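(* Let $M=(V,\mathrm{dist})$ be a metric space. Assume there is an algorithm $\mathcal{A}$ that, given $0<\varepsilon<1$, integers $k,z\ge1$ and an $n$-point dataset from $M$, constructs an $\varepsilon$-coreset for $(k,z)$-Clustering of size $N(n,k,\varepsilon^{-1})$ in time $T(n,k,\varepsilon^{-1})$. Then there is an algorithm that, given $0<\varepsilon<1$, integers $k,z,m\ge1$, an $n$-point dataset $X\subseteq V$ and a $(2^{O(z)},O(1),O(1))$-approximation solution $C^*\subseteq V$ to $(k,z,m)$-Clustering on $X$, constructs an $\varepsilon$-coreset $S$ of $X$ for $(k,z,m)$-Clustering. This algorithm invokes $\mathcal{A}$ a constant number of times, runs in time $\tilde O(nk)+T(n,k,O(\varepsilon^{-1}))$, and $|S|\le 2^{O(z\log z)}\cdot O(km\varepsilon^{-1})+N(n,k,O(\varepsilon^{-1}))$.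
   Context: The metric is accessed through a distance oracle. A weighted set is a finite set $S$ with weights $w_S:S\to\mathbb{R}_{\ge0}$; an unweighted set has all weights $1$. For weighted sets, $(Y,w_Y)\subseteq(X,w_X)$ means $Y\subseteq X$ and $w_Y\le w_X$ on $Y$; $X-Y$ is the weighted set with weight function $w_X-w_Y$. For $C\subseteq V$, $\mathrm{dist}(x,C)=\min_{c\in C}\mathrm{dist}(x,c)$, $\mathrm{cost}_z(X,C)=\sum_{x\in X}w_X(x)\mathrm{dist}(x,C)^z$, and for real $h\ge0$, $\mathrm{cost}_z^{(h)}(X,C)=\min\{\mathrm{cost}_z(X-Y,C):(Y,w_Y)\subseteq(X,w_X),\,w_Y(Y)=h\}$. $(k,z,m)$-Clustering minimizes $\mathrm{cost}_z^{(m)}(X,C)$ over $C\in V^k$, with optimum $\mathrm{OPT}_z^{(m)}(X)$; $(k,z)$-Clustering is the case $m=0$. A weighted $S\subseteq X$ is an $\varepsilon$-coreset of $X$ for $(k,z,m)$-Clustering if for all $C\in V^k$ and all real $0\le h\le m$, $\mathrm{cost}_z^{(h)}(S,C)\in[(1-\varepsilon),(1+\varepsilon)]\cdot\mathrm{cost}_z^{(h)}(X,C)$ (for $(k,z)$-Clustering take $m=0$). For $\alpha,\beta,\gamma\ge1$, a set $C\subseteq V$ is an $(\alpha,\beta,\gamma)$-approximation solution to $(k,z,m)$-Clustering on $X$ if $|C|\le\beta k$ and $\mathrm{cost}_z^{(\gamma m)}(X,C)\le\alpha\cdot\mathrm{OPT}_z^{(m)}(X)$.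
   Formalization: The bounds N(n,k,1/ε) and T(n,k,1/ε) are assumed nondecreasing in n (for k≥1, 1/ε>1); without this the claim fails literally, since the size at n can be small because of one far outlier while the dataset without it needs a large coreset. *)

theory Defs
  imports "HOL-Analysis.Analysis"
begin

section \<open>Weighted sets, costs and coresets\<close>

type_synonym 'v wset = "'v set \<times> ('v \<Rightarrow> real)"

definition weighted_set :: "'v wset \<Rightarrow> bool" where
  "weighted_set X \<longleftrightarrow> finite (fst X) \<and> (\<forall>x\<in>fst X. 0 \<le> snd X x)"

definition unweighted :: "'v set \<Rightarrow> 'v wset" where
  "unweighted X = (X, \<lambda>_. 1)"

definition weight :: "'v wset \<Rightarrow> real" where
  "weight X = sum (snd X) (fst X)"

definition wsubset :: "'v wset \<Rightarrow> 'v wset \<Rightarrow> bool" where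
  "wsubset Y X \<longleftrightarrow> weighted_set Y \<and> fst Y \<subseteq> fst X \<and> (\<forall>x\<in>fst Y. snd Y x \<le> snd X x)"

definition wdiff :: "'v wset \<Rightarrow> 'v wset \<Rightarrow> 'v wset" where
  "wdiff X Y = (fst X, \<lambda>x. snd X x - (if x \<in> fst Y then snd Y x else 0))"

text \<open>Centre sets are always finite and nonempty below, so that the minimum is meaningful.\<close>

definition dist_to :: "('v \<Rightarrow> 'v \<Rightarrow> real) \<Rightarrow> 'v \<Rightarrow> 'v set \<Rightarrow> real" where
  "dist_to d x C = Min (d x ` C)"

definition cost :: "('v \<Rightarrow> 'v \<Rightarrow> real) \<Rightarrow> nat \<Rightarrow> 'v wset \<Rightarrow> 'v set \<Rightarrow> real" where
  "cost d z X C = (\<Sum>x\<in>fst X. snd X x * dist_to d x C ^ z)"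

text \<open>The infimum below is attained: it is that of a continuous function on a nonempty compact
  set.  If more weight is to be discarded than is present, then everything is discarded and the
  cost is \<open>0\<close>.\<close>

definition robust_cost ::
    "('v \<Rightarrow> 'v \<Rightarrow> real) \<Rightarrow> nat \<Rightarrow> real \<Rightarrow> 'v wset \<Rightarrow> 'v set \<Rightarrow> real" where
  "robust_cost d z h X C =
     (if h \<le> weight X
      then Inf {cost d z (wdiff X Y) C |Y. wsubset Y X \<and> weight Y = h}
      else 0)"

text \<open>The elements of $V^k$, seen as sets.\<close>

definition center_sets :: "'v set \<Rightarrow> nat \<Rightarrow> 'v set set" where
  "center_sets V k = set ` {cs. length cs = k \<and> set cs \<subseteq> V}"

definition opt_cost ::
    "'v set \<Rightarrow> ('v \<Rightarrow> 'v \<Rightarrow> real) \<Rightarrow> nat \<Rightarrow> nat \<Rightarrow> nat \<Rightarrow> 'v wset \<Rightarrow> real" where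
  "opt_cost V d k z m X = (INF C\<in>center_sets V k. robust_cost d z (real m) X C)"

text \<open>The weights of a coreset are arbitrary nonnegative reals; they are not bounded by those
  of \<open>X\<close>.\<close>

definition coreset ::
    "'v set \<Rightarrow> ('v \<Rightarrow> 'v \<Rightarrow> real) \<Rightarrow> real \<Rightarrow> nat \<Rightarrow> nat \<Rightarrow> nat \<Rightarrow> 'v wset \<Rightarrow> 'v wset \<Rightarrow> bool" where
  "coreset V d \<epsilon> k z m S X \<longleftrightarrow>
     weighted_set S \<and> fst S \<subseteq> fst X \<and>
     (\<forall>C\<in>center_sets V k. \<forall>h. 0 \<le> h \<and> h \<le> real m \<longrightarrow>
        robust_cost d z h S C
          \<in> {(1 - \<epsilon>) * robust_cost d z h X C .. (1 + \<epsilon>) * robust_cost d z h X C})"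

definition approx_solution ::
    "'v set \<Rightarrow> ('v \<Rightarrow> 'v \<Rightarrow> real) \<Rightarrow> real \<Rightarrow> real \<Rightarrow> real \<Rightarrow> nat \<Rightarrow> nat \<Rightarrow> nat
      \<Rightarrow> 'v set \<Rightarrow> 'v wset \<Rightarrow> bool" where
  "approx_solution V d \<alpha> \<beta> \<gamma> k z m C X \<longleftrightarrow>
     finite C \<and> C \<noteq> {} \<and> C \<subseteq> V \<and> real (card C) \<le> \<beta> * real k \<and>
     robust_cost d z (\<gamma> * real m) X C \<le> \<alpha> * opt_cost V d k z m X"

section \<open>Algorithms\<close>

text \<open>Algorithms are programs of a unit-cost random access machine that handles natural numbers
  (with addition and truncated subtraction only), reals (with field operations and comparisons,
  but no rounding) and points.  Points are opaque: they can only be copied and handed to the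
  distance oracle.  The memory for each of the three sorts consists of infinite arrays; the name
  of an array is fixed in the program, the index is computed.  Scalar variables are arrays used
  at one index.\<close>

record 'v state =
  nmem :: "nat \<Rightarrow> nat \<Rightarrow> nat"
  rmem :: "nat \<Rightarrow> nat \<Rightarrow> real"
  pmem :: "nat \<Rightarrow> nat \<Rightarrow> 'v option"

datatype nexp = NConst nat | NGet nat nexp | NAdd nexp nexp | NSub nexp nexp

datatype rexp =
  ROfNat nexp | RGet nat nexp | RAdd rexp rexp | RSub rexp rexp | RMul rexp rexp | RDiv rexp rexp

datatype bexp = NLess nexp nexp | RLess rexp rexp | BNot bexp | BAnd bexp bexp

text \<open>\<open>Query a i b j c l\<close> stores in the real cell \<open>a[i]\<close> the distance of the points in the cells
  \<open>b[j]\<close> and \<open>c[l]\<close>.  \<open>Invoke e k z a n b\<close> calls the subroutine with parameters \<open>e\<close>, \<open>k\<close>, \<open>z\<close> on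
  the first \<open>n\<close> points of the array \<open>a\<close>, and stores the weighted set it returns in the arrays
  named \<open>b\<close>.\<close>

datatype com =
    Skip
  | NAsg nat nexp nexp
  | RAsg nat nexp rexp
  | PAsg nat nexp nat nexp
  | Query nat nexp nat nexp nat nexp
  | Seq com com
  | Cond bexp com com
  | While bexp com
  | Invoke rexp nexp nexp nat nexp nat

fun nval :: "'v state \<Rightarrow> nexp \<Rightarrow> nat" where
  "nval s (NConst n) = n"
| "nval s (NGet a i) = nmem s a (nval s i)"
| "nval s (NAdd x y) = nval s x + nval s y"
| "nval s (NSub x y) = nval s x - nval s y"

fun rval :: "'v state \<Rightarrow> rexp \<Rightarrow> real" where
  "rval s (ROfNat x) = real (nval s x)"
| "rval s (RGet a i) = rmem s a (nval s i)"
| "rval s (RAdd x y) = rval s x + rval s y"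
| "rval s (RSub x y) = rval s x - rval s y"
| "rval s (RMul x y) = rval s x * rval s y"
| "rval s (RDiv x y) = rval s x / rval s y"

fun bval :: "'v state \<Rightarrow> bexp \<Rightarrow> bool" where
  "bval s (NLess x y) \<longleftrightarrow> nval s x < nval s y"
| "bval s (RLess x y) \<longleftrightarrow> rval s x < rval s y"
| "bval s (BNot b) \<longleftrightarrow> \<not> bval s b"
| "bval s (BAnd b c) \<longleftrightarrow> bval s b \<and> bval s c"

text \<open>Evaluating an expression takes one unit of time per node.\<close>

fun ntime :: "nexp \<Rightarrow> nat" where
  "ntime (NConst n) = 1"
| "ntime (NGet a i) = ntime i + 1"
| "ntime (NAdd x y) = ntime x + ntime y + 1"
| "ntime (NSub x y) = ntime x + ntime y + 1"

fun rtime :: "rexp \<Rightarrow> nat" where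
  "rtime (ROfNat x) = ntime x + 1"
| "rtime (RGet a i) = ntime i + 1"
| "rtime (RAdd x y) = rtime x + rtime y + 1"
| "rtime (RSub x y) = rtime x + rtime y + 1"
| "rtime (RMul x y) = rtime x + rtime y + 1"
| "rtime (RDiv x y) = rtime x + rtime y + 1"

fun btime :: "bexp \<Rightarrow> nat" where
  "btime (NLess x y) = ntime x + ntime y + 1"
| "btime (RLess x y) = rtime x + rtime y + 1"
| "btime (BNot b) = btime b + 1"
| "btime (BAnd b c) = btime b + btime c + 1"

definition nput :: "nat \<Rightarrow> nat \<Rightarrow> nat \<Rightarrow> 'v state \<Rightarrow> 'v state" where
  "nput a i x s = s\<lparr>nmem := (nmem s)(a := (nmem s a)(i := x))\<rparr>"

definition rput :: "nat \<Rightarrow> nat \<Rightarrow> real \<Rightarrow> 'v state \<Rightarrow> 'v state" where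
  "rput a i x s = s\<lparr>rmem := (rmem s)(a := (rmem s a)(i := x))\<rparr>"

definition pput :: "nat \<Rightarrow> nat \<Rightarrow> 'v option \<Rightarrow> 'v state \<Rightarrow> 'v state" where
  "pput a i x s = s\<lparr>pmem := (pmem s)(a := (pmem s a)(i := x))\<rparr>"

text \<open>A list of points is held in the initial cells of an array.\<close>

definition holds_points :: "'v state \<Rightarrow> nat \<Rightarrow> 'v list \<Rightarrow> bool" where
  "holds_points s a xs \<longleftrightarrow> (\<forall>i<length xs. pmem s a i = Some (xs ! i))"

text \<open>A program starts with its arguments in the arrays named \<open>0\<close> (and, for further lists of points,
  \<open>1\<close>, \<open>2\<close>, \<dots>) and with all other cells blank.\<close>

definition initial_state :: "nat list \<Rightarrow> real list \<Rightarrow> 'v list list \<Rightarrow> 'v state" where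
  "initial_state ns rs ps =
     \<lparr>nmem = \<lambda>a i. if a = 0 \<and> i < length ns then ns ! i else 0,
      rmem = \<lambda>a i. if a = 0 \<and> i < length rs then rs ! i else 0,
      pmem = \<lambda>a i. if a < length ps \<and> i < length (ps ! a) then Some (ps ! a ! i) else None\<rparr>"

text \<open>A program returns a weighted set as its size (natural number cell \<open>0[0]\<close>) and a
  repetition-free list of points with their weights (arrays named \<open>0\<close>).\<close>

definition returns :: "'v state \<Rightarrow> 'v wset \<Rightarrow> bool" where
  "returns s S \<longleftrightarrow>
     (\<exists>ps. distinct ps \<and> set ps = fst S \<and> nmem s 0 0 = length ps \<and> holds_points s 0 ps \<and>
           (\<forall>i<length ps. rmem s 0 i = snd S (ps ! i)))"

definition store_result :: "nat \<Rightarrow> 'v state \<Rightarrow> 'v state \<Rightarrow> 'v state" where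
  "store_result b r s =
     s\<lparr>nmem := (nmem s)(b := (nmem s b)(0 := nmem r 0 0)),
       rmem := (rmem s)(b := (\<lambda>i. if i < nmem r 0 0 then rmem r 0 i else rmem s b i)),
       pmem := (pmem s)(b := (\<lambda>i. if i < nmem r 0 0 then pmem r 0 i else pmem s b i))\<rparr>"

text \<open>\<open>exec d sub c s t q s'\<close>: with distance oracle \<open>d\<close>, the program \<open>c\<close> started in \<open>s\<close> terminates
  in \<open>s'\<close>, after \<open>t\<close> units of time and with \<open>q\<close> invocations of the subroutine.  The subroutine is
  given by its behaviour \<open>sub \<epsilon> k z xs t r\<close>: on these arguments it stops after time \<open>t\<close> in state \<open>r\<close>
  of its own memory.  Time spent in the subroutine and for passing arguments and results is
  counted.\<close>

inductive exec ::
    "('v \<Rightarrow> 'v \<Rightarrow> real) \<Rightarrow> (real \<Rightarrow> nat \<Rightarrow> nat \<Rightarrow> 'v list \<Rightarrow> nat \<Rightarrow> 'v state \<Rightarrow> bool)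
      \<Rightarrow> com \<Rightarrow> 'v state \<Rightarrow> nat \<Rightarrow> nat \<Rightarrow> 'v state \<Rightarrow> bool"
  for d :: "'v \<Rightarrow> 'v \<Rightarrow> real"
    and sub :: "real \<Rightarrow> nat \<Rightarrow> nat \<Rightarrow> 'v list \<Rightarrow> nat \<Rightarrow> 'v state \<Rightarrow> bool"
where
  Skip: "exec d sub Skip s 1 0 s"
| NAsg: "exec d sub (NAsg a i x) s (ntime i + ntime x + 1) 0 (nput a (nval s i) (nval s x) s)"
| RAsg: "exec d sub (RAsg a i x) s (ntime i + rtime x + 1) 0 (rput a (nval s i) (rval s x) s)"
| PAsg: "exec d sub (PAsg a i b j) s (ntime i + ntime j + 1) 0
           (pput a (nval s i) (pmem s b (nval s j)) s)"
| Query: "pmem s b (nval s j) = Some x \<Longrightarrow> pmem s c (nval s l) = Some y \<Longrightarrow>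
    exec d sub (Query a i b j c l) s (ntime i + ntime j + ntime l + 1) 0
      (rput a (nval s i) (d x y) s)"
| Seq: "exec d sub c1 s t1 q1 s1 \<Longrightarrow> exec d sub c2 s1 t2 q2 s2 \<Longrightarrow>
    exec d sub (Seq c1 c2) s (t1 + t2) (q1 + q2) s2"
| CondTrue: "bval s b \<Longrightarrow> exec d sub c1 s t q s' \<Longrightarrow>
    exec d sub (Cond b c1 c2) s (btime b + t + 1) q s'"
| CondFalse: "\<not> bval s b \<Longrightarrow> exec d sub c2 s t q s' \<Longrightarrow>
    exec d sub (Cond b c1 c2) s (btime b + t + 1) q s'"
| WhileFalse: "\<not> bval s b \<Longrightarrow> exec d sub (While b c) s (btime b + 1) 0 s"
| WhileTrue: "bval s b \<Longrightarrow> exec d sub c s t1 q1 s1 \<Longrightarrow> exec d sub (While b c) s1 t2 q2 s2 \<Longrightarrow>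
    exec d sub (While b c) s (btime b + t1 + t2 + 1) (q1 + q2) s2"
| Invoke: "length xs = nval s n \<Longrightarrow> holds_points s a xs \<Longrightarrow>
    sub (rval s e) (nval s k) (nval s z) xs t r \<Longrightarrow>
    exec d sub (Invoke e k z a n b) s
      (rtime e + ntime k + ntime z + ntime n + length xs + t + nmem r 0 0 + 1) 1
      (store_result b r s)"

inductive_cases SkipE: "exec d sub (Skip) s t q s'"
inductive_cases NAsgE: "exec d sub (NAsg a i x) s t q s'"
inductive_cases RAsgE: "exec d sub (RAsg a i x) s t q s'"
inductive_cases PAsgE: "exec d sub (PAsg a i b j) s t q s'"
inductive_cases QueryE: "exec d sub (Query a i b j c l) s t q s'"
inductive_cases SeqE: "exec d sub (Seq c1 c2) s t q s'"
inductive_cases CondE: "exec d sub (Cond b c1 c2) s t q s'"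
inductive_cases WhileE: "exec d sub (While b c) s t q s'"
inductive_cases InvokeE: "exec d sub (Invoke e k z a n b) s t q s'"

text \<open>The run of a program \<open>A\<close>, which itself invokes no subroutine, on an instance of
  $(k,z)$-clustering.\<close>

definition vanilla_run ::
    "('v \<Rightarrow> 'v \<Rightarrow> real) \<Rightarrow> com \<Rightarrow> real \<Rightarrow> nat \<Rightarrow> nat \<Rightarrow> 'v list \<Rightarrow> nat \<Rightarrow> 'v state \<Rightarrow> bool" where
  "vanilla_run d A \<epsilon> k z xs t r \<longleftrightarrow>
     exec d (\<lambda>_ _ _ _ _ _. False) A (initial_state [length xs, k, z] [\<epsilon>] [xs]) t 0 r"

text \<open>The run of a program \<open>P\<close> with subroutine \<open>A\<close> on an instance of $(k,z,m)$-clustering that comes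
  with a list of centres.\<close>

definition robust_run ::
    "('v \<Rightarrow> 'v \<Rightarrow> real) \<Rightarrow> com \<Rightarrow> com \<Rightarrow> real \<Rightarrow> nat \<Rightarrow> nat \<Rightarrow> nat \<Rightarrow> 'v list \<Rightarrow> 'v list
      \<Rightarrow> nat \<Rightarrow> nat \<Rightarrow> 'v state \<Rightarrow> bool" where
  "robust_run d A P \<epsilon> k z m xs cs t q r \<longleftrightarrow>
     exec d (vanilla_run d A) P
       (initial_state [length xs, k, z, m, length cs] [\<epsilon>] [xs, cs]) t q r"

text \<open>Execution is deterministic, so the existence of a run with certain properties says that
  the run has them.\<close>

lemma exec_deterministic:
  assumes "exec d sub c s t q s'" and "exec d sub c s t' q' s''"
    and det: "\<And>\<epsilon> k z xs t r t' r'. sub \<epsilon> k z xs t r \<Longrightarrow> sub \<epsilon> k z xs t' r' \<Longrightarrow> t = t' \<and> r = r'"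
  shows "t = t' \<and> q = q' \<and> s' = s''"
  using assms(1,2)
proof (induction arbitrary: t' q' s'' rule: exec.induct)
  case (Skip s)
  then show ?case by (elim SkipE) simp
next
  case (NAsg a i x s)
  then show ?case by (elim NAsgE) simp
next
  case (RAsg a i x s)
  then show ?case by (elim RAsgE) simp
next
  case (PAsg a i b j s)
  then show ?case by (elim PAsgE) simp
next
  case (Query s b j x c l y a i)
  from Query.prems Query.hyps show ?case by (elim QueryE) simp
next
  case (Seq c1 s t1 q1 s1 c2 t2 q2 s2)
  from Seq.prems show ?case
  proof (rule SeqE)
    fix u1 p1 r u2 p2
    assume eq: "t' = u1 + u2" "q' = p1 + p2"
      and run: "exec d sub c1 s u1 p1 r" "exec d sub c2 r u2 p2 s''"
    have 1: "t1 = u1 \<and> q1 = p1 \<and> s1 = r" by (rule Seq.IH(1)[OF run(1)])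
    with run(2) have "exec d sub c2 s1 u2 p2 s''" by simp
    from Seq.IH(2)[OF this] 1 eq show ?thesis by simp
  qed
next
  case (CondTrue s b c1 t q s' c2)
  from CondTrue.prems show ?case
  proof (rule CondE)
    fix u
    assume eq: "t' = Suc (btime b + u)" and run: "exec d sub c1 s u q' s''"
    from CondTrue.IH[OF run] eq show ?thesis by simp
  next
    assume "\<not> bval s b"
    with CondTrue.hyps(1) show ?thesis by contradiction
  qed
next
  case (CondFalse s b c2 t q s' c1)
  from CondFalse.prems show ?case
  proof (rule CondE)
    assume "bval s b"
    with CondFalse.hyps(1) show ?thesis by contradiction
  next
    fix u
    assume eq: "t' = Suc (btime b + u)" and run: "exec d sub c2 s u q' s''"
    from CondFalse.IH[OF run] eq show ?thesis by simp
  qed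
next
  case (WhileFalse s b c)
  from WhileFalse.prems show ?case
    by (rule WhileE) (use WhileFalse.hyps in simp_all)
next
  case (WhileTrue s b c t1 q1 s1 t2 q2 s2)
  from WhileTrue.prems show ?case
  proof (rule WhileE)
    assume "\<not> bval s b"
    with WhileTrue.hyps(1) show ?thesis by contradiction
  next
    fix u1 p1 r u2 p2
    assume eq: "t' = Suc (btime b + u1 + u2)" "q' = p1 + p2"
      and run: "exec d sub c s u1 p1 r" "exec d sub (While b c) r u2 p2 s''"
    have 1: "t1 = u1 \<and> q1 = p1 \<and> s1 = r" by (rule WhileTrue.IH(1)[OF run(1)])
    with run(2) have "exec d sub (While b c) s1 u2 p2 s''" by simp
    from WhileTrue.IH(2)[OF this] 1 eq show ?thesis by simp
  qed
next
  case (Invoke xs s n a e k z t r b)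
  from Invoke.prems show ?case
  proof (rule InvokeE)
    fix ys t2 r2
    assume ys: "length ys = nval s n" "holds_points s a ys"
        "sub (rval s e) (nval s k) (nval s z) ys t2 r2"
      and eq: "t' = Suc (rtime e + ntime k + ntime z + ntime n + nval s n + t2 + nmem r2 0 0)"
        "q' = Suc 0" "s'' = store_result b r2 s"
    have "ys = xs"
      using ys(1,2) Invoke.hyps(1,2) unfolding holds_points_def by (metis nth_equalityI option.inject)
    with ys(3) Invoke.hyps(3) det have "t2 = t \<and> r2 = r"
      by blast
    with Invoke.hyps(1) eq show ?thesis by simp
  qed
qed

text \<open>The dataset is presented to the program as a repetition-free list in arbitrary order.\<close>

definition vanilla_coreset_algorithm ::
    "'v set \<Rightarrow> ('v \<Rightarrow> 'v \<Rightarrow> real) \<Rightarrow> com \<Rightarrow> (nat \<Rightarrow> nat \<Rightarrow> real \<Rightarrow> real)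
      \<Rightarrow> (nat \<Rightarrow> nat \<Rightarrow> real \<Rightarrow> real) \<Rightarrow> bool" where
  "vanilla_coreset_algorithm V d A N T \<longleftrightarrow>
     (\<forall>\<epsilon> k z n xs. 0 < \<epsilon> \<and> \<epsilon> < 1 \<and> 1 \<le> k \<and> 1 \<le> z \<and> 1 \<le> n \<and>
        length xs = n \<and> distinct xs \<and> set xs \<subseteq> V \<longrightarrow>
        (\<exists>t r S. vanilla_run d A \<epsilon> k z xs t r \<and> returns r S \<and>
           coreset V d \<epsilon> k z 0 S (unweighted (set xs)) \<and>
           real (card (fst S)) \<le> N n k (1 / \<epsilon>) \<and>
           real t \<le> T n k (1 / \<epsilon>)))"

end

theory Submission
  imports Defs
begin

text \<open>Split the dataset into clusters according to the nearest point of \<open>C\<^sup>*\<close>, and peel off from each cluster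
  the \<open>K\<close> points that are farthest from the centre and the \<open>K\<close> points that are nearest to it, where
  \<open>K = 2\<^bsup>O(z)\<^esup> m / \<epsilon>\<close>.  The peeled points \<open>F\<close> are kept with weight one.  For any point \<open>x\<close> of the rest
  \<open>D\<close> and any centre set \<open>C\<close>, even \<open>m\<close> copies of \<open>x\<close> cost at most an \<open>\<epsilon>/3\<close> fraction of the robust cost:
  otherwise \<open>x\<close>, hence the \<open>K\<close> points of its cluster nearer to the centre, would be far from \<open>C\<close>, or else the
  \<open>K\<close> points farther from the centre would make \<open>C\<^sup>*\<close> too expensive.  So discarding from
  \<open>D\<close> is negligible, the robust cost of the dataset is the robust cost of \<open>F\<close> plus the plain cost of \<open>D\<close>, and \<open>D\<close> may
  be replaced by a coreset for plain clustering.  As the negligibility concerns points and not weights,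
  that coreset need not preserve the total weight.

  Peeling needs the points of each cluster in the order of their distance to the centre, which a tournament tree
  provides in time \<open>O(n log n)\<close>.\<close>

section \<open>Robust costs\<close>

text \<open>The bound \<open>K\<close> has two summands. In the guarantee for the given centres up
  to \<open>\<gamma> * m\<close> far points may be discarded, so that many are written off. The
  remaining \<open>4 ^ z * \<alpha> * m / \<delta>\<close> points must pay for \<open>m\<close>
  copies of \<open>x\<close>: \<open>\<alpha>\<close> is the loss of the approximation, and
  \<open>4 ^ z\<close> comes from comparing \<open>dist_to d x C\<close> with four times the
  distance of \<open>x\<close> to its centre. Since \<open>\<alpha>\<close> is itself a constant to
  the power \<open>z\<close>, a single power \<open>b ^ z\<close> dominates both exponentials.

  The precision is split in three: one third is lost to the subroutine, one third to discarding from
  \<open>D\<close>, and the last absorbs the product of these errors.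

  Two features of the model shape the program. Naturals can only be added and subtracted, so a power
  of two is found by doubling and parents in the tree are tabulated. And the subroutine is specified
  for nonempty datasets only, so an empty \<open>D\<close> is a case of its own, in which the peeled
  points are already the whole dataset.\<close>

lemma fst_wdiff [simp]: "fst (wdiff X Y) = fst X"
  by (simp add: wdiff_def)

lemma weighted_set_wdiff: "weighted_set X \<Longrightarrow> wsubset Y X \<Longrightarrow> weighted_set (wdiff X Y)"
  by (auto simp: weighted_set_def wsubset_def wdiff_def)

lemma sum_restrict_subset:
  fixes f g :: "'v \<Rightarrow> real"
  assumes "finite B" "A \<subseteq> B"
  shows "(\<Sum>x\<in>B. (if x \<in> A then f x else 0) * g x) = (\<Sum>x\<in>A. f x * g x)"
proof -
  have "(\<Sum>x\<in>B. (if x \<in> A then f x else 0) * g x) = (\<Sum>x\<in>A. (if x \<in> A then f x else 0) * g x)"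
    by (rule sum.mono_neutral_right) (use assms in auto)
  then show ?thesis by simp
qed

lemma cost_wdiff:
  assumes "weighted_set X" "wsubset Y X"
  shows "cost d z (wdiff X Y) C = cost d z X C - cost d z Y C"
  using sum_restrict_subset[of "fst X" "fst Y" "snd Y" "\<lambda>x. dist_to d x C ^ z"] assms
  by (simp add: cost_def wdiff_def wsubset_def weighted_set_def left_diff_distrib sum_subtractf)

lemma cost_nonneg:
  assumes "weighted_set X" "\<And>x. x \<in> fst X \<Longrightarrow> 0 \<le> dist_to d x C"
  shows "0 \<le> cost d z X C"
  using assms by (auto simp: cost_def weighted_set_def intro!: sum_nonneg)

lemma weight_nonneg: "weighted_set X \<Longrightarrow> 0 \<le> weight X"
  by (auto simp: weight_def weighted_set_def intro!: sum_nonneg)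

text \<open>The definition admits only sets of weight exactly \<open>h\<close>. A lighter
  \<open>Y\<close> is enlarged by moving its weights proportionally towards those of
  \<open>X\<close>, which cannot decrease what is saved.\<close>

lemma robust_cost_le:
  assumes X: "weighted_set X" and Y: "wsubset Y X" and h: "weight Y \<le> h" "h \<le> weight X"
    and nn: "\<And>x. x \<in> fst X \<Longrightarrow> 0 \<le> dist_to d x C"
  shows "robust_cost d z h X C \<le> cost d z X C - cost d z Y C"
proof -
  define y where "y x = (if x \<in> fst Y then snd Y x else 0)" for x
  \<comment> \<open>If \<open>weight Y = weight X\<close>, the quotient is \<open>0 / 0 = 0\<close>,
    which is right because then \<open>h = weight Y\<close>.\<close>
  define l where "l = (h - weight Y) / (weight X - weight Y)"
  define Z where "Z = (fst X, \<lambda>x. y x + l * (snd X x - y x))"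
  have fin: "finite (fst X)" and sub: "fst Y \<subseteq> fst X"
    using X Y by (auto simp: weighted_set_def wsubset_def)
  have l: "0 \<le> l" "l \<le> 1" using h by (auto simp: l_def divide_le_eq_1)
  have y: "0 \<le> y x" "y x \<le> snd X x" if "x \<in> fst X" for x
    using X Y that by (auto simp: y_def weighted_set_def wsubset_def)
  have le: "y x \<le> snd Z x" if "x \<in> fst X" for x
    using y[OF that] l by (simp add: Z_def)
  have "wsubset Z X"
    unfolding wsubset_def weighted_set_def
  proof (intro conjI ballI)
    fix x assume "x \<in> fst Z"
    then have x: "x \<in> fst X" by (simp add: Z_def)
    show "0 \<le> snd Z x" using y[OF x] le[OF x] by simp
    have "l * (snd X x - y x) \<le> 1 * (snd X x - y x)"
      by (rule mult_right_mono) (use l y[OF x] in auto)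
    then show "snd Z x \<le> snd X x" by (simp add: Z_def)
  qed (use fin in \<open>auto simp: Z_def\<close>)
  have sumy: "sum y (fst X) = weight Y"
    using sum_restrict_subset[OF fin sub, of "snd Y" "\<lambda>_. 1"] by (simp add: y_def weight_def)
  have "weight Z = weight Y + l * (weight X - weight Y)"
    by (simp add: weight_def Z_def sum.distrib sum_distrib_left[symmetric] sum_subtractf
        sumy[unfolded weight_def])
  also have "\<dots> = h" using h by (auto simp: l_def)
  finally have wZ: "weight Z = h" .
  have "cost d z Y C = (\<Sum>x\<in>fst X. y x * dist_to d x C ^ z)"
    using sum_restrict_subset[OF fin sub, of "snd Y" "\<lambda>x. dist_to d x C ^ z"]
    by (simp add: cost_def y_def)
  also have "\<dots> \<le> cost d z Z C"
    unfolding cost_def using le nn by (auto simp: Z_def intro!: sum_mono mult_right_mono)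
  finally have YZ: "cost d z Y C \<le> cost d z Z C" .
  have "robust_cost d z h X C = Inf {cost d z (wdiff X Y) C |Y. wsubset Y X \<and> weight Y = h}"
    using h by (simp add: robust_cost_def)
  also have "\<dots> \<le> cost d z (wdiff X Z) C"
  proof (rule cInf_lower)
    show "cost d z (wdiff X Z) C \<in> {cost d z (wdiff X Y) C |Y. wsubset Y X \<and> weight Y = h}"
      using \<open>wsubset Z X\<close> wZ by blast
    have "0 \<le> v" if "v \<in> {cost d z (wdiff X Y) C |Y. wsubset Y X \<and> weight Y = h}" for v
      using that X nn by (auto intro!: cost_nonneg weighted_set_wdiff)
    then show "bdd_below {cost d z (wdiff X Y) C |Y. wsubset Y X \<and> weight Y = h}"
      by (rule bdd_belowI)
  qed
  finally show ?thesis using YZ cost_wdiff[OF X \<open>wsubset Z X\<close>, of d z C] by simp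
qed

text \<open>A bound on all members bounds \<open>Inf\<close> only for a nonempty set, so an
  admissible set must be exhibited: \<open>X\<close> scaled down to weight \<open>h\<close>.\<close>

lemma robust_cost_ge:
  assumes X: "weighted_set X" and h: "0 \<le> h" "h \<le> weight X"
    and B: "\<And>Y. wsubset Y X \<Longrightarrow> weight Y = h \<Longrightarrow> B \<le> cost d z X C - cost d z Y C"
  shows "B \<le> robust_cost d z h X C"
proof -
  \<comment> \<open>If \<open>weight X = 0\<close>, the factor is \<open>0 / 0 = 0\<close>, and
    \<open>h = 0\<close> too.\<close>
  define Z where "Z = (fst X, \<lambda>x. (h / weight X) * snd X x)"
  have "0 \<le> h / weight X" "h / weight X \<le> 1" using h by (auto simp: divide_le_eq_1)
  then have "wsubset Z X"
    using X mult_right_mono[of "h / weight X" 1]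
    by (fastforce simp: wsubset_def weighted_set_def Z_def simp del: times_divide_eq_left)
  moreover have "weight Z = h"
  proof -
    have "weight Z = (h / weight X) * weight X"
      unfolding weight_def Z_def fst_conv snd_conv sum_distrib_left[symmetric] ..
    also have "\<dots> = h" using h by auto
    finally show ?thesis .
  qed
  ultimately have ne: "{cost d z (wdiff X Y) C |Y. wsubset Y X \<and> weight Y = h} \<noteq> {}" by blast
  have "B \<le> Inf {cost d z (wdiff X Y) C |Y. wsubset Y X \<and> weight Y = h}"
    by (rule cInf_greatest[OF ne]) (use B cost_wdiff[OF X] in fastforce)
  then show ?thesis using h by (simp add: robust_cost_def)
qed

lemma robust_cost_nonneg:
  assumes X: "weighted_set X" and h: "0 \<le> h"
    and nn: "\<And>x. x \<in> fst X \<Longrightarrow> 0 \<le> dist_to d x C"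
  shows "0 \<le> robust_cost d z h X C"
proof (cases "h \<le> weight X")
  case True
  show ?thesis
  proof (rule robust_cost_ge[OF X h True])
    fix Y assume Y: "wsubset Y X"
    have "0 \<le> cost d z (wdiff X Y) C"
      by (rule cost_nonneg[OF weighted_set_wdiff[OF X Y]]) (use nn in auto)
    then show "0 \<le> cost d z X C - cost d z Y C" by (simp add: cost_wdiff[OF X Y])
  qed
qed (simp add: robust_cost_def)

lemma robust_cost_antimono:
  assumes X: "weighted_set X" and h: "0 \<le> h" "h \<le> h'"
    and nn: "\<And>x. x \<in> fst X \<Longrightarrow> 0 \<le> dist_to d x C"
  shows "robust_cost d z h' X C \<le> robust_cost d z h X C"
proof (cases "h' \<le> weight X")
  case True
  show ?thesis
    by (rule robust_cost_ge[OF X h(1)]) (use h True robust_cost_le[OF X _ _ _ nn] in auto)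
next
  case False
  then show ?thesis using robust_cost_nonneg[OF X h(1) nn] by (simp add: robust_cost_def)
qed

text \<open>This turns a coreset for \<open>m = 0\<close> into a statement on plain costs. A
  discarded set of weight zero may contain points, but all its weights vanish.\<close>

lemma robust_cost_zero:
  assumes X: "weighted_set X" and nn: "\<And>x. x \<in> fst X \<Longrightarrow> 0 \<le> dist_to d x C"
  shows "robust_cost d z 0 X C = cost d z X C"
proof (rule antisym)
  show "robust_cost d z 0 X C \<le> cost d z X C"
    using robust_cost_le[OF X, of "({}, \<lambda>_. 0)" 0 d C z] nn weight_nonneg[OF X]
    by (simp add: wsubset_def weighted_set_def weight_def cost_def)
  show "cost d z X C \<le> robust_cost d z 0 X C"
  proof (rule robust_cost_ge[OF X])
    fix Y assume Y: "wsubset Y X" "weight Y = 0"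
    then have "\<forall>y\<in>fst Y. snd Y y = 0"
      by (simp add: weight_def wsubset_def weighted_set_def sum_nonneg_eq_0_iff)
    then show "cost d z X C \<le> cost d z X C - cost d z Y C" by (simp add: cost_def)
  qed (simp_all add: weight_nonneg[OF X])
qed

lemma weighted_set_unweighted [simp]: "weighted_set (unweighted X) \<longleftrightarrow> finite X"
  and weight_unweighted [simp]: "weight (unweighted X) = real (card X)"
  and fst_unweighted [simp]: "fst (unweighted X) = X"
  and snd_unweighted [simp]: "snd (unweighted X) x = 1"
  by (simp_all add: weighted_set_def unweighted_def weight_def)

text \<open>Discarding weight \<open>h\<close> takes at most \<open>h\<close> away from
  \<open>A\<close>, and each unit that remains costs at least \<open>v\<close>.\<close>

lemma robust_cost_ge_subset:
  assumes X: "finite X" and A: "A \<subseteq> X" and h: "0 \<le> h" "h \<le> real (card X)"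
    and nn: "\<And>x. x \<in> X \<Longrightarrow> 0 \<le> dist_to d x C"
    and v: "0 \<le> v" "\<And>x. x \<in> A \<Longrightarrow> v \<le> dist_to d x C ^ z"
  shows "(real (card A) - h) * v \<le> robust_cost d z h (unweighted X) C"
proof (rule robust_cost_ge)
  fix Y assume Y: "wsubset Y (unweighted X)" "weight Y = h"
  define y where "y x = (if x \<in> fst Y then snd Y x else 0)" for x
  have sub: "fst Y \<subseteq> X" using Y by (auto simp: wsubset_def)
  have y: "0 \<le> y x" "y x \<le> 1" for x
    using Y by (auto simp: y_def weighted_set_def wsubset_def)
  have finA: "finite A" using A X finite_subset by blast
  have "sum y A \<le> sum y X" by (rule sum_mono2) (use X A y in auto)
  also have "\<dots> = h"
    using sum_restrict_subset[OF X sub, of "snd Y" "\<lambda>_. 1"] Y(2) by (simp add: y_def weight_def)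
  finally have "(real (card A) - h) * v \<le> (real (card A) - sum y A) * v"
    using v(1) by (simp add: mult_right_mono)
  also have "\<dots> = (\<Sum>x\<in>A. (1 - y x) * v)"
    by (simp add: sum_subtractf left_diff_distrib sum_distrib_right)
  also have "\<dots> \<le> (\<Sum>x\<in>A. (1 - y x) * dist_to d x C ^ z)"
    by (intro sum_mono mult_left_mono) (use v y in auto)
  also have "\<dots> \<le> (\<Sum>x\<in>X. (1 - y x) * dist_to d x C ^ z)"
    by (rule sum_mono2) (use X A y nn in auto)
  also have "\<dots> = cost d z (unweighted X) C - cost d z Y C"
    using sum_restrict_subset[OF X sub, of "snd Y" "\<lambda>x. dist_to d x C ^ z"]
    by (simp add: cost_def y_def left_diff_distrib sum_subtractf)
  finally show "(real (card A) - h) * v \<le> cost d z (unweighted X) C - cost d z Y C" .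
qed (use X h in auto)

section \<open>Adjoining points of weight one\<close>

definition wunion :: "'v set \<Rightarrow> 'v wset \<Rightarrow> 'v wset" where
  "wunion F W = (F \<union> fst W, \<lambda>x. if x \<in> F then 1 else snd W x)"

lemma wunion_unweighted: "wunion F (unweighted D) = unweighted (F \<union> D)"
  by (auto simp: wunion_def unweighted_def)

lemma fst_wunion [simp]: "fst (wunion F W) = F \<union> fst W"
  by (simp add: wunion_def)

lemma weighted_set_wunion: "finite F \<Longrightarrow> weighted_set W \<Longrightarrow> weighted_set (wunion F W)"
  by (auto simp: weighted_set_def wunion_def)

lemma
  assumes "finite F" "weighted_set W" "F \<inter> fst W = {}"
  shows cost_wunion: "cost d z (wunion F W) C = cost d z (unweighted F) C + cost d z W C"
    and weight_wunion: "weight (wunion F W) = real (card F) + weight W"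
proof -
  have *: "(if x \<in> F then 1 else snd W x) = snd W x" if "x \<in> fst W" for x
    using assms(3) that by auto
  show "cost d z (wunion F W) C = cost d z (unweighted F) C + cost d z W C"
    unfolding cost_def wunion_def fst_conv snd_conv
    by (subst sum.union_disjoint) (use assms * in \<open>simp_all add: weighted_set_def\<close>)
  show "weight (wunion F W) = real (card F) + weight W"
    unfolding weight_def wunion_def fst_conv snd_conv
    by (subst sum.union_disjoint) (use assms * in \<open>simp_all add: weighted_set_def\<close>)
qed

text \<open>Whatever is discarded from \<open>F\<close> may also be discarded from the union. The
  bound of \<open>h\<close> by \<open>card F\<close> keeps clear of the convention that the robust
  cost of \<open>F\<close> is \<open>0\<close> beyond it.\<close>

lemma robust_cost_wunion_le:
  assumes F: "finite F" and W: "weighted_set W" and disj: "F \<inter> fst W = {}"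
    and h: "0 \<le> h" "h \<le> real (card F)"
    and nn: "\<And>x. x \<in> F \<union> fst W \<Longrightarrow> 0 \<le> dist_to d x C"
  shows "robust_cost d z h (wunion F W) C \<le> robust_cost d z h (unweighted F) C + cost d z W C"
proof -
  have "robust_cost d z h (wunion F W) C - cost d z W C \<le> robust_cost d z h (unweighted F) C"
  proof (rule robust_cost_ge)
    fix Y assume Y: "wsubset Y (unweighted F)" "weight Y = h"
    have "wsubset Y (wunion F W)"
      using Y(1) by (auto simp: wsubset_def wunion_def subset_iff)
    then have "robust_cost d z h (wunion F W) C \<le> cost d z (wunion F W) C - cost d z Y C"
      by (rule robust_cost_le[OF weighted_set_wunion[OF F W]])
        (use Y h nn weight_wunion[OF F W disj] weight_nonneg[OF W] in auto)
    then show "robust_cost d z h (wunion F W) C - cost d z W C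
        \<le> cost d z (unweighted F) C - cost d z Y C"
      by (simp add: cost_wunion[OF F W disj])
  qed (use F h in auto)
  then show ?thesis by simp
qed

lemma robust_cost_wunion_ge:
  assumes F: "finite F" and W: "weighted_set W" and disj: "F \<inter> fst W = {}"
    and h: "0 \<le> h" "h \<le> real (card F)"
    and nn: "\<And>x. x \<in> F \<union> fst W \<Longrightarrow> 0 \<le> dist_to d x C"
    and R: "0 \<le> R" "\<And>x. x \<in> fst W \<Longrightarrow> dist_to d x C ^ z \<le> R"
  shows "robust_cost d z h (unweighted F) C + cost d z W C - h * R
      \<le> robust_cost d z h (wunion F W) C"
proof (rule robust_cost_ge)
  fix Y assume Y: "wsubset Y (wunion F W)" "weight Y = h"
  define Y1 where "Y1 = (fst Y \<inter> F, snd Y)"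
  define Y2 where "Y2 = (fst Y - F, snd Y)"
  have fin: "finite (fst Y)" and pos: "\<And>y. y \<in> fst Y \<Longrightarrow> 0 \<le> snd Y y"
    using Y by (auto simp: wsubset_def weighted_set_def)
  have split: "fst Y = (fst Y \<inter> F) \<union> (fst Y - F)" by blast
  have c: "cost d z Y C = cost d z Y1 C + cost d z Y2 C"
    unfolding cost_def Y1_def Y2_def fst_conv snd_conv
    by (subst split, subst sum.union_disjoint) (use fin in auto)
  have w: "weight Y = weight Y1 + weight Y2"
    unfolding weight_def Y1_def Y2_def fst_conv snd_conv
    by (subst split, subst sum.union_disjoint) (use fin in auto)
  have w2: "0 \<le> weight Y1" "0 \<le> weight Y2"
    using pos by (auto simp: weight_def Y1_def Y2_def intro!: sum_nonneg)
  have sub2: "fst Y2 \<subseteq> fst W" using Y(1) by (auto simp: Y2_def wsubset_def)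
  have "cost d z Y2 C \<le> (\<Sum>x\<in>fst Y2. snd Y2 x * R)"
    unfolding cost_def
    by (intro sum_mono mult_left_mono) (use R sub2 pos in \<open>auto simp: Y2_def\<close>)
  also have "\<dots> = weight Y2 * R" by (simp add: weight_def sum_distrib_right)
  also have "\<dots> \<le> h * R" using w w2 Y(2) R(1) by (simp add: mult_right_mono)
  finally have 2: "cost d z Y2 C \<le> h * R" .
  have "wsubset Y1 (unweighted F)"
    using Y(1) by (auto simp: Y1_def wsubset_def wunion_def weighted_set_def split: if_splits)
  then have "robust_cost d z h (unweighted F) C \<le> cost d z (unweighted F) C - cost d z Y1 C"
    by (rule robust_cost_le[rotated]) (use F Y w w2 h nn in auto)
  then show "robust_cost d z h (unweighted F) C + cost d z W C - h * R
      \<le> cost d z (wunion F W) C - cost d z Y C"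
    using c 2 by (simp add: cost_wunion[OF F W disj])
qed (use h weight_wunion[OF F W disj] weight_nonneg[OF W] weighted_set_wunion[OF F W] in auto)

lemma center_setsD:
  assumes "C \<in> center_sets V k" "1 \<le> k"
  shows "finite C" "C \<noteq> {}" "C \<subseteq> V"
  using assms by (auto simp: center_sets_def)

section \<open>Negligible points and the gluing of coresets\<close>

context Metric_space
begin

lemma dist_to_nonneg: "finite C \<Longrightarrow> C \<noteq> {} \<Longrightarrow> 0 \<le> dist_to d x C"
  by (simp add: dist_to_def)

lemma dist_to_triangle:
  assumes "finite C" "C \<noteq> {}" "C \<subseteq> M" "x \<in> M" "y \<in> M"
  shows "dist_to d x C \<le> d x y + dist_to d y C"
proof -
  have "Min (d y ` C) \<in> d y ` C" using assms by (intro Min_in) auto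
  then obtain c where c: "c \<in> C" "dist_to d y C = d y c" unfolding dist_to_def by auto
  have "dist_to d x C \<le> d x c" using assms c by (simp add: dist_to_def)
  also have "\<dots> \<le> d x y + d y c" using assms c by (intro triangle) auto
  finally show ?thesis using c by simp
qed

text \<open>If \<open>C\<close> is close to \<open>x\<close>, then the points of the cluster that are farther than \<open>x\<close> from the
  centre make the optimum large; otherwise the points that are nearer make \<open>C\<close> expensive.\<close>

lemma dense_point_negligible:
  assumes X: "finite X" "X \<subseteq> M" and m: "1 \<le> m" and k: "1 \<le> k"
    and apx: "approx_solution M d \<alpha> \<beta> \<gamma> k z m Cs (unweighted X)"
    and \<alpha>: "1 \<le> \<alpha>" and \<gamma>: "1 \<le> \<gamma>" and \<delta>: "0 < \<delta>"
    and K: "\<gamma> * real m + 4 ^ z * \<alpha> * real m / \<delta> \<le> K"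
    and x: "x \<in> X" and c: "c \<in> M"
    and far: "A \<subseteq> X" "K \<le> real (card A)" "\<And>y. y \<in> A \<Longrightarrow> d x c \<le> dist_to d y Cs"
    and near: "B \<subseteq> X" "K \<le> real (card B)" "\<And>y. y \<in> B \<Longrightarrow> d y c \<le> d x c"
    and C: "C \<in> center_sets M k" and h: "0 \<le> h" "h \<le> real m"
  shows "real m * dist_to d x C ^ z \<le> \<delta> * robust_cost d z h (unweighted X) C"
proof -
  note C' = center_setsD[OF C k]
  have nn: "0 \<le> dist_to d y C" for y using C' by (intro dist_to_nonneg)
  define \<rho> where "\<rho> = robust_cost d z h (unweighted X) C"
  \<comment> \<open>So many points at distance at least \<open>dist_to d x C / 4\<close> from
    \<open>C\<close> suffice for the claim. After \<open>\<gamma> * m\<close> points are written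
    off, \<open>K\<close> still leaves \<open>\<alpha> * b\<close>, and \<open>\<alpha>\<close> will
    cancel against the approximation factor.\<close>
  define b where "b = 4 ^ z * real m / \<delta>"
  have b: "0 < b" using m \<delta> by (simp add: b_def)
  have K': "\<gamma> * real m + \<alpha> * b \<le> K" using K by (simp add: b_def mult_ac)
  have gm: "real m \<le> \<gamma> * real m" using \<gamma> m by simp
  have ab: "b \<le> \<alpha> * b" using \<alpha> b by simp
  have "card A \<le> card X" using far(1) X by (intro card_mono)
  then have cX: "\<gamma> * real m \<le> real (card X)" "real m \<le> real (card X)"
    using K' far(2) ab b gm by linarith+
  have *: "b * (dist_to d x C / 4) ^ z \<le> \<rho>"
  \<comment> \<open>A point \<open>y\<close> of \<open>B\<close> has
    \<open>d x y \<le> 2 * d x c\<close>. In the second case this is less than half of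
    \<open>dist_to d x C\<close>, so more than the required quarter is left for
    \<open>y\<close>.\<close>
  proof (cases "dist_to d x C \<le> 4 * d x c")
    case True
    have fCs: "finite Cs" "Cs \<noteq> {}" using apx by (auto simp: approx_solution_def)
    have "\<alpha> * b * d x c ^ z \<le> (real (card A) - \<gamma> * real m) * d x c ^ z"
      using K' far(2) by (intro mult_right_mono) auto
    also have "\<dots> \<le> robust_cost d z (\<gamma> * real m) (unweighted X) Cs"
      using far(1) cX \<gamma>
      by (intro robust_cost_ge_subset X dist_to_nonneg[OF fCs] power_mono far(3)) auto
    also have "\<dots> \<le> \<alpha> * opt_cost M d k z m (unweighted X)"
      using apx by (simp add: approx_solution_def)
    also have "opt_cost M d k z m (unweighted X) \<le> robust_cost d z (real m) (unweighted X) C"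
      unfolding opt_cost_def
    proof (rule cINF_lower[OF _ C], rule bdd_belowI2)
      fix C' assume "C' \<in> center_sets M k"
      from center_setsD[OF this k] show "0 \<le> robust_cost d z (real m) (unweighted X) C'"
        using X by (intro robust_cost_nonneg dist_to_nonneg) auto
    qed
    \<comment> \<open>The optimum discards weight \<open>m\<close>; discarding only
      \<open>h \<le> m\<close> costs at least as much.\<close>
    also have "robust_cost d z (real m) (unweighted X) C \<le> \<rho>"
      unfolding \<rho>_def using X h nn by (intro robust_cost_antimono) auto
    finally have "\<alpha> * (b * d x c ^ z) \<le> \<alpha> * \<rho>" using \<alpha> by (simp add: mult_left_mono mult_ac)
    then have "b * d x c ^ z \<le> \<rho>" using \<alpha> by simp
    moreover have "(dist_to d x C / 4) ^ z \<le> d x c ^ z" using True nn by (intro power_mono) auto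
    ultimately show ?thesis using b by (meson less_imp_le mult_left_mono order_trans)
  next
    case False
    have ge: "dist_to d x C / 4 \<le> dist_to d y C" if y: "y \<in> B" for y
    proof -
      have yX: "y \<in> M" "x \<in> M" using y near(1) X x by auto
      have "dist_to d x C \<le> d x y + dist_to d y C" using C' yX by (intro dist_to_triangle)
      moreover have "d x y \<le> d x c + d c y" using yX c by (intro triangle)
      moreover have "d c y \<le> d x c" using near(3)[OF y] by (simp add: commute)
      ultimately show ?thesis using False nn[of x] by linarith
    qed
    have "b * (dist_to d x C / 4) ^ z \<le> (real (card B) - h) * (dist_to d x C / 4) ^ z"
      using K' near(2) gm ab h nn[of x] by (intro mult_right_mono) auto
    also have "\<dots> \<le> \<rho>"
      unfolding \<rho>_def using near(1) h cX nn
      by (intro robust_cost_ge_subset X power_mono ge) auto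
    finally show ?thesis .
  qed
  have "b * (dist_to d x C / 4) ^ z = real m * dist_to d x C ^ z / \<delta>"
    by (simp add: b_def power_divide)
  with * have "real m * dist_to d x C ^ z / \<delta> \<le> \<rho>" by simp
  then show ?thesis using \<delta> by (simp add: \<rho>_def pos_divide_le_eq mult.commute)
qed

text \<open>Both robust costs fall below \<open>f + e\<close> and \<open>f + w\<close> respectively
  by at most \<open>h * R\<close>, and exceed neither, while \<open>e\<close> and \<open>w\<close>
  differ by at most \<open>(\<epsilon> / 3) * e\<close>. The bound \<open>m \<le> card F\<close>
  allows every \<open>h\<close> to be discarded inside \<open>F\<close>.\<close>

lemma coreset_wunion:
  assumes F: "finite F" and D: "finite D" and disj: "F \<inter> D = {}"
    and k: "1 \<le> k" and m: "1 \<le> m" "m \<le> card F" and \<epsilon>: "0 < \<epsilon>" "\<epsilon> < 1"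
    and W: "coreset M d (\<epsilon> / 3) k z 0 W (unweighted D)"
    and negl: "\<And>x C h. x \<in> D \<Longrightarrow> C \<in> center_sets M k \<Longrightarrow> 0 \<le> h \<Longrightarrow> h \<le> real m \<Longrightarrow>
      real m * dist_to d x C ^ z \<le> (\<epsilon> / 3) * robust_cost d z h (unweighted (F \<union> D)) C"
  shows "coreset M d \<epsilon> k z m (wunion F W) (unweighted (F \<union> D))"
proof -
  have wW: "weighted_set W" and sW: "fst W \<subseteq> D" using W by (auto simp: coreset_def)
  have disjW: "F \<inter> fst W = {}" using sW disj by auto
  have "robust_cost d z h (wunion F W) C \<in> {(1 - \<epsilon>) * robust_cost d z h (unweighted (F \<union> D)) C ..
      (1 + \<epsilon>) * robust_cost d z h (unweighted (F \<union> D)) C}"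
    if C: "C \<in> center_sets M k" and h: "0 \<le> h" "h \<le> real m" for C h
  proof -
    note C' = center_setsD[OF C k]
    have nn: "0 \<le> dist_to d y C" for y using C' by (intro dist_to_nonneg)
    define \<rho> where "\<rho> = robust_cost d z h (unweighted (F \<union> D)) C"
    define \<sigma> where "\<sigma> = robust_cost d z h (wunion F W) C"
    define f where "f = robust_cost d z h (unweighted F) C"
    define e where "e = cost d z (unweighted D) C"
    define w where "w = cost d z W C"
    have \<rho>0: "0 \<le> \<rho>" and f0: "0 \<le> f" and e0: "0 \<le> e"
      unfolding \<rho>_def f_def e_def using F D h nn
      by (auto intro!: robust_cost_nonneg cost_nonneg)
    have we: "(1 - \<epsilon> / 3) * e \<le> w" "w \<le> (1 + \<epsilon> / 3) * e"
    proof -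
      have "robust_cost d z 0 W C = w" "robust_cost d z 0 (unweighted D) C = e"
        unfolding w_def e_def using D wW nn by (auto intro!: robust_cost_zero)
      moreover have "robust_cost d z 0 W C \<in> {(1 - \<epsilon> / 3) * robust_cost d z 0 (unweighted D) C ..
          (1 + \<epsilon> / 3) * robust_cost d z 0 (unweighted D) C}"
        using W C unfolding coreset_def by (metis of_nat_0 order_refl)
      ultimately show "(1 - \<epsilon> / 3) * e \<le> w" "w \<le> (1 + \<epsilon> / 3) * e" by simp_all
    qed
    \<comment> \<open>The bound on the cost of one point of \<open>D\<close> that negligibility
      provides; discarding weight at most \<open>m\<close> there saves no more than
      \<open>(\<epsilon> / 3) * \<rho>\<close>.\<close>
    define R where "R = (\<epsilon> / 3) * \<rho> / real m"
    have R0: "0 \<le> R" using \<rho>0 \<epsilon> by (simp add: R_def)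
    have R: "dist_to d x C ^ z \<le> R" if "x \<in> D" for x
      using negl[OF that C h] m by (simp add: R_def \<rho>_def field_simps)
    have "h * R \<le> real m * R" using h R0 by (intro mult_right_mono)
    also have "\<dots> = (\<epsilon> / 3) * \<rho>" using m by (simp add: R_def)
    finally have hR: "h * R \<le> (\<epsilon> / 3) * \<rho>" .
    have hF: "h \<le> real (card F)" using h m by linarith
    have 1: "\<rho> \<le> f + e"
      using robust_cost_wunion_le[OF F _ _ h(1) hF, of "unweighted D" d C z] D disj nn
      by (simp add: wunion_unweighted \<rho>_def f_def e_def)
    have 2: "f + e - h * R \<le> \<rho>"
      using robust_cost_wunion_ge[OF F _ _ h(1) hF _ R0, of "unweighted D" d C z] D disj nn R
      by (simp add: wunion_unweighted \<rho>_def f_def e_def)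
    have 3: "\<sigma> \<le> f + w"
      using robust_cost_wunion_le[OF F wW disjW h(1) hF, of d C z] nn
      by (simp add: \<sigma>_def f_def w_def)
    have 4: "f + w - h * R \<le> \<sigma>"
      using robust_cost_wunion_ge[OF F wW disjW h(1) hF _ R0, of d C z] nn R sW
      by (auto simp: \<sigma>_def f_def w_def)
    have \<epsilon>f: "0 \<le> \<epsilon> / 3 * f" using f0 \<epsilon> by simp
    have "\<sigma> \<le> (1 + \<epsilon> / 3) * (f + e)"
    proof -
      have "(1 + \<epsilon> / 3) * (f + e) = f + \<epsilon> / 3 * f + (1 + \<epsilon> / 3) * e"
        by (simp add: algebra_simps)
      then show ?thesis using 3 we(2) \<epsilon>f by linarith
    qed
    also have "\<dots> \<le> (1 + \<epsilon> / 3) * ((1 + \<epsilon> / 3) * \<rho>)"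
      using 2 hR \<epsilon> by (intro mult_left_mono) (auto simp: algebra_simps)
    also have "\<dots> = ((1 + \<epsilon> / 3) * (1 + \<epsilon> / 3)) * \<rho>" by (simp only: mult_ac)
    also have "\<dots> \<le> (1 + \<epsilon>) * \<rho>"
    proof (intro mult_right_mono \<rho>0)
      have "\<epsilon> * \<epsilon> \<le> \<epsilon> * 3" using \<epsilon> by (intro mult_left_mono) auto
      then show "(1 + \<epsilon> / 3) * (1 + \<epsilon> / 3) \<le> 1 + \<epsilon>" by (simp add: algebra_simps)
    qed
    finally have up: "\<sigma> \<le> (1 + \<epsilon>) * \<rho>" .
    have "(1 - \<epsilon>) * \<rho> \<le> (1 - \<epsilon> / 3) * \<rho> - (\<epsilon> / 3) * \<rho>"
      using \<rho>0 \<epsilon> by (simp add: algebra_simps)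
    also have "\<dots> \<le> (1 - \<epsilon> / 3) * (f + e) - h * R"
      using 1 hR \<epsilon> by (intro diff_mono mult_left_mono) auto
    also have "\<dots> \<le> \<sigma>"
    proof -
      have "(1 - \<epsilon> / 3) * (f + e) = f - \<epsilon> / 3 * f + (1 - \<epsilon> / 3) * e"
        by (simp add: algebra_simps)
      then show ?thesis using 4 we(1) \<epsilon>f by linarith
    qed
    finally show ?thesis using up by (simp add: \<rho>_def \<sigma>_def)
  qed
  then show ?thesis
    using weighted_set_wunion[OF F wW] sW by (auto simp: coreset_def)
qed

end

section \<open>Weakest preconditions\<close>

text \<open>Total correctness, with the running time as an argument of the postcondition. The number
  of invocations is fixed to \<open>0\<close>: the single \<open>Invoke\<close> of the program is
  treated by \<open>exec\<close> directly.\<close>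

definition wp ::
    "('v \<Rightarrow> 'v \<Rightarrow> real) \<Rightarrow> (real \<Rightarrow> nat \<Rightarrow> nat \<Rightarrow> 'v list \<Rightarrow> nat \<Rightarrow> 'v state \<Rightarrow> bool)
      \<Rightarrow> com \<Rightarrow> (nat \<Rightarrow> 'v state \<Rightarrow> bool) \<Rightarrow> 'v state \<Rightarrow> bool" where
  "wp d sub c Q s \<longleftrightarrow> (\<exists>t s'. exec d sub c s t 0 s' \<and> Q t s')"

lemma wp_Skip: "wp d sub Skip Q s \<longleftrightarrow> Q 1 s"
  by (auto simp: wp_def intro: exec.Skip[simplified] elim: SkipE)

lemma wp_NAsg:
  "wp d sub (NAsg a i x) Q s \<longleftrightarrow> Q (ntime i + ntime x + 1) (nput a (nval s i) (nval s x) s)"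
  by (auto simp: wp_def intro: exec.NAsg[simplified] elim: NAsgE)

lemma wp_RAsg:
  "wp d sub (RAsg a i x) Q s \<longleftrightarrow> Q (ntime i + rtime x + 1) (rput a (nval s i) (rval s x) s)"
  by (auto simp: wp_def intro: exec.RAsg[simplified] elim: RAsgE)

lemma wp_PAsg:
  "wp d sub (PAsg a i b j) Q s \<longleftrightarrow>
     Q (ntime i + ntime j + 1) (pput a (nval s i) (pmem s b (nval s j)) s)"
  by (auto simp: wp_def intro: exec.PAsg[simplified] elim: PAsgE)

lemma wp_Query:
  "wp d sub (Query a i b j c l) Q s \<longleftrightarrow>
     (\<exists>x y. pmem s b (nval s j) = Some x \<and> pmem s c (nval s l) = Some y \<and>
        Q (ntime i + ntime j + ntime l + 1) (rput a (nval s i) (d x y) s))"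
  by (fastforce simp: wp_def intro: exec.Query[simplified] elim: QueryE)

lemma wp_Seq:
  "wp d sub (Seq c1 c2) Q s \<longleftrightarrow> wp d sub c1 (\<lambda>t1. wp d sub c2 (\<lambda>t2. Q (t1 + t2))) s"
proof
  assume "wp d sub (Seq c1 c2) Q s"
  then obtain t s' where "exec d sub (Seq c1 c2) s t 0 s'" "Q t s'" by (auto simp: wp_def)
  then show "wp d sub c1 (\<lambda>t1. wp d sub c2 (\<lambda>t2. Q (t1 + t2))) s"
    by (elim SeqE) (auto simp: wp_def)
next
  assume "wp d sub c1 (\<lambda>t1. wp d sub c2 (\<lambda>t2. Q (t1 + t2))) s"
  then obtain t1 s1 t2 s' where
    "exec d sub c1 s t1 0 s1" "exec d sub c2 s1 t2 0 s'" "Q (t1 + t2) s'"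
    by (auto simp: wp_def)
  then show "wp d sub (Seq c1 c2) Q s"
    using exec.Seq by (fastforce simp: wp_def)
qed

lemma wp_Cond:
  "wp d sub (Cond b c1 c2) Q s \<longleftrightarrow>
     (if bval s b then wp d sub c1 (\<lambda>t. Q (btime b + t + 1)) s
      else wp d sub c2 (\<lambda>t. Q (btime b + t + 1)) s)"
  by (auto simp: wp_def intro: exec.CondTrue[simplified] exec.CondFalse[simplified] elim!: CondE)

lemmas wp_simps = wp_Skip wp_NAsg wp_RAsg wp_PAsg wp_Query wp_Seq wp_Cond

lemma wp_mono: "wp d sub c Q s \<Longrightarrow> (\<And>t s'. Q t s' \<Longrightarrow> Q' t s') \<Longrightarrow> wp d sub c Q' s"
  by (auto simp: wp_def)

section \<open>Frame conditions\<close>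

fun nmod :: "com \<Rightarrow> nat set" where
  "nmod (NAsg a i x) = {a}"
| "nmod (Seq c1 c2) = nmod c1 \<union> nmod c2"
| "nmod (Cond b c1 c2) = nmod c1 \<union> nmod c2"
| "nmod (While b c) = nmod c"
| "nmod (Invoke e k z a n b) = {b}"
| "nmod _ = {}"

fun rmod :: "com \<Rightarrow> nat set" where
  "rmod (RAsg a i x) = {a}"
| "rmod (Query a i b j c l) = {a}"
| "rmod (Seq c1 c2) = rmod c1 \<union> rmod c2"
| "rmod (Cond b c1 c2) = rmod c1 \<union> rmod c2"
| "rmod (While b c) = rmod c"
| "rmod (Invoke e k z a n b) = {b}"
| "rmod _ = {}"

fun pmod :: "com \<Rightarrow> nat set" where
  "pmod (PAsg a i b j) = {a}"
| "pmod (Seq c1 c2) = pmod c1 \<union> pmod c2"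
| "pmod (Cond b c1 c2) = pmod c1 \<union> pmod c2"
| "pmod (While b c) = pmod c"
| "pmod (Invoke e k z a n b) = {b}"
| "pmod _ = {}"

text \<open>The unit is a whole array, so an invariant has to speak only about the arrays that its
  loop writes.\<close>

definition frame :: "com \<Rightarrow> 'v state \<Rightarrow> 'v state \<Rightarrow> bool" where
  "frame c s s' \<longleftrightarrow> (\<forall>a. a \<notin> nmod c \<longrightarrow> nmem s' a = nmem s a) \<and>
     (\<forall>a. a \<notin> rmod c \<longrightarrow> rmem s' a = rmem s a) \<and> (\<forall>a. a \<notin> pmod c \<longrightarrow> pmem s' a = pmem s a)"

lemma exec_frame: "exec d sub c s t q s' \<Longrightarrow> frame c s s'"
  by (induction rule: exec.induct)
    (auto simp: frame_def nput_def rput_def pput_def store_result_def)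

lemma wp_frame: "wp d sub c Q s \<Longrightarrow> wp d sub c (\<lambda>t s'. Q t s' \<and> frame c s s') s"
  by (auto simp: wp_def intro: exec_frame)

lemma frame_refl: "frame c s s"
  by (simp add: frame_def)

lemma frame_trans: "frame c s s' \<Longrightarrow> frame c s' s'' \<Longrightarrow> frame c s s''"
  by (simp add: frame_def)

text \<open>The invariant is indexed by the number of iterations done. Requiring
  \<open>j < n\<close> whenever the test succeeds gives termination and the time bound at once; the
  frame relative to the initial state is supplied to each step.\<close>

lemma wp_While:
  assumes init: "I 0 s"
    and step: "\<And>j s'. I j s' \<Longrightarrow> frame c s s' \<Longrightarrow> bval s' b \<Longrightarrow>
      j < n \<and> wp d sub c (\<lambda>t s''. t \<le> B \<and> I (Suc j) s'') s'"
  shows "wp d sub (While b c) (\<lambda>t s'. t \<le> n * (B + btime b + 1) + btime b + 1 \<and>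
    \<not> bval s' b \<and> (\<exists>j\<le>n. I j s') \<and> frame c s s') s"
proof -
  have "wp d sub (While b c) (\<lambda>t s''. t \<le> (n - j) * (B + btime b + 1) + btime b + 1 \<and>
      \<not> bval s'' b \<and> (\<exists>j\<le>n. I j s'') \<and> frame c s s'') s'"
    if "I j s'" "j \<le> n" "frame c s s'" for j s'
    using that
  proof (induction "n - j" arbitrary: j s')
    case 0
    then have "\<not> bval s' b" using step by fastforce
    from this exec.WhileFalse[OF this] show ?case
      using 0 unfolding wp_def by (metis le_add2 add.assoc)
  next
    case (Suc m)
    show ?case
    proof (cases "bval s' b")
      case False
      from this exec.WhileFalse[OF this] show ?thesis
        using Suc.prems unfolding wp_def by (metis le_add2 add.assoc)
    next
      case True
      from step[OF Suc.prems(1,3) True] obtain t1 s1 where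
        j: "j < n" and 1: "exec d sub c s' t1 0 s1" "t1 \<le> B" "I (Suc j) s1"
        by (auto simp: wp_def)
      have "frame c s s1" using exec_frame[OF 1(1)] Suc.prems(3) frame_trans by blast
      then have "wp d sub (While b c)
          (\<lambda>t s''. t \<le> (n - Suc j) * (B + btime b + 1) + btime b + 1 \<and>
            \<not> bval s'' b \<and> (\<exists>j\<le>n. I j s'') \<and> frame c s s'') s1"
        using Suc.hyps(2) j 1(3) by (intro Suc.hyps(1)) auto
      then obtain t2 s2 where
        2: "exec d sub (While b c) s1 t2 0 s2"
          "t2 \<le> (n - Suc j) * (B + btime b + 1) + btime b + 1"
          "\<not> bval s2 b \<and> (\<exists>j\<le>n. I j s2) \<and> frame c s s2"
        by (auto simp: wp_def)
      have "exec d sub (While b c) s' (btime b + t1 + t2 + 1) 0 s2"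
        using exec.WhileTrue[OF True 1(1) 2(1)] by simp
      moreover have "n - j = Suc (n - Suc j)" using j by simp
      then have "btime b + t1 + t2 + 1 \<le> (n - j) * (B + btime b + 1) + btime b + 1"
        using 1(2) 2(2) by simp
      ultimately show ?thesis using 2(3) unfolding wp_def by blast
    qed
  qed
  from this[OF init _ frame_refl] show ?thesis by simp
qed

text \<open>Scalar variables live in cell \<open>0\<close> of their array.\<close>

abbreviation "nvar a \<equiv> NGet a (NConst 0)"
abbreviation "rvar a \<equiv> RGet a (NConst 0)"
abbreviation "incr a \<equiv> NAsg a (NConst 0) (NAdd (nvar a) (NConst 1))"

lemmas put_defs = nput_def rput_def pput_def

section \<open>The program\<close>

text \<open>Use of the arrays.  Natural numbers: \<open>0\<close> input and result size, \<open>1\<close> index of the nearest centre,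
  \<open>2\<close> parent in the tournament tree, \<open>3\<close> sorted order, \<open>4\<close> cluster sizes, \<open>5\<close> number of points of a
  cluster met so far, \<open>6\<close> number of leaves, \<open>7\<close> and \<open>8\<close> loop variables, \<open>9\<close> and \<open>10\<close> lengths of the
  point arrays \<open>2\<close> and \<open>3\<close>, \<open>11\<close> temporary.  Reals: \<open>0\<close> precision and result weights, \<open>1\<close> distances to
  the centres, \<open>2\<close> tournament tree, \<open>3\<close> number of points to be peeled off, \<open>4\<close> temporary.  Points: \<open>0\<close> dataset
  and result, \<open>1\<close> centres, \<open>2\<close> points kept with weight one, \<open>3\<close> points handed to the subroutine.\<close>

definition assign_inner :: com where
  "assign_inner =
    Seq (Query 4 (NConst 0) 0 (nvar 7) 1 (nvar 8))
   (Seq (Cond (RLess (rvar 4) (RGet 1 (nvar 7)))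
          (Seq (RAsg 1 (nvar 7) (rvar 4)) (NAsg 1 (nvar 7) (nvar 8))) Skip)
        (incr 8))"

definition assign_body :: com where
  "assign_body =
    Seq (Query 1 (nvar 7) 0 (nvar 7) 1 (NConst 0))
   (Seq (NAsg 1 (nvar 7) (NConst 0))
   (Seq (NAsg 8 (NConst 0) (NConst 1))
   (Seq (While (NLess (nvar 8) (NGet 0 (NConst 4))) assign_inner)
   (Seq (NAsg 4 (NGet 1 (nvar 7)) (NAdd (NGet 4 (NGet 1 (nvar 7))) (NConst 1)))
        (incr 7)))))"

definition assign_prog :: com where
  "assign_prog = Seq (NAsg 7 (NConst 0) (NConst 0))
     (While (NLess (nvar 7) (nvar 0)) assign_body)"

text \<open>The prefix length \<open>l\<close> lets the same predicate serve as invariant of the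
  minimum search, from \<open>l = 1\<close> up to all centres.\<close>

definition nearest :: "('v \<Rightarrow> 'v \<Rightarrow> real) \<Rightarrow> 'v list \<Rightarrow> 'v \<Rightarrow> nat \<Rightarrow> real \<Rightarrow> nat \<Rightarrow> bool" where
  "nearest d cs x i r l \<longleftrightarrow> i < l \<and> r = d x (cs ! i) \<and> (\<forall>c<l. r \<le> d x (cs ! c))"

lemma assign_inner:
  fixes s :: "'v state"
  assumes "nmem s 0 4 = length cs" "pmem s 0 (nmem s 7 0) = Some x" "holds_points s 1 cs"
    and "1 \<le> length cs" "nmem s 8 0 = 1" "nmem s 1 (nmem s 7 0) = 0"
    and "rmem s 1 (nmem s 7 0) = d x (cs ! 0)"
  shows "wp d sub (While (NLess (nvar 8) (NGet 0 (NConst 4))) assign_inner)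
    (\<lambda>t s'. t \<le> 40 * length cs + 10 \<and>
       nearest d cs x (nmem s' 1 (nmem s 7 0)) (rmem s' 1 (nmem s 7 0)) (length cs) \<and>
       (\<forall>j. j \<noteq> nmem s 7 0 \<longrightarrow> nmem s' 1 j = nmem s 1 j \<and> rmem s' 1 j = rmem s 1 j) \<and>
       frame assign_inner s s') s"
proof -
  define I where "I j s' \<longleftrightarrow> nmem s' 8 0 = Suc j \<and> Suc j \<le> length cs \<and>
    nearest d cs x (nmem s' 1 (nmem s 7 0)) (rmem s' 1 (nmem s 7 0)) (Suc j) \<and>
    (\<forall>j. j \<noteq> nmem s 7 0 \<longrightarrow> nmem s' 1 j = nmem s 1 j \<and> rmem s' 1 j = rmem s 1 j)"
    for j and s' :: "'v state"
  show ?thesis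
  proof (rule wp_mono[OF wp_While[where I = I and n = "length cs" and B = 32]])
    show "I 0 s" using assms by (auto simp: I_def nearest_def)
  next
    fix j s'
    assume "I j s'" "frame assign_inner s s'" "bval s' (NLess (nvar 8) (NGet 0 (NConst 4)))"
    then show "j < length cs \<and> wp d sub assign_inner (\<lambda>t s''. t \<le> 32 \<and> I (Suc j) s'') s'"
      using assms by (auto simp: I_def nearest_def assign_inner_def frame_def holds_points_def
        wp_simps put_defs less_Suc_eq split: if_splits)
  qed (use assms in \<open>auto simp: I_def assign_inner_def frame_def\<close>)
qed

lemma assign_prog:
  fixes s :: "'v state"
  assumes n: "nmem s 0 0 = length xs" and l: "nmem s 0 4 = length cs" "1 \<le> length cs"
    and xs: "holds_points s 0 xs" and cs: "holds_points s 1 cs" and cnt: "nmem s 4 = (\<lambda>_. 0)"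
  shows "wp d sub assign_prog
    (\<lambda>t s'. t \<le> length xs * (40 * length cs + 60) + 20 \<and>
       (\<forall>j<length xs. nearest d cs (xs ! j) (nmem s' 1 j) (rmem s' 1 j) (length cs)) \<and>
       (\<forall>c. nmem s' 4 c = card {j. j < length xs \<and> nmem s' 1 j = c})) s"
proof -
  define I where "I j s' \<longleftrightarrow> nmem s' 7 0 = j \<and> j \<le> length xs \<and>
    (\<forall>i<j. nearest d cs (xs ! i) (nmem s' 1 i) (rmem s' 1 i) (length cs)) \<and>
    (\<forall>c. nmem s' 4 c = card {i. i < j \<and> nmem s' 1 i = c})"
    for j and s' :: "'v state"
  define s0 where "s0 = nput 7 0 0 s"
  have loop: "wp d sub (While (NLess (nvar 7) (nvar 0)) assign_body)
    (\<lambda>t s'. t \<le> length xs * ((40 * length cs + 50) + btime (NLess (nvar 7) (nvar 0)) + 1)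
        + btime (NLess (nvar 7) (nvar 0)) + 1 \<and>
      \<not> bval s' (NLess (nvar 7) (nvar 0)) \<and> (\<exists>j\<le>length xs. I j s') \<and> frame assign_body s0 s') s0"
  proof (rule wp_While)
    show "I 0 s0" using cnt by (simp add: I_def s0_def put_defs)
  next
    fix j s'
    assume I: "I j s'" and fr: "frame assign_body s0 s'" and b: "bval s' (NLess (nvar 7) (nvar 0))"
    have fr': "nmem s' 0 = nmem s 0" "pmem s' 0 = pmem s 0" "pmem s' 1 = pmem s 1"
      using fr by (simp_all add: frame_def assign_body_def assign_inner_def s0_def put_defs)
    have j: "nmem s' 7 0 = j" "j < length xs" using I b n fr' by (auto simp: I_def)
    have c0: "pmem s' 1 0 = Some (cs ! 0)" using cs l fr' by (simp add: holds_points_def Suc_le_eq)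
    have xj: "pmem s' 0 j = Some (xs ! j)" using xs j fr' by (simp add: holds_points_def)
    let ?s = "nput 8 0 1 (nput 1 j 0 (rput 1 j (d (xs ! j) (cs ! 0)) s'))"
    have "wp d sub (While (NLess (nvar 8) (NGet 0 (NConst 4))) assign_inner)
      (\<lambda>t s''. t \<le> 40 * length cs + 10 \<and>
       nearest d cs (xs ! j) (nmem s'' 1 (nmem ?s 7 0)) (rmem s'' 1 (nmem ?s 7 0)) (length cs) \<and>
       (\<forall>j. j \<noteq> nmem ?s 7 0 \<longrightarrow> nmem s'' 1 j = nmem ?s 1 j \<and> rmem s'' 1 j = rmem ?s 1 j) \<and>
       frame assign_inner ?s s'') ?s"
      by (rule assign_inner)
        (use l fr' j xj cs in \<open>simp_all add: put_defs holds_points_def\<close>)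
    then have "wp d sub assign_body (\<lambda>t s''. t \<le> 40 * length cs + 50 \<and> I (Suc j) s'') s'"
      unfolding assign_body_def
      apply (simp add: wp_simps j xj c0[simplified] put_defs)
      apply (erule wp_mono)
      subgoal premises p for t s''
      proof -
        have q: "nmem s'' 7 = nmem s' 7" "nmem s'' 4 = nmem s' 4"
          "\<And>i. i \<noteq> j \<Longrightarrow> nmem s'' 1 i = nmem s' 1 i" "\<And>i. i \<noteq> j \<Longrightarrow> rmem s'' 1 i = rmem s' 1 i"
          "nearest d cs (xs ! j) (nmem s'' 1 j) (rmem s'' 1 j) (length cs)" "t \<le> 40 * length cs + 10"
          using p j by (simp_all add: frame_def assign_inner_def put_defs)
        \<comment> \<open>Earlier points keep their centres, so only the cluster that receives
          \<open>j\<close> grows.\<close>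
        have "{i. i < Suc j \<and> nmem s'' 1 i = c} =
          (if c = nmem s'' 1 j then insert j else id) {i. i < j \<and> nmem s' 1 i = c}" for c
          using q(3) by (auto simp: less_Suc_eq)
        then have "card {i. i < Suc j \<and> nmem s'' 1 i = c} =
          (if c = nmem s'' 1 j then Suc (nmem s' 4 c) else nmem s' 4 c)" for c
          using I by (simp add: I_def)
        then show ?thesis
          using I q j by (auto simp: wp_simps I_def put_defs less_Suc_eq)
      qed
      done
    with j show "j < length xs \<and> wp d sub assign_body (\<lambda>t s''. t \<le> 40 * length cs + 50 \<and> I (Suc j) s'') s'"
      by simp
  qed
  show ?thesis
    unfolding assign_prog_def wp_Seq wp_NAsg nval.simps
    apply (fold s0_def)
    apply (rule wp_mono[OF loop])
    subgoal for t s'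
      using n by (auto simp: I_def frame_def assign_body_def assign_inner_def s0_def put_defs algebra_simps)
    done
qed

text \<open>Multiplying up to the bound on \<open>K\<close> would take time proportional to \<open>z\<close>; since clusters have at
  most \<open>n\<close> points, the loop may stop once \<open>K\<close> reaches \<open>n\<close>.\<close>

definition bound_body :: "nat \<Rightarrow> com" where
  "bound_body b = Seq (RAsg 3 (NConst 0) (RMul (rvar 3) (ROfNat (NConst b)))) (incr 7)"

definition bound_test :: bexp where
  "bound_test = BAnd (NLess (nvar 7) (NGet 0 (NConst 2))) (RLess (rvar 3) (ROfNat (nvar 0)))"

definition bound_prog :: "nat \<Rightarrow> nat \<Rightarrow> com" where
  "bound_prog g b =
    Seq (RAsg 3 (NConst 0) (RDiv (RMul (ROfNat (NConst g)) (ROfNat (NGet 0 (NConst 3)))) (rvar 0)))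
   (Seq (NAsg 7 (NConst 0) (NConst 0))
        (While bound_test (bound_body b)))"

lemma bound_prog:
  fixes s :: "'v state"
  assumes K0: "K0 = real g * real (nmem s 0 3) / rmem s 0 0" "1 \<le> K0" and b: "2 \<le> b"
    and L: "nmem s 0 0 \<le> 2 ^ L"
  shows "wp d sub (bound_prog g b)
    (\<lambda>t s'. t \<le> 40 * L + 60 \<and> (\<exists>i\<le>nmem s 0 2. rmem s' 3 0 = K0 * real b ^ i \<and>
       (i = nmem s 0 2 \<or> real (nmem s 0 0) \<le> rmem s' 3 0))) s"
proof -
  define I where "I j s' \<longleftrightarrow> nmem s' 7 0 = j \<and> j \<le> nmem s 0 2 \<and> rmem s' 3 0 = K0 * real b ^ j"
    for j and s' :: "'v state"
  define s0 where "s0 = nput 7 0 0 (rput 3 0 K0 s)"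
  have loop: "wp d sub (While bound_test (bound_body b))
    (\<lambda>t s'. t \<le> L * (20 + btime bound_test + 1) + btime bound_test + 1 \<and>
      \<not> bval s' bound_test \<and> (\<exists>j\<le>L. I j s') \<and> frame (bound_body b) s0 s') s0"
  proof (rule wp_While)
    show "I 0 s0" by (simp add: I_def s0_def put_defs)
  next
    fix j s'
    assume I: "I j s'" and fr: "frame (bound_body b) s0 s'" and bt: "bval s' bound_test"
    have fr': "nmem s' 0 = nmem s 0"
      using fr by (simp add: frame_def bound_body_def s0_def put_defs)
    \<comment> \<open>Because \<open>1 \<le> K0\<close> and \<open>2 \<le> b\<close>, the value at
      least doubles in each round and reaches the number of points within \<open>L\<close> rounds,
      however large the exponent is.\<close>
    have "real (2 ^ j) \<le> real b ^ j" using b by (simp add: power_mono)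
    also have "\<dots> \<le> K0 * real b ^ j"
      using mult_right_mono[OF K0(2), of "real b ^ j"] by simp
    also have "\<dots> < real (nmem s 0 0)" using bt I fr' by (simp add: I_def bound_test_def)
    finally have "2 ^ j < nmem s 0 0" by (simp only: of_nat_less_iff)
    then have "(2::nat) ^ j < 2 ^ L" using L by linarith
    then have "j < L" by simp
    moreover have "wp d sub (bound_body b) (\<lambda>t s''. t \<le> 20 \<and> I (Suc j) s'') s'"
      using I bt fr' by (simp add: I_def bound_test_def bound_body_def wp_simps put_defs)
    ultimately show "j < L \<and> wp d sub (bound_body b) (\<lambda>t s''. t \<le> 20 \<and> I (Suc j) s'') s'" ..
  qed
  show ?thesis
    unfolding bound_prog_def wp_Seq wp_NAsg wp_RAsg
    apply (simp flip: s0_def K0(1))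
    apply (rule wp_mono[OF loop])
    subgoal for t s'
      by (auto simp: I_def frame_def bound_test_def bound_body_def s0_def put_defs)
    done
qed

text \<open>Leaves \<open>N, \<dots>, 2N - 1\<close>, children \<open>2i\<close> and \<open>2i + 1\<close>, and \<open>-1\<close> for an absent leaf.\<close>

definition winner :: "(nat \<Rightarrow> real) \<Rightarrow> nat \<Rightarrow> bool" where
  "winner f i \<longleftrightarrow> f i = max (f (i + i)) (f (i + i + 1))"

definition tournament :: "nat \<Rightarrow> (nat \<Rightarrow> real) \<Rightarrow> bool" where
  "tournament N f \<longleftrightarrow> (\<forall>i. 1 \<le> i \<longrightarrow> i < N \<longrightarrow> winner f i)"

text \<open>No node exceeds its parent \<open>i div 2\<close>, and passing to parents leads to node
  \<open>1\<close>.\<close>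

lemma tournament_root:
  assumes "tournament N f" "1 \<le> i" "i < N + N"
  shows "f i \<le> f 1"
  using assms(2,3)
proof (induction i rule: less_induct)
  case (less i)
  show ?case
  proof (cases "i = 1")
    case False
    define p where "p = i div 2"
    have p: "1 \<le> p" "p < i" "p < N" "i = p + p \<or> i = p + p + 1"
      using False less.prems by (auto simp: p_def)
    then have "f i \<le> f p" using assms(1) by (auto simp: tournament_def winner_def)
    also have "\<dots> \<le> f 1" using p by (intro less.IH) auto
    finally show ?thesis .
  qed simp
qed

section \<open>Building the tournament tree\<close>

definition double_prog :: com where
  "double_prog = Seq (NAsg 6 (NConst 0) (NConst 1))
     (While (NLess (nvar 6) (nvar 0)) (NAsg 6 (NConst 0) (NAdd (nvar 6) (nvar 6))))"

text \<open>A power of two puts all leaves at the same depth; that it is at most twice the number of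
  points keeps the tree linear in size.\<close>

lemma double_prog:
  fixes s :: "'v state"
  assumes L: "nmem s 0 0 \<le> 2 ^ L" and n: "1 \<le> nmem s 0 0"
  shows "wp d sub double_prog
    (\<lambda>t s'. t \<le> 20 * L + 20 \<and> (\<exists>e\<le>L. nmem s' 6 0 = 2 ^ e) \<and>
       nmem s 0 0 \<le> nmem s' 6 0 \<and> nmem s' 6 0 \<le> 2 * nmem s 0 0) s"
proof -
  define I where "I j s' \<longleftrightarrow> nmem s' 6 0 = 2 ^ j \<and> nmem s' 6 0 \<le> 2 * nmem s 0 0"
    for j and s' :: "'v state"
  define s0 where "s0 = nput 6 0 1 s"
  let ?b = "NLess (nvar 6) (nvar 0)" and ?c = "NAsg 6 (NConst 0) (NAdd (nvar 6) (nvar 6))"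
  have loop: "wp d sub (While ?b ?c) (\<lambda>t s'. t \<le> L * (10 + btime ?b + 1) + btime ?b + 1 \<and>
      \<not> bval s' ?b \<and> (\<exists>j\<le>L. I j s') \<and> frame ?c s0 s') s0"
  proof (rule wp_While)
    show "I 0 s0" using n by (simp add: I_def s0_def put_defs)
  next
    fix j s'
    assume I: "I j s'" and fr: "frame ?c s0 s'" and bt: "bval s' ?b"
    have fr': "nmem s' 0 = nmem s 0" using fr by (simp add: frame_def s0_def put_defs)
    have "2 ^ j < nmem s 0 0" using bt I fr' by (simp add: I_def)
    with L have "(2::nat) ^ j < 2 ^ L" by linarith
    then have "j < L" by simp
    then show "j < L \<and> wp d sub ?c (\<lambda>t s''. t \<le> 10 \<and> I (Suc j) s'') s'"
      using I bt fr' by (simp add: I_def wp_simps put_defs)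
  qed
  show ?thesis
    unfolding double_prog_def wp_Seq wp_NAsg nval.simps
    apply (fold s0_def)
    apply (rule wp_mono[OF loop])
    subgoal for t s'
      by (auto simp: I_def frame_def s0_def put_defs)
    done
qed

text \<open>Naturals cannot be halved on this machine. Instead each inner node records itself as
  parent at both of its children.\<close>

definition half_body :: com where
  "half_body = Seq (NAsg 2 (NAdd (nvar 7) (nvar 7)) (nvar 7))
    (Seq (NAsg 2 (NAdd (NAdd (nvar 7) (nvar 7)) (NConst 1)) (nvar 7)) (incr 7))"

definition half_prog :: com where
  "half_prog = Seq (NAsg 7 (NConst 0) (NConst 1)) (While (NLess (nvar 7) (nvar 6)) half_body)"

lemma half_prog:
  fixes s :: "'v state"
  assumes N: "1 \<le> nmem s 6 0"
  shows "wp d sub half_prog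
    (\<lambda>t s'. t \<le> 40 * nmem s 6 0 + 20 \<and>
       (\<forall>u. 2 \<le> u \<longrightarrow> u < nmem s 6 0 + nmem s 6 0 \<longrightarrow> nmem s' 2 u = u div 2)) s"
proof -
  define I where "I j s' \<longleftrightarrow> nmem s' 7 0 = Suc j \<and> Suc j \<le> nmem s 6 0 \<and>
    (\<forall>u. 2 \<le> u \<longrightarrow> u < Suc j + Suc j \<longrightarrow> nmem s' 2 u = u div 2)"
    for j and s' :: "'v state"
  define s0 where "s0 = nput 7 0 1 s"
  let ?b = "NLess (nvar 7) (nvar 6)" and ?n = "nmem s 6 0"
  have loop: "wp d sub (While ?b half_body) (\<lambda>t s'. t \<le> ?n * (30 + btime ?b + 1) + btime ?b + 1 \<and>
      \<not> bval s' ?b \<and> (\<exists>j\<le>?n. I j s') \<and> frame half_body s0 s') s0"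
  proof (rule wp_While)
    show "I 0 s0" using N by (simp add: I_def s0_def put_defs)
  next
    fix j s'
    assume I: "I j s'" and fr: "frame half_body s0 s'" and bt: "bval s' ?b"
    have fr': "nmem s' 6 = nmem s 6" using fr by (simp add: frame_def half_body_def s0_def put_defs)
    have div: "u div 2 = Suc j" if "u = Suc (Suc (j + j)) \<or> u = Suc (Suc (Suc (j + j)))" for u
      using that by auto
    show "j < ?n \<and> wp d sub half_body (\<lambda>t s''. t \<le> 30 \<and> I (Suc j) s'') s'"
      using I bt fr' by (auto simp: I_def half_body_def wp_simps put_defs div less_Suc_eq)
  qed
  show ?thesis
    unfolding half_prog_def wp_Seq wp_NAsg nval.simps
    apply (fold s0_def)
    apply (rule wp_mono[OF loop])
    subgoal for t s'
    proof -
      assume p: "t \<le> ?n * (30 + btime ?b + 1) + btime ?b + 1 \<and>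
        \<not> bval s' ?b \<and> (\<exists>j\<le>?n. I j s') \<and> frame half_body s0 s'"
      then have "nmem s' 6 = nmem s 6" by (simp add: frame_def half_body_def s0_def put_defs)
      with p obtain j where "I j s'" "Suc j = ?n" by (auto simp: I_def)
      then show ?thesis using p by (auto simp: I_def)
    qed
    done
qed

definition leaf_body :: com where
  "leaf_body = Seq
     (Cond (NLess (nvar 7) (nvar 0))
        (RAsg 2 (NAdd (nvar 6) (nvar 7)) (RGet 1 (nvar 7)))
        (RAsg 2 (NAdd (nvar 6) (nvar 7)) (RSub (ROfNat (NConst 0)) (ROfNat (NConst 1)))))
     (incr 7)"

definition leaf_prog :: com where
  "leaf_prog = Seq (NAsg 7 (NConst 0) (NConst 0)) (While (NLess (nvar 7) (nvar 6)) leaf_body)"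

lemma leaf_prog:
  fixes s :: "'v state"
  shows "wp d sub leaf_prog
    (\<lambda>t s'. t \<le> 40 * nmem s 6 0 + 20 \<and>
       (\<forall>u<nmem s 6 0. rmem s' 2 (nmem s 6 0 + u) = (if u < nmem s 0 0 then rmem s 1 u else -1))) s"
proof -
  define I where "I j s' \<longleftrightarrow> nmem s' 7 0 = j \<and> j \<le> nmem s 6 0 \<and>
    (\<forall>u<j. rmem s' 2 (nmem s 6 0 + u) = (if u < nmem s 0 0 then rmem s 1 u else -1))"
    for j and s' :: "'v state"
  define s0 where "s0 = nput 7 0 0 s"
  let ?b = "NLess (nvar 7) (nvar 6)" and ?n = "nmem s 6 0"
  have loop: "wp d sub (While ?b leaf_body) (\<lambda>t s'. t \<le> ?n * (30 + btime ?b + 1) + btime ?b + 1 \<and>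
      \<not> bval s' ?b \<and> (\<exists>j\<le>?n. I j s') \<and> frame leaf_body s0 s') s0"
  proof (rule wp_While)
    show "I 0 s0" by (simp add: I_def s0_def put_defs)
  next
    fix j s'
    assume I: "I j s'" and fr: "frame leaf_body s0 s'" and bt: "bval s' ?b"
    have fr': "nmem s' 6 = nmem s 6" "nmem s' 0 = nmem s 0" "rmem s' 1 = rmem s 1"
      using fr by (simp_all add: frame_def leaf_body_def s0_def put_defs)
    show "j < ?n \<and> wp d sub leaf_body (\<lambda>t s''. t \<le> 30 \<and> I (Suc j) s'') s'"
      using I bt fr' by (auto simp: I_def leaf_body_def wp_simps put_defs less_Suc_eq)
  qed
  show ?thesis
    unfolding leaf_prog_def wp_Seq wp_NAsg nval.simps
    apply (fold s0_def)
    apply (rule wp_mono[OF loop])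
    subgoal for t s'
      by (auto simp: I_def frame_def leaf_body_def s0_def put_defs)
    done
qed

definition update_node :: com where
  "update_node =
     Cond (RLess (RGet 2 (NAdd (nvar 8) (nvar 8))) (RGet 2 (NAdd (NAdd (nvar 8) (nvar 8)) (NConst 1))))
       (RAsg 2 (nvar 8) (RGet 2 (NAdd (NAdd (nvar 8) (nvar 8)) (NConst 1))))
       (RAsg 2 (nvar 8) (RGet 2 (NAdd (nvar 8) (nvar 8))))"

lemma update_node:
  "wp d sub update_node (\<lambda>t s'. t \<le> 40 \<and> s' = rput 2 (nmem s 8 0)
     (max (rmem s 2 (nmem s 8 0 + nmem s 8 0)) (rmem s 2 (nmem s 8 0 + nmem s 8 0 + 1))) s) s"
  by (simp add: update_node_def wp_simps max_def)

definition build_body :: com where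
  "build_body = Seq (NAsg 8 (NConst 0) (NSub (nvar 8) (NConst 1))) update_node"

definition build_prog :: com where
  "build_prog = Seq (NAsg 8 (NConst 0) (nvar 6)) (While (NLess (NConst 1) (nvar 8)) build_body)"

text \<open>Nodes are treated in descending order, so children are final before their parent is
  computed.\<close>

lemma build_prog:
  fixes s :: "'v state"
  assumes N: "1 \<le> nmem s 6 0"
  shows "wp d sub build_prog
    (\<lambda>t s'. t \<le> 60 * nmem s 6 0 + 20 \<and> tournament (nmem s 6 0) (rmem s' 2) \<and>
       (\<forall>u\<ge>nmem s 6 0. rmem s' 2 u = rmem s 2 u)) s"
proof -
  define I where "I j s' \<longleftrightarrow> nmem s' 8 0 + j = nmem s 6 0 \<and> 1 \<le> nmem s' 8 0 \<and>
    (\<forall>u. nmem s' 8 0 \<le> u \<longrightarrow> u < nmem s 6 0 \<longrightarrow> winner (rmem s' 2) u) \<and>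
    (\<forall>u\<ge>nmem s 6 0. rmem s' 2 u = rmem s 2 u)"
    for j and s' :: "'v state"
  define s0 where "s0 = nput 8 0 (nmem s 6 0) s"
  let ?b = "NLess (NConst 1) (nvar 8)" and ?n = "nmem s 6 0"
  have loop: "wp d sub (While ?b build_body) (\<lambda>t s'. t \<le> ?n * (50 + btime ?b + 1) + btime ?b + 1 \<and>
      \<not> bval s' ?b \<and> (\<exists>j\<le>?n. I j s') \<and> frame build_body s0 s') s0"
  proof (rule wp_While)
    show "I 0 s0" using N by (simp add: I_def s0_def put_defs)
  next
    fix j s'
    assume I: "I j s'" and bt: "bval s' ?b"
    define i where "i = nmem s' 8 0 - 1"
    have i: "1 \<le> i" "nmem s' 8 0 = Suc i" "Suc i + j = ?n" using I bt by (auto simp: i_def I_def)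
    define f where "f = (rmem s' 2)(i := max (rmem s' 2 (i + i)) (rmem s' 2 (i + i + 1)))"
    \<comment> \<open>The children of a node beyond \<open>i\<close> have indices beyond
      \<open>i\<close>, so writing node \<open>i\<close> does not disturb it.\<close>
    have "winner f u" if "i \<le> u" "u < ?n" for u
    proof (cases "u = i")
      case True
      then show ?thesis using i by (simp add: winner_def f_def)
    next
      case False
      with that have "winner (rmem s' 2) u" using I i by (simp add: I_def)
      then show ?thesis using i that False by (simp add: winner_def f_def)
    qed
    moreover have "f u = rmem s 2 u" if "?n \<le> u" for u
      using I i that by (simp add: I_def f_def)
    ultimately have *: "I (Suc j) (rput 2 i (max (rmem s' 2 (i + i)) (rmem s' 2 (i + i + 1))) (nput 8 0 i s'))"
      using i by (simp add: I_def f_def put_defs)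
    have "wp d sub build_body (\<lambda>t s''. t \<le> 50 \<and> I (Suc j) s'') s'"
      unfolding build_body_def wp_Seq wp_NAsg
      by (rule wp_mono[OF update_node]) (use * i in \<open>auto simp: put_defs\<close>)
    then show "j < ?n \<and> wp d sub build_body (\<lambda>t s''. t \<le> 50 \<and> I (Suc j) s'') s'"
      using i by simp
  qed
  show ?thesis
    unfolding build_prog_def wp_Seq wp_NAsg nval.simps
    apply (fold s0_def)
    apply (rule wp_mono[OF loop])
    subgoal for t s'
      by (auto simp: I_def tournament_def)
    done
qed

section \<open>Extracting the maximum\<close>

definition descend_body :: com where
  "descend_body = Seq (NAsg 8 (NConst 0) (NAdd (nvar 8) (nvar 8)))
     (Cond (RLess (RGet 2 (nvar 8)) (RGet 2 (NAdd (nvar 8) (NConst 1)))) (incr 8) Skip)"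

definition ascend_body :: com where
  "ascend_body = Seq (NAsg 8 (NConst 0) (NGet 2 (nvar 8))) update_node"

text \<open>The larger child has the value of its parent, so following it carries the value of the
  root down to a leaf.\<close>

lemma descend:
  fixes s :: "'v state"
  assumes N: "nmem s 6 0 = 2 ^ e" and tree: "tournament (2 ^ e) (rmem s 2)"
  shows "wp d sub (Seq (NAsg 8 (NConst 0) (NConst 1)) (While (NLess (nvar 8) (nvar 6)) descend_body))
    (\<lambda>t s'. t \<le> 50 * e + 20 \<and> 2 ^ e \<le> nmem s' 8 0 \<and> nmem s' 8 0 < 2 ^ Suc e \<and>
       rmem s 2 (nmem s' 8 0) = rmem s 2 1 \<and> frame descend_body s s') s"
proof -
  define I where "I j s' \<longleftrightarrow> 2 ^ j \<le> nmem s' 8 0 \<and> nmem s' 8 0 < 2 ^ Suc j \<and> j \<le> e \<and>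
    rmem s 2 (nmem s' 8 0) = rmem s 2 1"
    for j and s' :: "'v state"
  define s0 where "s0 = nput 8 0 1 s"
  let ?b = "NLess (nvar 8) (nvar 6)"
  have loop: "wp d sub (While ?b descend_body) (\<lambda>t s'. t \<le> e * (40 + btime ?b + 1) + btime ?b + 1 \<and>
      \<not> bval s' ?b \<and> (\<exists>j\<le>e. I j s') \<and> frame descend_body s0 s') s0"
  proof (rule wp_While)
    show "I 0 s0" by (simp add: I_def s0_def put_defs)
  next
    fix j s'
    assume I: "I j s'" and fr: "frame descend_body s0 s'" and bt: "bval s' ?b"
    have fr': "nmem s' 6 = nmem s 6" "rmem s' 2 = rmem s 2"
      using fr by (simp_all add: frame_def descend_body_def s0_def put_defs)
    define i where "i = nmem s' 8 0"
    have i: "i < 2 ^ e" "2 ^ j \<le> i" "i < 2 ^ Suc j" "rmem s 2 i = rmem s 2 1"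
      using I bt fr' N by (auto simp: I_def i_def)
    have "(2::nat) ^ j < 2 ^ e" using i by linarith
    then have j: "j < e" by simp
    have "1 \<le> i" using i(2) by (meson le_trans one_le_numeral one_le_power)
    then have "winner (rmem s 2) i" using tree i by (simp add: tournament_def)
    then have "wp d sub descend_body (\<lambda>t s''. t \<le> 40 \<and> I (Suc j) s'') s'"
      using i fr' j by (auto simp: I_def descend_body_def wp_simps put_defs winner_def i_def[symmetric])
    with j show "j < e \<and> wp d sub descend_body (\<lambda>t s''. t \<le> 40 \<and> I (Suc j) s'') s'" ..
  qed
  show ?thesis
    unfolding wp_Seq wp_NAsg nval.simps
    apply (fold s0_def)
    apply (rule wp_mono[OF loop])
    subgoal for t s'
    proof -
      assume p: "t \<le> e * (40 + btime ?b + 1) + btime ?b + 1 \<and>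
        \<not> bval s' ?b \<and> (\<exists>j\<le>e. I j s') \<and> frame descend_body s0 s'"
      then have fr: "nmem s' 6 = nmem s 6" "frame descend_body s s'"
        by (auto simp: frame_def descend_body_def s0_def put_defs)
      from p obtain j where j: "I j s'" by auto
      \<comment> \<open>The final node is at least \<open>2 ^ e\<close>, whereas after
        \<open>j\<close> rounds it is below \<open>2 ^ Suc j\<close>; so the depth is exactly
        \<open>e\<close>.\<close>
      with p fr N have "(2::nat) ^ e < 2 ^ Suc j" by (simp add: I_def)
      then have "e < Suc j" by (rule power_less_imp_less_exp[rotated]) simp
      with j have "j = e" by (simp add: I_def)
      then show ?thesis using p j fr N by (auto simp: I_def)
    qed
    done
qed

text \<open>While the changed value is carried to the root, only the proper ancestors of the current
  node can violate the tournament property.\<close>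

definition broken_above :: "nat \<Rightarrow> (nat \<Rightarrow> real) \<Rightarrow> nat \<Rightarrow> bool" where
  "broken_above N f i \<longleftrightarrow>
     (\<forall>u. 1 \<le> u \<longrightarrow> u < N \<longrightarrow> \<not> winner f u \<longrightarrow> (\<exists>q. u = i div 2 ^ Suc q))"

text \<open>Rewriting the parent repairs it, and its new value is seen from above only by its own
  parent, which is an allowed exception. All other nodes keep their own values and those of their
  children.\<close>

lemma broken_above_step:
  assumes "broken_above N f i" and "g = f(i div 2 := max (f (i div 2 + i div 2)) (f (i div 2 + i div 2 + 1)))"
    and i: "1 < i"
  shows "broken_above N g (i div 2)"
  unfolding broken_above_def
proof (intro allI impI)
  fix u assume u: "1 \<le> u" "u < N" "\<not> winner g u"
  let ?p = "i div 2"
  have p: "1 \<le> ?p" using i by simp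
  have "u \<noteq> ?p" using u(3) p by (auto simp: winner_def assms(2))
  show "\<exists>q. u = ?p div 2 ^ Suc q"
  proof (cases "u + u = ?p \<or> u + u + 1 = ?p")
    case True
    then have "u = ?p div 2 ^ Suc 0" by auto
    then show ?thesis ..
  next
    case False
    with u(3) \<open>u \<noteq> ?p\<close> have "\<not> winner f u" by (auto simp: winner_def assms(2))
    \<comment> \<open>Here \<open>q = 0\<close> would mean \<open>u = ?p\<close>, so
      \<open>u\<close> is also a proper ancestor of \<open>?p\<close>.\<close>
    with assms(1) u obtain q where q: "u = i div 2 ^ Suc q" by (auto simp: broken_above_def)
    with \<open>u \<noteq> ?p\<close> obtain q' where "q = Suc q'" by (cases q) auto
    then have "u = ?p div 2 ^ Suc q'" using q \<open>q = Suc q'\<close>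
      by (simp only: power_Suc div_mult2_eq)
    then show ?thesis ..
  qed
qed

lemma ascend:
  fixes s :: "'v state"
  assumes N: "nmem s 6 0 = 2 ^ e" and half: "\<And>u. 2 \<le> u \<Longrightarrow> u < 2 ^ Suc e \<Longrightarrow> nmem s 2 u = u div 2"
    and i: "1 \<le> nmem s 8 0" "nmem s 8 0 < 2 ^ Suc e"
    and br: "broken_above (2 ^ e) (rmem s 2) (nmem s 8 0)"
  shows "wp d sub (While (NLess (NConst 1) (nvar 8)) ascend_body)
    (\<lambda>t s'. t \<le> 80 * e + 20 \<and> tournament (2 ^ e) (rmem s' 2) \<and>
       (\<forall>u\<ge>2 ^ e. rmem s' 2 u = rmem s 2 u) \<and> frame ascend_body s s') s"
proof -
  define I where "I j s' \<longleftrightarrow> nmem s' 8 0 = nmem s 8 0 div 2 ^ j \<and> 1 \<le> nmem s' 8 0 \<and>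
    broken_above (2 ^ e) (rmem s' 2) (nmem s' 8 0) \<and> (\<forall>u\<ge>2 ^ e. rmem s' 2 u = rmem s 2 u)"
    for j and s' :: "'v state"
  let ?b = "NLess (NConst 1) (nvar 8)"
  have loop: "wp d sub (While ?b ascend_body) (\<lambda>t s'. t \<le> e * (60 + btime ?b + 1) + btime ?b + 1 \<and>
      \<not> bval s' ?b \<and> (\<exists>j\<le>e. I j s') \<and> frame ascend_body s s') s"
  proof (rule wp_While)
    show "I 0 s" using i br by (simp add: I_def)
  next
    fix j s'
    assume I: "I j s'" and fr: "frame ascend_body s s'" and bt: "bval s' ?b"
    have fr': "nmem s' 2 = nmem s 2"
      using fr by (simp add: frame_def ascend_body_def update_node_def)
    define i where "i = nmem s' 8 0"
    have i1: "1 < i" using bt by (simp add: i_def)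
    have ij: "i = nmem s 8 0 div 2 ^ j" using I by (simp add: I_def i_def)
    then have "i \<le> nmem s 8 0" by simp
    then have i2: "i < 2 ^ Suc e" using assms(4) by linarith
    \<comment> \<open>A number below \<open>2 ^ Suc e\<close> that is still at least
      \<open>2\<close> after \<open>j\<close> halvings forces \<open>j < e\<close>, which bounds the
      climb.\<close>
    have "2 * 2 ^ j \<le> i * 2 ^ j" using i1 by simp
    also have "\<dots> \<le> nmem s 8 0" by (simp add: ij)
    finally have "(2::nat) ^ Suc j < 2 ^ Suc e" using assms(4) unfolding power_Suc by linarith
    then have "Suc j < Suc e" by (rule power_less_imp_less_exp[rotated]) simp
    then have j: "j < e" by simp
    have h: "nmem s' 2 i = i div 2" using half[of i] fr' i1 i2 by simp
    define p where "p = i div 2"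
    have pe: "p < 2 ^ e" using i2 by (auto simp: p_def)
    define v where "v = max (rmem s' 2 (p + p)) (rmem s' 2 (p + p + 1))"
    have "broken_above (2 ^ e) ((rmem s' 2)(p := v)) p"
      unfolding p_def by (rule broken_above_step[OF _ _ i1]) (use I in \<open>auto simp: I_def i_def p_def v_def\<close>)
    moreover have "p = nmem s 8 0 div 2 ^ Suc j"
      by (simp add: p_def ij div_mult2_eq[symmetric] mult.commute)
    moreover have "1 \<le> p" using i1 by (simp add: p_def)
    ultimately have *: "I (Suc j) (rput 2 p v (nput 8 0 p s'))"
      using I pe by (auto simp: I_def put_defs)
    have "wp d sub ascend_body (\<lambda>t s''. t \<le> 60 \<and> I (Suc j) s'') s'"
      unfolding ascend_body_def wp_Seq wp_NAsg
      by (rule wp_mono[OF update_node])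
        (use * h in \<open>auto simp: put_defs v_def p_def i_def\<close>)
    with j show "j < e \<and> wp d sub ascend_body (\<lambda>t s''. t \<le> 60 \<and> I (Suc j) s'') s'" ..
  qed
  show ?thesis
  proof (rule wp_mono[OF loop])
    fix t s'
    assume p: "t \<le> e * (60 + btime ?b + 1) + btime ?b + 1 \<and>
      \<not> bval s' ?b \<and> (\<exists>j\<le>e. I j s') \<and> frame ascend_body s s'"
    then obtain j where j: "I j s'" by auto
    with p have root: "nmem s' 8 0 = 1" by (auto simp: I_def)
    from j have "broken_above (2 ^ e) (rmem s' 2) (nmem s' 8 0)" unfolding I_def by blast
    then have br: "broken_above (2 ^ e) (rmem s' 2) 1" by (simp only: root)
    \<comment> \<open>The root has no proper ancestor: halving its number gives \<open>0\<close>,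
      which is not a node. So no exception remains.\<close>
    have "1 div 2 ^ Suc q = (0::nat)" for q by (rule div_less[OF one_less_power]) simp_all
    with br have "tournament (2 ^ e) (rmem s' 2)"
      unfolding tournament_def broken_above_def by (metis not_one_le_zero)
    then show "t \<le> 80 * e + 20 \<and> tournament (2 ^ e) (rmem s' 2) \<and>
       (\<forall>u\<ge>2 ^ e. rmem s' 2 u = rmem s 2 u) \<and> frame ascend_body s s'"
      using p j by (auto simp: I_def)
  qed
qed

text \<open>Overwriting the leaf by \<open>-1\<close> removes it from the competition, as distances
  are nonnegative. Its node number minus the number of leaves is the index of the point.\<close>

definition pop_prog :: com where
  "pop_prog =
    Seq (Seq (NAsg 8 (NConst 0) (NConst 1)) (While (NLess (nvar 8) (nvar 6)) descend_body))
   (Seq (NAsg 3 (nvar 7) (NSub (nvar 8) (nvar 6)))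
   (Seq (RAsg 2 (nvar 8) (RSub (ROfNat (NConst 0)) (ROfNat (NConst 1))))
        (While (NLess (NConst 1) (nvar 8)) ascend_body)))"

lemma pop_prog:
  fixes s :: "'v state"
  assumes N: "nmem s 6 0 = 2 ^ e" and tree: "tournament (2 ^ e) (rmem s 2)"
    and half: "\<And>u. 2 \<le> u \<Longrightarrow> u < 2 ^ Suc e \<Longrightarrow> nmem s 2 u = u div 2"
  shows "wp d sub pop_prog
    (\<lambda>t s'. t \<le> 130 * e + 100 \<and> tournament (2 ^ e) (rmem s' 2) \<and>
       (\<exists>w<2 ^ e. rmem s 2 (2 ^ e + w) = rmem s 2 1 \<and> nmem s' 3 = (nmem s 3)(nmem s 7 0 := w) \<and>
         (\<forall>u. rmem s' 2 (2 ^ e + u) = (if u = w then -1 else rmem s 2 (2 ^ e + u)))) \<and>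
       frame pop_prog s s') s"
proof -
  have "wp d sub pop_prog
    (\<lambda>t s'. t \<le> 130 * e + 100 \<and> tournament (2 ^ e) (rmem s' 2) \<and>
       (\<exists>w<2 ^ e. rmem s 2 (2 ^ e + w) = rmem s 2 1 \<and> nmem s' 3 = (nmem s 3)(nmem s 7 0 := w) \<and>
         (\<forall>u. rmem s' 2 (2 ^ e + u) = (if u = w then -1 else rmem s 2 (2 ^ e + u))))) s"
    unfolding pop_prog_def wp_Seq[of _ _ "Seq _ _"]
  proof (rule wp_mono[OF descend[OF N tree]])
    fix t s'
    assume p: "t \<le> 50 * e + 20 \<and> 2 ^ e \<le> nmem s' 8 0 \<and> nmem s' 8 0 < 2 ^ Suc e \<and>
       rmem s 2 (nmem s' 8 0) = rmem s 2 1 \<and> frame descend_body s s'"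
    have fr: "nmem s' 6 = nmem s 6" "nmem s' 7 = nmem s 7" "nmem s' 2 = nmem s 2"
        "nmem s' 3 = nmem s 3" "rmem s' 2 = rmem s 2"
      using p by (simp_all add: frame_def descend_body_def)
    define i where "i = nmem s' 8 0"
    have i: "2 ^ e \<le> i" "i < 2 ^ Suc e" "rmem s 2 i = rmem s 2 1" using p by (simp_all add: i_def)
    have i1: "1 \<le> i" using i(1) by (meson le_trans one_le_numeral one_le_power)
    let ?s = "rput 2 i (-1) (nput 3 (nmem s 7 0) (i - 2 ^ e) s')"
    \<comment> \<open>The cleared node is a leaf, so only its parent can become wrong.\<close>
    have br: "broken_above (2 ^ e) ((rmem s 2)(i := -1)) i"
      unfolding broken_above_def
    proof (intro allI impI)
      fix u assume u: "1 \<le> u" "u < 2 ^ e" "\<not> winner ((rmem s 2)(i := -1)) u"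
      moreover have "winner (rmem s 2) u" using tree u by (simp add: tournament_def)
      ultimately have "u + u = i \<or> u + u + 1 = i" using i(1) by (auto simp: winner_def split: if_splits)
      then have "u = i div 2 ^ Suc 0" by auto
      then show "\<exists>q. u = i div 2 ^ Suc q" ..
    qed
    have "wp d sub (While (NLess (NConst 1) (nvar 8)) ascend_body)
      (\<lambda>t s''. t \<le> 80 * e + 20 \<and> tournament (2 ^ e) (rmem s'' 2) \<and>
       (\<forall>u\<ge>2 ^ e. rmem s'' 2 u = rmem ?s 2 u) \<and> frame ascend_body ?s s'') ?s"
      by (rule ascend) (use N half i i1 fr br in \<open>auto simp: put_defs i_def[symmetric]\<close>)
    then show "wp d sub (Seq (NAsg 3 (nvar 7) (NSub (nvar 8) (nvar 6)))
         (Seq (RAsg 2 (nvar 8) (RSub (ROfNat (NConst 0)) (ROfNat (NConst 1))))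
           (While (NLess (NConst 1) (nvar 8)) ascend_body)))
       (\<lambda>ta s'. t + ta \<le> 130 * e + 100 \<and> tournament (2 ^ e) (rmem s' 2) \<and>
         (\<exists>w<2 ^ e. rmem s 2 (2 ^ e + w) = rmem s 2 1 \<and> nmem s' 3 = (nmem s 3)(nmem s 7 0 := w) \<and>
           (\<forall>u. rmem s' 2 (2 ^ e + u) = (if u = w then -1 else rmem s 2 (2 ^ e + u))))) s'"
      apply (simp add: wp_simps put_defs fr N i_def[symmetric])
      apply (erule wp_mono)
      subgoal premises q for t' s''
        apply (intro conjI exI[of _ "i - 2 ^ e"])
        using q p i fr by (auto simp: frame_def ascend_body_def update_node_def)
      done
  qed
  from wp_frame[OF this] show ?thesis by (rule wp_mono) simp
qed

section \<open>Sorting by repeated extraction\<close>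

definition descending :: "nat \<Rightarrow> (nat \<Rightarrow> nat) \<Rightarrow> (nat \<Rightarrow> real) \<Rightarrow> bool" where
  "descending n \<pi> f \<longleftrightarrow> bij_betw \<pi> {..<n} {..<n} \<and> (\<forall>t<n. \<forall>t'<t. f (\<pi> t) \<le> f (\<pi> t'))"

definition sort_body :: com where
  "sort_body = Seq pop_prog (incr 7)"

definition sort_prog :: com where
  "sort_prog = Seq (NAsg 7 (NConst 0) (NConst 0)) (While (NLess (nvar 7) (nvar 0)) sort_body)"

lemmas pop_frame = frame_def pop_prog_def descend_body_def ascend_body_def update_node_def

lemma sort_prog:
  fixes s :: "'v state"
  assumes N: "nmem s 6 0 = 2 ^ e" and n: "n = nmem s 0 0" "n \<le> 2 ^ e"
    and tree: "tournament (2 ^ e) (rmem s 2)"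
    and half: "\<And>u. 2 \<le> u \<Longrightarrow> u < 2 ^ Suc e \<Longrightarrow> nmem s 2 u = u div 2"
    and f: "\<And>u. u < n \<Longrightarrow> 0 \<le> f u"
    and leaves: "\<And>u. u < 2 ^ e \<Longrightarrow> rmem s 2 (2 ^ e + u) = (if u < n then f u else -1)"
  shows "wp d sub sort_prog
    (\<lambda>t s'. t \<le> n * (130 * e + 130) + 20 \<and> descending n (nmem s' 3) f) s"
proof -
  \<comment> \<open>The last clause compares the point popped at time \<open>t'\<close> with all
    points not popped before it, including those popped later; at the end this is the order.\<close>
  define I where "I t s' \<longleftrightarrow> nmem s' 7 0 = t \<and> t \<le> n \<and> tournament (2 ^ e) (rmem s' 2) \<and>
    inj_on (nmem s' 3) {..<t} \<and> nmem s' 3 ` {..<t} \<subseteq> {..<n} \<and>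
    (\<forall>u<2 ^ e. rmem s' 2 (2 ^ e + u) = (if u < n \<and> u \<notin> nmem s' 3 ` {..<t} then f u else -1)) \<and>
    (\<forall>t'<t. \<forall>u<n. u \<notin> nmem s' 3 ` {..<t'} \<longrightarrow> f u \<le> f (nmem s' 3 t'))"
    for t and s' :: "'v state"
  define s0 where "s0 = nput 7 0 0 s"
  let ?b = "NLess (nvar 7) (nvar 0)"
  have loop: "wp d sub (While ?b sort_body)
    (\<lambda>t s'. t \<le> n * (130 * e + 110 + btime ?b + 1) + btime ?b + 1 \<and>
      \<not> bval s' ?b \<and> (\<exists>j\<le>n. I j s') \<and> frame sort_body s0 s') s0"
  proof (rule wp_While)
    show "I 0 s0" using tree leaves by (simp add: I_def s0_def put_defs)
  next
    fix t s'
    assume I: "I t s'" and fr: "frame sort_body s0 s'" and bt: "bval s' ?b"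
    have fr': "nmem s' 6 = nmem s 6" "nmem s' 0 = nmem s 0" "nmem s' 2 = nmem s 2"
      using fr by (simp_all add: sort_body_def pop_frame s0_def put_defs)
    have t: "t < n" "nmem s' 7 0 = t" using I bt fr' n by (auto simp: I_def)
    let ?f = "rmem s' 2" and ?\<pi> = "nmem s' 3"
    have root: "?f (2 ^ e + u) \<le> ?f 1" if "u < 2 ^ e" for u
      using I that by (intro tournament_root[of "2 ^ e"]) (auto simp: I_def Suc_le_eq)
    have leaf: "?f (2 ^ e + u) = (if u < n \<and> u \<notin> ?\<pi> ` {..<t} then f u else -1)" if "u < 2 ^ e" for u
      using I that by (simp add: I_def)
    have "card (?\<pi> ` {..<t}) < card {..<n}" using I t by (simp add: I_def card_image)
    then have "\<not> {..<n} \<subseteq> ?\<pi> ` {..<t}" by (meson card_mono finite_imageI finite_lessThan not_less)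
    then obtain u0 where u0: "u0 < n" "u0 \<notin> ?\<pi> ` {..<t}" by blast
    \<comment> \<open>As long as a point remains, the root is nonnegative, so the leaf found does
      not hold \<open>-1\<close> and belongs to a point not yet popped.\<close>
    then have "0 \<le> ?f 1" using root[of u0] leaf[of u0] f[of u0] n(2) by fastforce
    have "wp d sub pop_prog
      (\<lambda>t' s''. t' \<le> 130 * e + 100 \<and> tournament (2 ^ e) (rmem s'' 2) \<and>
        (\<exists>w<2 ^ e. ?f (2 ^ e + w) = ?f 1 \<and> nmem s'' 3 = ?\<pi>(nmem s' 7 0 := w) \<and>
         (\<forall>u. rmem s'' 2 (2 ^ e + u) = (if u = w then -1 else ?f (2 ^ e + u)))) \<and>
        frame pop_prog s' s'') s'"
      by (rule pop_prog) (use N I half fr' in \<open>auto simp: I_def\<close>)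
    then have "wp d sub sort_body (\<lambda>t' s''. t' \<le> 130 * e + 110 \<and> I (Suc t) s'') s'"
      unfolding sort_body_def wp_Seq
    proof (rule wp_mono)
      fix t' s''
      assume p: "t' \<le> 130 * e + 100 \<and> tournament (2 ^ e) (rmem s'' 2) \<and>
        (\<exists>w<2 ^ e. ?f (2 ^ e + w) = ?f 1 \<and> nmem s'' 3 = ?\<pi>(nmem s' 7 0 := w) \<and>
         (\<forall>u. rmem s'' 2 (2 ^ e + u) = (if u = w then -1 else ?f (2 ^ e + u)))) \<and>
        frame pop_prog s' s''"
      then obtain w where w: "w < 2 ^ e" "?f (2 ^ e + w) = ?f 1" "nmem s'' 3 = ?\<pi>(t := w)"
        "\<And>u. rmem s'' 2 (2 ^ e + u) = (if u = w then -1 else ?f (2 ^ e + u))"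
        using t by auto
      have fr2: "nmem s'' 7 = nmem s' 7" using p by (simp add: pop_frame)
      have wn: "w < n" "w \<notin> ?\<pi> ` {..<t}" "?f 1 = f w"
        using \<open>0 \<le> ?f 1\<close> w(2) leaf[OF w(1)] by (auto split: if_splits)
      have img: "(?\<pi>(t := w)) ` {..<t'} = ?\<pi> ` {..<t'}" if "t' \<le> t" for t'
        using that by (intro image_cong) auto
      have img': "(?\<pi>(t := w)) ` {..<Suc t} = insert w (?\<pi> ` {..<t})"
        by (simp only: lessThan_Suc image_insert fun_upd_same img[OF order_refl])
      have "inj_on (?\<pi>(t := w)) {..<t}" using I by (auto simp: I_def inj_on_def)
      then have "inj_on (?\<pi>(t := w)) {..<Suc t}"
        using img[of t] wn(2) by (simp add: lessThan_Suc)
      moreover have "(?\<pi>(t := w)) ` {..<Suc t} \<subseteq> {..<n}"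
        using I wn(1) unfolding img' by (simp add: I_def)
      moreover have "rmem s'' 2 (2 ^ e + u) =
          (if u < n \<and> u \<notin> (?\<pi>(t := w)) ` {..<Suc t} then f u else -1)" if "u < 2 ^ e" for u
        unfolding img' using w(4)[of u] leaf[OF that] by auto
      moreover have "f u \<le> f ((?\<pi>(t := w)) t')"
        if "t' < Suc t" "u < n" "u \<notin> (?\<pi>(t := w)) ` {..<t'}" for t' u
      proof (cases "t' = t")
        case True
        then have "u \<notin> ?\<pi> ` {..<t}" using that img[of t] by simp
        moreover have "u < 2 ^ e" using that n by simp
        ultimately show ?thesis using root[of u] leaf[of u] that wn True by simp
      next
        case False
        then have "u \<notin> ?\<pi> ` {..<t'}" "t' < t" using that img[of t'] by auto
        then show ?thesis using I that by (simp add: I_def)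
      qed
      ultimately have "I (Suc t) (nput 7 0 (Suc t) s'')"
        using t p w(3) by (simp add: I_def put_defs)
      then show "wp d sub (incr 7) (\<lambda>t2 s'. t' + t2 \<le> 130 * e + 110 \<and> I (Suc t) s') s''"
        using p t fr2 by (simp add: wp_simps)
    qed
    with t show "t < n \<and> wp d sub sort_body (\<lambda>t' s''. t' \<le> 130 * e + 110 \<and> I (Suc t) s'') s'"
      by simp
  qed
  show ?thesis
    unfolding sort_prog_def wp_Seq wp_NAsg nval.simps
    apply (fold s0_def)
  proof (rule wp_mono[OF loop])
    fix t s'
    assume p: "t \<le> n * (130 * e + 110 + btime ?b + 1) + btime ?b + 1 \<and>
      \<not> bval s' ?b \<and> (\<exists>j\<le>n. I j s') \<and> frame sort_body s0 s'"
    then have "nmem s' 0 = nmem s 0"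
      by (simp add: sort_body_def pop_frame s0_def put_defs)
    with p n obtain j where "I j s'" "j = n" by (auto simp: I_def)
    then have I: "I n s'" by simp
    let ?\<pi> = "nmem s' 3"
    have inj: "inj_on ?\<pi> {..<n}" "?\<pi> ` {..<n} \<subseteq> {..<n}" using I by (auto simp: I_def)
    then have bij: "bij_betw ?\<pi> {..<n} {..<n}"
      by (simp add: bij_betw_def card_image card_subset_eq)
    have "f (?\<pi> t) \<le> f (?\<pi> t')" if "t < n" "t' < t" for t t'
    proof -
      have "?\<pi> t < n" using inj(2) that by auto
      moreover have "?\<pi> t \<notin> ?\<pi> ` {..<t'}" using inj(1) that by (auto dest!: inj_onD)
      moreover have "t' < n" using that by simp
      ultimately show ?thesis using I by (simp add: I_def)
    qed
    with bij have "descending n ?\<pi> f" by (simp add: descending_def)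
    with p show "ntime (NConst 0) + ntime (NConst 0) + 1 + t \<le> n * (130 * e + 130) + 20 \<and>
        descending n ?\<pi> f"
      by (auto simp: algebra_simps)
  qed
qed

definition order_prog :: com where
  "order_prog = Seq double_prog (Seq half_prog (Seq leaf_prog (Seq build_prog sort_prog)))"

lemma order_prog:
  fixes s :: "'v state"
  assumes n: "n = nmem s 0 0" "1 \<le> n" "n \<le> 2 ^ L" and f: "\<And>u. u < n \<Longrightarrow> 0 \<le> rmem s 1 u"
  shows "wp d sub order_prog
    (\<lambda>t s'. t \<le> 700 * (n * (L + 1)) \<and> descending n (nmem s' 3) (rmem s 1)) s"
  unfolding order_prog_def wp_Seq
proof (rule wp_mono[OF wp_frame[OF double_prog]])
  fix t1 s1
  assume p1: "(t1 \<le> 20 * L + 20 \<and> (\<exists>e\<le>L. nmem s1 6 0 = 2 ^ e) \<and>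
    nmem s 0 0 \<le> nmem s1 6 0 \<and> nmem s1 6 0 \<le> 2 * nmem s 0 0) \<and> frame double_prog s s1"
  then obtain e where e: "e \<le> L" "nmem s1 6 0 = 2 ^ e" "n \<le> 2 ^ e" "2 ^ e \<le> 2 * n"
    using n by auto
  have f1: "nmem s1 0 = nmem s 0" "rmem s1 1 = rmem s 1"
    using p1 by (simp_all add: frame_def double_prog_def)
  show "wp d sub half_prog (\<lambda>t2. wp d sub leaf_prog (\<lambda>t3. wp d sub build_prog (\<lambda>t4.
      wp d sub sort_prog (\<lambda>t5 s'. t1 + (t2 + (t3 + (t4 + t5))) \<le> 700 * (n * (L + 1)) \<and>
        descending n (nmem s' 3) (rmem s 1))))) s1"
  proof (rule wp_mono[OF wp_frame[OF half_prog]])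
    fix t2 s2
    assume p2: "(t2 \<le> 40 * nmem s1 6 0 + 20 \<and>
       (\<forall>u. 2 \<le> u \<longrightarrow> u < nmem s1 6 0 + nmem s1 6 0 \<longrightarrow> nmem s2 2 u = u div 2)) \<and>
       frame half_prog s1 s2"
    then have f2: "nmem s2 0 = nmem s 0" "rmem s2 1 = rmem s 1" "nmem s2 6 = nmem s1 6"
      using f1 by (simp_all add: frame_def half_prog_def half_body_def)
    show "wp d sub leaf_prog (\<lambda>t3. wp d sub build_prog (\<lambda>t4.
      wp d sub sort_prog (\<lambda>t5 s'. t1 + (t2 + (t3 + (t4 + t5))) \<le> 700 * (n * (L + 1)) \<and>
        descending n (nmem s' 3) (rmem s 1)))) s2"
    proof (rule wp_mono[OF wp_frame[OF leaf_prog]])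
      fix t3 s3
      assume p3: "(t3 \<le> 40 * nmem s2 6 0 + 20 \<and> (\<forall>u<nmem s2 6 0.
        rmem s3 2 (nmem s2 6 0 + u) = (if u < nmem s2 0 0 then rmem s2 1 u else -1))) \<and>
        frame leaf_prog s2 s3"
      then have f3: "nmem s3 0 = nmem s 0" "nmem s3 6 = nmem s1 6" "nmem s3 2 = nmem s2 2"
        using f2 by (simp_all add: frame_def leaf_prog_def leaf_body_def)
      show "wp d sub build_prog (\<lambda>t4.
        wp d sub sort_prog (\<lambda>t5 s'. t1 + (t2 + (t3 + (t4 + t5))) \<le> 700 * (n * (L + 1)) \<and>
          descending n (nmem s' 3) (rmem s 1))) s3"
      proof (rule wp_mono[OF wp_frame[OF build_prog]])
        fix t4 s4
        assume p4: "(t4 \<le> 60 * nmem s3 6 0 + 20 \<and> tournament (nmem s3 6 0) (rmem s4 2) \<and>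
          (\<forall>u\<ge>nmem s3 6 0. rmem s4 2 u = rmem s3 2 u)) \<and> frame build_prog s3 s4"
        then have f4: "nmem s4 0 = nmem s 0" "nmem s4 6 = nmem s1 6" "nmem s4 2 = nmem s2 2"
          using f3 by (simp_all add: frame_def build_prog_def build_body_def update_node_def)
        \<comment> \<open>Abstracting the products \<open>n * L\<close> and \<open>n * e\<close> to
          \<open>X\<close> and \<open>Y\<close> leaves a linear estimate.\<close>
        have bound: "t1 + (t2 + (t3 + (t4 + t5))) \<le> 700 * (X + n)"
          if "t1 \<le> 20 * L + 20" "t2 \<le> 40 * P + 20" "t3 \<le> 40 * P + 20" "t4 \<le> 60 * P + 20"
            "t5 \<le> 130 * Y + 130 * n + 20" "P \<le> 2 * n" "L \<le> X" "Y \<le> X" for t5 P X Y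
        proof -
          have "t1 + (t2 + (t3 + (t4 + t5))) \<le> 20 * L + 140 * P + 130 * Y + 130 * n + 100"
            using that(1-5) by linarith
          also have "\<dots> \<le> 150 * X + 510 * n" using that(6-8) n(2) by linarith
          finally show ?thesis by simp
        qed
        have ge: "n * (L + 1) = n * L + n" "L \<le> n * L" "n * e \<le> n * L" using n e by auto
        show "wp d sub sort_prog (\<lambda>t5 s'. t1 + (t2 + (t3 + (t4 + t5))) \<le> 700 * (n * (L + 1)) \<and>
          descending n (nmem s' 3) (rmem s 1)) s4"
        proof (rule wp_mono[OF sort_prog[where e = e and n = n and f = "rmem s 1"]])
          fix t5 s5
          assume p5: "t5 \<le> n * (130 * e + 130) + 20 \<and> descending n (nmem s5 3) (rmem s 1)"
          have "t1 \<le> 20 * L + 20" "t2 \<le> 40 * 2 ^ e + 20" "t3 \<le> 40 * 2 ^ e + 20"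
            "t4 \<le> 60 * 2 ^ e + 20" "t5 \<le> 130 * (n * e) + 130 * n + 20"
            using p1 p2 p3 p4 p5 e f2 f3 by (auto simp: algebra_simps)
          then have "t1 + (t2 + (t3 + (t4 + t5))) \<le> 700 * (n * (L + 1))"
            unfolding ge(1) by (intro bound[OF _ _ _ _ _ e(4) ge(2,3)])
          with p5 show "t1 + (t2 + (t3 + (t4 + t5))) \<le> 700 * (n * (L + 1)) \<and>
            descending n (nmem s5 3) (rmem s 1)" by simp
        qed (use n e f f2 f3 f4 p2 p3 p4 in \<open>auto simp: mult_2\<close>)
      qed (use e f3 in auto)
    qed
  qed (use e in auto)
qed (use n in auto)

text \<open>\<open>\<nu>\<close> sends the index of a point to that of its centre, and \<open>\<pi>\<close> lists the points by decreasing
  distance.  The subtraction below is not truncated, as \<open>crank\<close> is less than \<open>csize\<close>.\<close>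

definition crank :: "(nat \<Rightarrow> nat) \<Rightarrow> (nat \<Rightarrow> nat) \<Rightarrow> nat \<Rightarrow> nat" where
  "crank \<nu> \<pi> t = card {t'. t' < t \<and> \<nu> (\<pi> t') = \<nu> (\<pi> t)}"

definition csize :: "(nat \<Rightarrow> nat) \<Rightarrow> nat \<Rightarrow> nat \<Rightarrow> nat" where
  "csize \<nu> n c = card {j. j < n \<and> \<nu> j = c}"

text \<open>The second count includes the point itself. No point is central once \<open>K\<close>
  reaches the number of points, which is why the computation of \<open>K\<close> may stop
  there.\<close>

definition central :: "real \<Rightarrow> (nat \<Rightarrow> nat) \<Rightarrow> (nat \<Rightarrow> nat) \<Rightarrow> nat \<Rightarrow> nat \<Rightarrow> bool" where
  "central K \<nu> \<pi> n t \<longleftrightarrow> K \<le> real (crank \<nu> \<pi> t) \<and> K < real (csize \<nu> n (\<nu> (\<pi> t)) - crank \<nu> \<pi> t)"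

definition picked :: "(nat \<Rightarrow> bool) \<Rightarrow> (nat \<Rightarrow> nat) \<Rightarrow> 'v list \<Rightarrow> nat \<Rightarrow> 'v list" where
  "picked p \<pi> xs n = map (\<lambda>t. xs ! \<pi> t) (filter p [0..<n])"

section \<open>Separating peeled from central points\<close>

definition split_body :: com where
  "split_body =
    Seq (NAsg 11 (NConst 0) (NGet 3 (nvar 7)))
   (Seq (NAsg 8 (NConst 0) (NGet 1 (nvar 11)))
   (Seq (Cond (BAnd (BNot (RLess (ROfNat (NGet 5 (nvar 8))) (rvar 3)))
                (RLess (rvar 3) (ROfNat (NSub (NGet 4 (nvar 8)) (NGet 5 (nvar 8))))))
          (Seq (PAsg 3 (nvar 10) 0 (nvar 11)) (incr 10))
          (Seq (PAsg 2 (nvar 9) 0 (nvar 11)) (incr 9)))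
   (Seq (NAsg 5 (nvar 8) (NAdd (NGet 5 (nvar 8)) (NConst 1)))
        (incr 7))))"

definition split_prog :: com where
  "split_prog = Seq (NAsg 7 (NConst 0) (NConst 0)) (While (NLess (nvar 7) (nvar 0)) split_body)"

lemma holds_points_append:
  assumes "holds_points s a xs"
  shows "holds_points (pput a (length xs) (Some x) s) a (xs @ [x])"
  using assms by (auto simp: holds_points_def put_defs nth_append less_Suc_eq)

text \<open>Points are visited by position in \<open>\<pi>\<close>, so the counter of a cluster,
  read before it is increased, is the rank of the current point in its cluster.\<close>

lemma split_prog:
  fixes s :: "'v state"
  assumes n: "nmem s 0 0 = length xs" and xs: "holds_points s 0 xs"
    and \<pi>: "\<And>t. t < length xs \<Longrightarrow> nmem s 3 t < length xs"
    and cnt: "\<And>c. nmem s 4 c = csize (nmem s 1) (length xs) c"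
    and blank: "nmem s 5 = (\<lambda>_. 0)" "nmem s 9 = (\<lambda>_. 0)" "nmem s 10 = (\<lambda>_. 0)"
  defines "Q \<equiv> central (rmem s 3 0) (nmem s 1) (nmem s 3) (length xs)"
  shows "wp d sub split_prog
    (\<lambda>t s'. t \<le> 80 * length xs + 20 \<and>
       (let fs = picked (Not \<circ> Q) (nmem s 3) xs (length xs); ds = picked Q (nmem s 3) xs (length xs) in
        holds_points s' 2 fs \<and> nmem s' 9 0 = length fs \<and>
        holds_points s' 3 ds \<and> nmem s' 10 0 = length ds)) s"
proof -
  let ?\<pi> = "nmem s 3" and ?\<nu> = "nmem s 1" and ?n = "length xs"
  define I where "I t s' \<longleftrightarrow> nmem s' 7 0 = t \<and> t \<le> ?n \<and>
    (\<forall>c. nmem s' 5 c = card {t'. t' < t \<and> ?\<nu> (?\<pi> t') = c}) \<and>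
    holds_points s' 2 (picked (Not \<circ> Q) ?\<pi> xs t) \<and> nmem s' 9 0 = length (picked (Not \<circ> Q) ?\<pi> xs t) \<and>
    holds_points s' 3 (picked Q ?\<pi> xs t) \<and> nmem s' 10 0 = length (picked Q ?\<pi> xs t)"
    for t and s' :: "'v state"
  define s0 where "s0 = nput 7 0 0 s"
  let ?b = "NLess (nvar 7) (nvar 0)"
  have loop: "wp d sub (While ?b split_body) (\<lambda>t s'. t \<le> ?n * (70 + btime ?b + 1) + btime ?b + 1 \<and>
      \<not> bval s' ?b \<and> (\<exists>j\<le>?n. I j s') \<and> frame split_body s0 s') s0"
  proof (rule wp_While)
    show "I 0 s0" using blank by (simp add: I_def s0_def put_defs picked_def holds_points_def)
  next
    fix t s'
    assume I: "I t s'" and fr: "frame split_body s0 s'" and bt: "bval s' ?b"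
    have fr': "nmem s' 0 = nmem s 0" "nmem s' 1 = ?\<nu>" "nmem s' 3 = ?\<pi>" "nmem s' 4 = nmem s 4"
        "rmem s' 3 = rmem s 3" "pmem s' 0 = pmem s 0"
      using fr by (simp_all add: frame_def split_body_def s0_def put_defs)
    have t: "nmem s' 7 0 = t" "t < ?n" using I bt n fr' by (auto simp: I_def)
    have x: "pmem s' 0 (?\<pi> t) = Some (xs ! ?\<pi> t)"
      using xs \<pi>[OF t(2)] fr' by (simp add: holds_points_def)
    have cnt': "card {t'. t' < Suc t \<and> ?\<nu> (?\<pi> t') = c} =
        (if c = ?\<nu> (?\<pi> t) then Suc (nmem s' 5 c) else nmem s' 5 c)" for c
    proof -
      have "{t'. t' < Suc t \<and> ?\<nu> (?\<pi> t') = c} =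
        (if c = ?\<nu> (?\<pi> t) then insert t else id) {t'. t' < t \<and> ?\<nu> (?\<pi> t') = c}"
        by (auto simp: less_Suc_eq)
      then show ?thesis using I by (simp add: I_def)
    qed
    have crank: "nmem s' 5 (?\<nu> (?\<pi> t)) = crank ?\<nu> ?\<pi> t" using I by (simp add: I_def crank_def)
    have Q: "Q t \<longleftrightarrow> rmem s 3 0 \<le> real (crank ?\<nu> ?\<pi> t) \<and>
        rmem s 3 0 < real (nmem s 4 (?\<nu> (?\<pi> t)) - crank ?\<nu> ?\<pi> t)"
      by (simp add: Q_def central_def cnt)
    have app: "picked p ?\<pi> xs (Suc t) = picked p ?\<pi> xs t @ (if p t then [xs ! ?\<pi> t] else [])" for p
      by (simp add: picked_def)
    have "wp d sub split_body (\<lambda>t' s''. t' \<le> 70 \<and> I (Suc t) s'') s'"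
    proof (cases "Q t")
      case True
      then have "holds_points (pput 3 (length (picked Q ?\<pi> xs t)) (Some (xs ! ?\<pi> t)) s') 3
          (picked Q ?\<pi> xs (Suc t))"
        using I holds_points_append[of s' 3] unfolding app I_def by simp
      then show ?thesis
        using I t True x cnt' crank Q fr'
        by (simp add: I_def split_body_def wp_simps put_defs app holds_points_def not_less)
    next
      case False
      then have "holds_points (pput 2 (length (picked (Not \<circ> Q) ?\<pi> xs t)) (Some (xs ! ?\<pi> t)) s') 2
          (picked (Not \<circ> Q) ?\<pi> xs (Suc t))"
        using I holds_points_append[of s' 2] unfolding app I_def by simp
      then show ?thesis
        using I t False x cnt' crank Q fr'
        by (auto simp add: I_def split_body_def wp_simps put_defs app holds_points_def not_less)
    qed
    with t show "t < ?n \<and> wp d sub split_body (\<lambda>t' s''. t' \<le> 70 \<and> I (Suc t) s'') s'" by simp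
  qed
  show ?thesis
    unfolding split_prog_def wp_Seq wp_NAsg nval.simps
    apply (fold s0_def)
  proof (rule wp_mono[OF loop])
    fix t s'
    assume p: "t \<le> ?n * (70 + btime ?b + 1) + btime ?b + 1 \<and>
      \<not> bval s' ?b \<and> (\<exists>j\<le>?n. I j s') \<and> frame split_body s0 s'"
    then have "nmem s' 0 = nmem s 0"
      by (simp add: frame_def split_body_def s0_def put_defs)
    with p n obtain j where "I j s'" "j = ?n" by (auto simp: I_def)
    with p show "ntime (NConst 0) + ntime (NConst 0) + 1 + t \<le> 80 * ?n + 20 \<and>
       (let fs = picked (Not \<circ> Q) (nmem s 3) xs (length xs); ds = picked Q (nmem s 3) xs (length xs) in
        holds_points s' 2 fs \<and> nmem s' 9 0 = length fs \<and>
        holds_points s' 3 ds \<and> nmem s' 10 0 = length ds)"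
      by (auto simp: I_def)
  qed
qed

text \<open>The coreset of the central points already lies in the output arrays. Its size cell
  serves as write position and ends as the size of the union.\<close>

definition append_body :: com where
  "append_body =
    Seq (PAsg 0 (nvar 0) 2 (nvar 7))
   (Seq (RAsg 0 (nvar 0) (ROfNat (NConst 1)))
   (Seq (incr 0) (incr 7)))"

definition append_prog :: com where
  "append_prog = Seq (NAsg 7 (NConst 0) (NConst 0)) (While (NLess (nvar 7) (nvar 9)) append_body)"

lemma append_prog:
  fixes s :: "'v state"
  assumes fs: "holds_points s 2 fs" "nmem s 9 0 = length fs"
    and ret: "returns s W" and fs': "distinct fs" "set fs \<inter> fst W = {}"
  shows "wp d sub append_prog (\<lambda>t s'. t \<le> 60 * length fs + 20 \<and> returns s' (wunion (set fs) W)) s"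
proof -
  obtain ps where ps: "distinct ps" "set ps = fst W" "nmem s 0 0 = length ps" "holds_points s 0 ps"
    "\<forall>i<length ps. rmem s 0 i = snd W (ps ! i)"
    using ret by (auto simp: returns_def)
  define I where "I t s' \<longleftrightarrow> nmem s' 7 0 = t \<and> t \<le> length fs \<and> nmem s' 0 0 = length ps + t \<and>
    holds_points s' 0 (ps @ take t fs) \<and>
    (\<forall>i<length ps. rmem s' 0 i = snd W (ps ! i)) \<and> (\<forall>i<t. rmem s' 0 (length ps + i) = 1)"
    for t and s' :: "'v state"
  define s0 where "s0 = nput 7 0 0 s"
  let ?b = "NLess (nvar 7) (nvar 9)" and ?n = "length fs"
  have loop: "wp d sub (While ?b append_body) (\<lambda>t s'. t \<le> ?n * (50 + btime ?b + 1) + btime ?b + 1 \<and>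
      \<not> bval s' ?b \<and> (\<exists>j\<le>?n. I j s') \<and> frame append_body s0 s') s0"
  proof (rule wp_While)
    show "I 0 s0" using ps by (simp add: I_def s0_def put_defs holds_points_def)
  next
    fix t s'
    assume I: "I t s'" and fr: "frame append_body s0 s'" and bt: "bval s' ?b"
    have fr': "nmem s' 9 = nmem s 9" "pmem s' 2 = pmem s 2"
      using fr by (simp_all add: frame_def append_body_def s0_def put_defs)
    have t: "nmem s' 7 0 = t" "t < ?n" using I bt fs fr' by (auto simp: I_def)
    have x: "pmem s' 2 t = Some (fs ! t)" using fs t fr' by (simp add: holds_points_def)
    have hp: "holds_points (pput 0 (length ps + t) (Some (fs ! t)) s') 0 (ps @ take (Suc t) fs)"
      using I t holds_points_append[of s' 0 "ps @ take t fs" "fs ! t"]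
      by (simp add: I_def take_Suc_conv_app_nth)
    have "I (Suc t) (nput 7 0 (Suc t) (nput 0 0 (Suc (length ps + t)) (rput 0 (length ps + t) 1
        (pput 0 (length ps + t) (Some (fs ! t)) s'))))"
      using I t hp by (auto simp: I_def put_defs holds_points_def less_Suc_eq)
    then have "wp d sub append_body (\<lambda>t' s''. t' \<le> 50 \<and> I (Suc t) s'') s'"
      using I t x by (simp add: I_def append_body_def wp_simps put_defs)
    with t show "t < ?n \<and> wp d sub append_body (\<lambda>t' s''. t' \<le> 50 \<and> I (Suc t) s'') s'" by simp
  qed
  show ?thesis
    unfolding append_prog_def wp_Seq wp_NAsg nval.simps
    apply (fold s0_def)
  proof (rule wp_mono[OF loop])
    fix t s'
    assume p: "t \<le> ?n * (50 + btime ?b + 1) + btime ?b + 1 \<and>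
      \<not> bval s' ?b \<and> (\<exists>j\<le>?n. I j s') \<and> frame append_body s0 s'"
    then have "nmem s' 9 = nmem s 9"
      by (simp add: frame_def append_body_def s0_def put_defs)
    with p fs obtain j where "I j s'" "j = ?n" by (auto simp: I_def)
    then have I: "I ?n s'" by simp
    have "rmem s' 0 i = snd (wunion (set fs) W) ((ps @ fs) ! i)" if "i < length (ps @ fs)" for i
    proof (cases "i < length ps")
      case True
      then have "ps ! i \<in> fst W" using ps(2) by (metis nth_mem)
      then show ?thesis using I True fs'(2) by (auto simp: I_def wunion_def nth_append)
    next
      case False
      define j where "j = i - length ps"
      have "i = length ps + j" "j < ?n" using False that by (auto simp: j_def)
      then show ?thesis using I by (simp add: I_def wunion_def nth_append)
    qed
    then have "returns s' (wunion (set fs) W)"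
      unfolding returns_def using I ps fs'
      by (intro exI[of _ "ps @ fs"]) (auto simp: I_def)
    with p show "ntime (NConst 0) + ntime (NConst 0) + 1 + t \<le> 60 * ?n + 20 \<and>
       returns s' (wunion (set fs) W)" by simp
  qed
qed

section \<open>Assembling the program\<close>

definition prep_prog :: "nat \<Rightarrow> nat \<Rightarrow> com" where
  "prep_prog g b = Seq assign_prog (Seq (bound_prog g b) (Seq order_prog split_prog))"

text \<open>The test protects the subroutine from an empty dataset. Its result may overwrite the
  arrays \<open>0\<close>, since by then the points of both parts have been copied
  elsewhere.\<close>

definition robust_prog :: "nat \<Rightarrow> nat \<Rightarrow> com" where
  "robust_prog g b = Seq (prep_prog g b)
    (Seq (Cond (NLess (NConst 0) (nvar 10))
            (Invoke (RDiv (rvar 0) (ROfNat (NConst 3))) (NGet 0 (NConst 1)) (NGet 0 (NConst 2)) 3 (nvar 10) 0)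
            (NAsg 0 (NConst 0) (NConst 0)))
         append_prog)"

lemmas prog_frame = frame_def assign_prog_def assign_body_def assign_inner_def bound_prog_def
  bound_body_def order_prog_def double_prog_def half_prog_def half_body_def leaf_prog_def leaf_body_def
  build_prog_def build_body_def update_node_def sort_prog_def sort_body_def pop_prog_def
  descend_body_def ascend_body_def split_prog_def split_body_def

text \<open>The existential variables stand for the contents of the arrays, and \<open>i\<close> for
  the number of multiplications carried out, so that the correctness argument can proceed without
  the machine.\<close>

lemma prep_prog:
  fixes xs cs :: "'v list" and k z m :: nat
  assumes n: "1 \<le> length xs" "length xs \<le> 2 ^ L" and l: "1 \<le> length cs"
    and K0: "K0 = real g * real m / \<epsilon>" "1 \<le> K0" and b: "2 \<le> b"
    and pos: "\<And>x c. 0 \<le> d x c"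
  defines "n \<equiv> length xs"
    and "s \<equiv> initial_state [length xs, k, z, m, length cs] [\<epsilon>] [xs, cs]"
  shows "wp d sub (prep_prog g b) (\<lambda>t s'.
    t \<le> 1000 * (n * (L + 1 + length cs)) \<and>
    (\<exists>\<nu> f \<pi> K i. (\<forall>j<n. nearest d cs (xs ! j) (\<nu> j) (f j) (length cs)) \<and> descending n \<pi> f \<and>
       i \<le> z \<and> K = K0 * real b ^ i \<and> (i = z \<or> real n \<le> K) \<and>
       (let Q = central K \<nu> \<pi> n; fs = picked (Not \<circ> Q) \<pi> xs n; ds = picked Q \<pi> xs n in
         holds_points s' 2 fs \<and> nmem s' 9 0 = length fs \<and>
         holds_points s' 3 ds \<and> nmem s' 10 0 = length ds)) \<and>
    nmem s' 0 = nmem s 0 \<and> rmem s' 0 = rmem s 0) s"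
  unfolding prep_prog_def wp_Seq
proof (rule wp_mono[OF wp_frame[OF assign_prog[where xs = xs and cs = cs]]])
  fix t1 s1
  assume p1: "(t1 \<le> length xs * (40 * length cs + 60) + 20 \<and>
       (\<forall>j<length xs. nearest d cs (xs ! j) (nmem s1 1 j) (rmem s1 1 j) (length cs)) \<and>
       (\<forall>c. nmem s1 4 c = card {j. j < length xs \<and> nmem s1 1 j = c})) \<and> frame assign_prog s s1"
  have s: "nmem s 0 0 = n" "nmem s 0 2 = z" "nmem s 0 3 = m" "rmem s 0 0 = \<epsilon>"
    by (simp_all add: s_def n_def initial_state_def)
  have f1: "nmem s1 0 = nmem s 0" "rmem s1 0 = rmem s 0" "nmem s1 5 = (\<lambda>_. 0)"
      "nmem s1 9 = (\<lambda>_. 0)" "nmem s1 10 = (\<lambda>_. 0)" "pmem s1 0 = pmem s 0"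
    using p1 by (simp_all add: prog_frame s_def initial_state_def)
  show "wp d sub (bound_prog g b) (\<lambda>t2. wp d sub order_prog (\<lambda>t3. wp d sub split_prog (\<lambda>t4 s'.
    t1 + (t2 + (t3 + t4)) \<le> 1000 * (n * (L + 1 + length cs)) \<and>
    (\<exists>\<nu> f \<pi> K i. (\<forall>j<n. nearest d cs (xs ! j) (\<nu> j) (f j) (length cs)) \<and> descending n \<pi> f \<and>
       i \<le> z \<and> K = K0 * real b ^ i \<and> (i = z \<or> real n \<le> K) \<and>
       (let Q = central K \<nu> \<pi> n; fs = picked (Not \<circ> Q) \<pi> xs n; ds = picked Q \<pi> xs n in
         holds_points s' 2 fs \<and> nmem s' 9 0 = length fs \<and>
         holds_points s' 3 ds \<and> nmem s' 10 0 = length ds)) \<and>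
    nmem s' 0 = nmem s 0 \<and> rmem s' 0 = rmem s 0))) s1"
  proof (rule wp_mono[OF wp_frame[OF bound_prog[where L = L]]])
    fix t2 s2
    assume p2: "(t2 \<le> 40 * L + 60 \<and> (\<exists>i\<le>nmem s1 0 2. rmem s2 3 0 = K0 * real b ^ i \<and>
       (i = nmem s1 0 2 \<or> real (nmem s1 0 0) \<le> rmem s2 3 0))) \<and> frame (bound_prog g b) s1 s2"
    then obtain i where i: "i \<le> z" "rmem s2 3 0 = K0 * real b ^ i" "i = z \<or> real n \<le> rmem s2 3 0"
      using f1 s by auto
    have f2: "nmem s2 0 = nmem s 0" "rmem s2 0 = rmem s 0" "nmem s2 5 = (\<lambda>_. 0)"
      "nmem s2 9 = (\<lambda>_. 0)" "nmem s2 10 = (\<lambda>_. 0)" "pmem s2 0 = pmem s 0"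
      "nmem s2 1 = nmem s1 1" "rmem s2 1 = rmem s1 1" "nmem s2 4 = nmem s1 4"
      using p2 f1 by (simp_all add: prog_frame)
    show "wp d sub order_prog (\<lambda>t3. wp d sub split_prog (\<lambda>t4 s'.
      t1 + (t2 + (t3 + t4)) \<le> 1000 * (n * (L + 1 + length cs)) \<and>
      (\<exists>\<nu> f \<pi> K i. (\<forall>j<n. nearest d cs (xs ! j) (\<nu> j) (f j) (length cs)) \<and> descending n \<pi> f \<and>
         i \<le> z \<and> K = K0 * real b ^ i \<and> (i = z \<or> real n \<le> K) \<and>
         (let Q = central K \<nu> \<pi> n; fs = picked (Not \<circ> Q) \<pi> xs n; ds = picked Q \<pi> xs n in
           holds_points s' 2 fs \<and> nmem s' 9 0 = length fs \<and>
           holds_points s' 3 ds \<and> nmem s' 10 0 = length ds)) \<and>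
      nmem s' 0 = nmem s 0 \<and> rmem s' 0 = rmem s 0)) s2"
    proof (rule wp_mono[OF wp_frame[OF order_prog[where n = n and L = L]]])
      fix t3 s3
      assume p3: "(t3 \<le> 700 * (n * (L + 1)) \<and> descending n (nmem s3 3) (rmem s2 1)) \<and>
        frame order_prog s2 s3"
      then have f3: "nmem s3 0 = nmem s 0" "rmem s3 0 = rmem s 0" "nmem s3 5 = (\<lambda>_. 0)"
        "nmem s3 9 = (\<lambda>_. 0)" "nmem s3 10 = (\<lambda>_. 0)" "pmem s3 0 = pmem s 0"
        "nmem s3 1 = nmem s1 1" "rmem s3 1 = rmem s1 1" "nmem s3 4 = nmem s1 4" "rmem s3 3 = rmem s2 3"
        using f2 by (simp_all add: prog_frame)
      show "wp d sub split_prog (\<lambda>t4 s'.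
        t1 + (t2 + (t3 + t4)) \<le> 1000 * (n * (L + 1 + length cs)) \<and>
        (\<exists>\<nu> f \<pi> K i. (\<forall>j<n. nearest d cs (xs ! j) (\<nu> j) (f j) (length cs)) \<and> descending n \<pi> f \<and>
           i \<le> z \<and> K = K0 * real b ^ i \<and> (i = z \<or> real n \<le> K) \<and>
           (let Q = central K \<nu> \<pi> n; fs = picked (Not \<circ> Q) \<pi> xs n; ds = picked Q \<pi> xs n in
             holds_points s' 2 fs \<and> nmem s' 9 0 = length fs \<and>
             holds_points s' 3 ds \<and> nmem s' 10 0 = length ds)) \<and>
        nmem s' 0 = nmem s 0 \<and> rmem s' 0 = rmem s 0) s3"
      proof (rule wp_mono[OF wp_frame[OF split_prog[where xs = xs]]])
        fix t4 s4
        let ?Q = "central (rmem s3 3 0) (nmem s3 1) (nmem s3 3) (length xs)"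
        assume p4: "(t4 \<le> 80 * length xs + 20 \<and>
          (let fs = picked (Not \<circ> ?Q) (nmem s3 3) xs (length xs); ds = picked ?Q (nmem s3 3) xs (length xs)
           in holds_points s4 2 fs \<and> nmem s4 9 0 = length fs \<and>
              holds_points s4 3 ds \<and> nmem s4 10 0 = length ds)) \<and> frame split_prog s3 s4"
        have f4: "nmem s4 0 = nmem s 0" "rmem s4 0 = rmem s 0"
          using p4 f3 by (simp_all add: prog_frame)
        have t: "t1 + (t2 + (t3 + t4)) \<le> 1000 * (n * (L + 1 + length cs))"
        proof -
          have eq: "n * (L + 1 + length cs) = n * L + n + n * length cs" by (simp add: algebra_simps)
          have "t1 + (t2 + (t3 + t4)) \<le>
              40 * (n * length cs) + 60 * n + 20 + (40 * L + 60) + 700 * (n * L) + 700 * n + 80 * n + 20"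
            using p1 p2 p3 p4 by (simp add: n_def algebra_simps)
          also have "\<dots> \<le> 40 * (n * length cs) + 740 * (n * L) + 940 * n"
            using n(1) mult_le_mono1[of 1 n L] unfolding n_def[symmetric] by linarith
          finally show ?thesis unfolding eq by simp
        qed
        show "t1 + (t2 + (t3 + t4)) \<le> 1000 * (n * (L + 1 + length cs)) \<and>
          (\<exists>\<nu> f \<pi> K i. (\<forall>j<n. nearest d cs (xs ! j) (\<nu> j) (f j) (length cs)) \<and> descending n \<pi> f \<and>
             i \<le> z \<and> K = K0 * real b ^ i \<and> (i = z \<or> real n \<le> K) \<and>
             (let Q = central K \<nu> \<pi> n; fs = picked (Not \<circ> Q) \<pi> xs n; ds = picked Q \<pi> xs n in
               holds_points s4 2 fs \<and> nmem s4 9 0 = length fs \<and>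
               holds_points s4 3 ds \<and> nmem s4 10 0 = length ds)) \<and>
          nmem s4 0 = nmem s 0 \<and> rmem s4 0 = rmem s 0"
          apply (intro conjI t f4)
          apply (rule exI[of _ "nmem s1 1"], rule exI[of _ "rmem s1 1"], rule exI[of _ "nmem s3 3"],
            rule exI[of _ "rmem s2 3 0"], rule exI[of _ i])
          using p1 p3 p4 i f2 f3 by (auto simp: n_def)
      next
        show "holds_points s3 0 xs"
          by (simp add: holds_points_def f3 s_def initial_state_def)
        show "nmem s3 3 t < length xs" if "t < length xs" for t
          using p3 that by (auto simp: descending_def n_def bij_betw_def)
      qed (use p1 f3 s in \<open>simp_all add: n_def csize_def\<close>)
    next
      show "0 \<le> rmem s2 1 u" if "u < n" for u
        using p1 pos f2 that by (simp add: n_def nearest_def)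
    qed (use f2 s n in \<open>simp_all add: n_def\<close>)
  qed (use f1 s K0 b n in \<open>simp_all add: n_def\<close>)
qed (use l in \<open>simp_all add: s_def initial_state_def holds_points_def\<close>)

section \<open>Correctness\<close>

lemma dist_to_nearest:
  assumes "nearest d cs x i r (length cs)"
  shows "dist_to d x (set cs) = r"
proof -
  have "Min (d x ` set cs) = d x (cs ! i)"
  proof (rule Min_eqI)
    show "d x (cs ! i) \<in> d x ` set cs"
      using assms by (intro imageI nth_mem) (simp add: nearest_def)
  qed (use assms in \<open>auto simp: nearest_def in_set_conv_nth\<close>)
  then show ?thesis using assms by (simp add: dist_to_def nearest_def)
qed

lemma picked_facts:
  assumes xs: "distinct xs" "length xs = n" and \<pi>: "bij_betw \<pi> {..<n} {..<n}"
  shows set_picked: "set (picked p \<pi> xs n) = (\<lambda>t. xs ! \<pi> t) ` {t. t < n \<and> p t}"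
    and distinct_picked: "distinct (picked p \<pi> xs n)"
    and length_picked: "length (picked p \<pi> xs n) = card {t. t < n \<and> p t}"
    and picked_disjoint: "set (picked (Not \<circ> p) \<pi> xs n) \<inter> set (picked p \<pi> xs n) = {}"
    and picked_union: "set (picked (Not \<circ> p) \<pi> xs n) \<union> set (picked p \<pi> xs n) = set xs"
proof -
  have img: "\<pi> ` {..<n} = {..<n}" and inj: "inj_on \<pi> {..<n}" using \<pi> by (auto simp: bij_betw_def)
  have "inj_on (\<lambda>t. xs ! \<pi> t) {..<n}"
  proof (rule inj_onI)
    fix t t' assume "t \<in> {..<n}" "t' \<in> {..<n}" "xs ! \<pi> t = xs ! \<pi> t'"
    then have "\<pi> t = \<pi> t'" using xs img by (metis imageI lessThan_iff nth_eq_iff_index_eq)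
    then show "t = t'" using \<open>t \<in> _\<close> \<open>t' \<in> _\<close> inj by (auto dest: inj_onD)
  qed
  then have inj': "t = t'" if "xs ! \<pi> t = xs ! \<pi> t'" "t < n" "t' < n" for t t'
    using that by (auto dest: inj_onD)
  show set: "set (picked p \<pi> xs n) = (\<lambda>t. xs ! \<pi> t) ` {t. t < n \<and> p t}" for p
    by (auto simp: picked_def)
  show "distinct (picked p \<pi> xs n)"
    by (auto simp: picked_def distinct_map intro!: inj_onI inj')
  show "length (picked p \<pi> xs n) = card {t. t < n \<and> p t}"
    by (simp add: picked_def length_filter_conv_card cong: conj_cong)
  show "set (picked (Not \<circ> p) \<pi> xs n) \<inter> set (picked p \<pi> xs n) = {}"
    unfolding set using inj' by (auto dest: inj')
  have "set (picked (Not \<circ> p) \<pi> xs n) \<union> set (picked p \<pi> xs n) = (\<lambda>t. xs ! \<pi> t) ` {..<n}"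
    unfolding set by auto
  also have "\<dots> = (!) xs ` {..<n}" by (simp only: image_image[symmetric] img)
  also have "\<dots> = set xs" using xs(2) by (auto simp: set_conv_nth)
  finally show "set (picked (Not \<circ> p) \<pi> xs n) \<union> set (picked p \<pi> xs n) = set xs" .
qed

section \<open>Ranks within clusters and the number of peeled points\<close>

lemma crank_less_csize:
  assumes \<pi>: "bij_betw \<pi> {..<n} {..<n}" and t: "t < n"
  shows "crank \<nu> \<pi> t < csize \<nu> n (\<nu> (\<pi> t))"
proof -
  have img: "\<pi> ` {..<n} = {..<n}" and inj: "inj_on \<pi> {..<n}" using \<pi> by (auto simp: bij_betw_def)
  let ?A = "{t'. t' < t \<and> \<nu> (\<pi> t') = \<nu> (\<pi> t)}"
  have "crank \<nu> \<pi> t = card (\<pi> ` ?A)"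
    unfolding crank_def using t by (intro card_image[symmetric] inj_on_subset[OF inj]) auto
  also have "\<dots> < csize \<nu> n (\<nu> (\<pi> t))"
    unfolding csize_def
  proof (rule psubset_card_mono)
    have "\<pi> t \<notin> \<pi> ` ?A" using inj t by (auto dest!: inj_onD)
    moreover have "\<pi> t < n" "\<pi> ` ?A \<subseteq> {..<n}" using img t by auto
    ultimately show "\<pi> ` ?A \<subset> {j. j < n \<and> \<nu> j = \<nu> (\<pi> t)}" by auto
  qed simp
  finally show ?thesis .
qed

lemma crank_inj:
  assumes "\<nu> (\<pi> t) = \<nu> (\<pi> t')" "crank \<nu> \<pi> t = crank \<nu> \<pi> t'"
  shows "t = t'"
proof -
  have "crank \<nu> \<pi> u < crank \<nu> \<pi> u'" if "u < u'" "\<nu> (\<pi> u) = \<nu> (\<pi> u')" for u u'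
    unfolding crank_def by (rule psubset_card_mono) (use that in auto)
  from this[of t t'] this[of t' t] assms show ?thesis by (metis less_irrefl nat_neq_iff)
qed

text \<open>Ranks are distinct within a cluster. With \<open>k\<close> the integer part of
  \<open>K\<close>, those of peeled points are among the first \<open>k + 1\<close> or the last
  \<open>k\<close>, and \<open>2 * k + 1 \<le> 3 * K\<close> because
  \<open>1 \<le> K\<close>.\<close>

lemma card_not_central:
  assumes \<pi>: "bij_betw \<pi> {..<n} {..<n}" and \<nu>: "\<And>j. j < n \<Longrightarrow> \<nu> j < l" and K: "1 \<le> K"
  shows "real (card {t. t < n \<and> \<not> central K \<nu> \<pi> n t}) \<le> real l * (3 * K)"
proof -
  have img: "\<pi> ` {..<n} = {..<n}" using \<pi> by (auto simp: bij_betw_def)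
  let ?A = "\<lambda>c. {t. t < n \<and> \<nu> (\<pi> t) = c \<and> \<not> central K \<nu> \<pi> n t}"
  define k where "k = nat \<lfloor>K\<rfloor>"
  have k: "real k \<le> K" "K < real k + 1" using K by (simp_all add: k_def)
  have one: "real (card (?A c)) \<le> 3 * K" for c
  proof -
    have sub: "crank \<nu> \<pi> ` ?A c \<subseteq> {..k} \<union> {csize \<nu> n c - k..<csize \<nu> n c}"
    proof
      fix r assume "r \<in> crank \<nu> \<pi> ` ?A c"
      then obtain t where t: "t < n" "\<nu> (\<pi> t) = c" "\<not> central K \<nu> \<pi> n t" "r = crank \<nu> \<pi> t" by blast
      then have lt: "r < csize \<nu> n c" using crank_less_csize[OF \<pi>, of t \<nu>] by simp
      have "real r < K \<or> real (csize \<nu> n c - r) \<le> K" using t by (auto simp: central_def)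
      then have "real r < real (Suc k) \<or> real (csize \<nu> n c - r) < real (Suc k)" using k by auto
      then have "r < Suc k \<or> csize \<nu> n c - r < Suc k" by (simp only: of_nat_less_iff)
      with lt show "r \<in> {..k} \<union> {csize \<nu> n c - k..<csize \<nu> n c}" by auto
    qed
    have "card (?A c) = card (crank \<nu> \<pi> ` ?A c)"
      by (rule card_image[symmetric], rule inj_onI, rule crank_inj[of \<nu> \<pi>]) auto
    also have "\<dots> \<le> card ({..k} \<union> {csize \<nu> n c - k..<csize \<nu> n c})"
      using sub by (intro card_mono) auto
    also have "\<dots> \<le> card {..k} + card {csize \<nu> n c - k..<csize \<nu> n c}" by (rule card_Un_le)
    also have "\<dots> \<le> 2 * k + 1" by simp
    finally have "real (card (?A c)) \<le> 2 * real k + 1" by linarith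
    then show ?thesis using k K by linarith
  qed
  have "\<nu> (\<pi> t) < l" if "t < n" for t using that img by (intro \<nu>) auto
  then have "{t. t < n \<and> \<not> central K \<nu> \<pi> n t} = (\<Union>c<l. ?A c)" by auto
  then have "card {t. t < n \<and> \<not> central K \<nu> \<pi> n t} \<le> (\<Sum>c<l. card (?A c))"
    by (simp add: card_UN_le)
  then have "real (card {t. t < n \<and> \<not> central K \<nu> \<pi> n t}) \<le> (\<Sum>c<l. real (card (?A c)))"
    unfolding of_nat_sum[symmetric] by (simp only: of_nat_le_iff)
  also have "\<dots> \<le> (\<Sum>c<l. 3 * K)" by (intro sum_mono one)
  finally show ?thesis by simp
qed

text \<open>The points before the first central one are not central.\<close>

lemma card_not_central_ge:
  assumes "central K \<nu> \<pi> n t" "t < n"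
  shows "K \<le> real (card {t. t < n \<and> \<not> central K \<nu> \<pi> n t})"
proof -
  define u where "u = (LEAST u. central K \<nu> \<pi> n u)"
  have u: "central K \<nu> \<pi> n u" unfolding u_def by (rule LeastI[of "central K \<nu> \<pi> n", OF assms(1)])
  have "u \<le> t" unfolding u_def by (rule Least_le[of "central K \<nu> \<pi> n", OF assms(1)])
  have "\<not> central K \<nu> \<pi> n t'" if "t' < u" for t'
    using that unfolding u_def by (rule not_less_Least)
  then have "crank \<nu> \<pi> u \<le> card {t. t < n \<and> \<not> central K \<nu> \<pi> n t}"
    unfolding crank_def using \<open>u \<le> t\<close> assms(2) by (intro card_mono) auto
  then show ?thesis using u by (simp add: central_def)
qed

text \<open>These are the sets needed for \<open>dense_point_negligible\<close>: the points of the
  cluster that precede \<open>x\<close> in the order, and the others, \<open>x\<close> among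
  them.\<close>

lemma central_witnesses:
  assumes xs: "distinct xs" "length xs = n" and desc: "descending n \<pi> f"
    and near: "\<And>j. j < n \<Longrightarrow> nearest d cs (xs ! j) (\<nu> j) (f j) (length cs)"
    and t: "t < n" "central K \<nu> \<pi> n t"
  defines "x \<equiv> xs ! \<pi> t" and "c \<equiv> cs ! \<nu> (\<pi> t)"
  shows "\<exists>A B. A \<subseteq> set xs \<and> K \<le> real (card A) \<and> (\<forall>y\<in>A. d x c \<le> dist_to d y (set cs)) \<and>
    B \<subseteq> set xs \<and> K \<le> real (card B) \<and> (\<forall>y\<in>B. d y c \<le> d x c)"
proof -
  have \<pi>: "bij_betw \<pi> {..<n} {..<n}" and le: "\<And>t t'. t < n \<Longrightarrow> t' < t \<Longrightarrow> f (\<pi> t) \<le> f (\<pi> t')"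
    using desc by (auto simp: descending_def)
  have img: "\<pi> ` {..<n} = {..<n}" and inj: "inj_on \<pi> {..<n}" using \<pi> by (auto simp: bij_betw_def)
  have \<pi>n: "\<pi> t' < n" if "t' < n" for t' using img that by auto
  define P where "P = \<pi> ` {t'. t' < t \<and> \<nu> (\<pi> t') = \<nu> (\<pi> t)}"
  define R where "R = {j. j < n \<and> \<nu> j = \<nu> (\<pi> t)} - P"
  have cP: "card P = crank \<nu> \<pi> t"
    unfolding crank_def P_def using t by (intro card_image inj_on_subset[OF inj]) auto
  have P: "P \<subseteq> {j. j < n \<and> \<nu> j = \<nu> (\<pi> t)}" using \<pi>n t by (auto simp: P_def)
  then have "card R = csize \<nu> n (\<nu> (\<pi> t)) - crank \<nu> \<pi> t"
    unfolding R_def csize_def cP[symmetric] by (intro card_Diff_subset) (auto intro: finite_subset)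
  then have K: "K \<le> real (card P)" "K \<le> real (card R)" using t(2) cP by (auto simp: central_def)
  have cimg: "card ((!) xs ` J) = card J" if "J \<subseteq> {..<n}" for J
    using that xs by (intro card_image inj_on_nth) auto
  have sub: "P \<subseteq> {..<n}" "R \<subseteq> {..<n}" using P by (auto simp: R_def)
  have fx: "f (\<pi> t) = d x c" using near[OF \<pi>n[OF t(1)]] by (simp add: nearest_def x_def c_def)
  \<comment> \<open>For every point \<open>f\<close> is its distance to the whole of
    \<open>cs\<close>, not merely to the centre of this cluster.\<close>
  have "d x c \<le> dist_to d (xs ! j) (set cs)" if "j \<in> P" for j
  proof -
    from that obtain t' where "t' < t" "j = \<pi> t'" by (auto simp: P_def)
    with le[OF t(1)] have "f (\<pi> t) \<le> f j" by simp
    moreover have "j < n" using that sub by auto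
    ultimately show ?thesis using dist_to_nearest[OF near] fx by simp
  qed
  moreover have "d (xs ! j) c \<le> d x c" if "j \<in> R" for j
  proof -
    have j: "j < n" "\<nu> j = \<nu> (\<pi> t)" "j \<notin> P" using that by (auto simp: R_def)
    then obtain t' where t': "t' < n" "j = \<pi> t'" using img by (metis imageE lessThan_iff)
    with j have "\<not> t' < t" by (auto simp: P_def)
    then have "f j \<le> f (\<pi> t)" using le[of t' t] t' by (cases "t = t'") auto
    then show ?thesis using near[OF j(1)] fx j(2) by (simp add: nearest_def c_def)
  qed
  moreover have "(!) xs ` P \<subseteq> set xs" "(!) xs ` R \<subseteq> set xs" using sub xs(2) by auto
  ultimately show ?thesis
    using K cimg[OF sub(1)] cimg[OF sub(2)]
    by (intro exI[of _ "(!) xs ` P"] exI[of _ "(!) xs ` R"]) auto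
qed

lemma returns_store_result: "returns r W \<Longrightarrow> returns (store_result 0 r s) W"
  by (auto simp: returns_def store_result_def holds_points_def)

context Metric_space
begin

text \<open>This settles the case without central points, where everything is peeled.\<close>

lemma coreset_refl:
  assumes X: "finite X" and k: "1 \<le> k" and \<epsilon>: "0 < \<epsilon>"
  shows "coreset M d \<epsilon> k z m (unweighted X) (unweighted X)"
proof -
  have "0 \<le> robust_cost d z h (unweighted X) C" if "C \<in> center_sets M k" "0 \<le> h" for C h
    using that X center_setsD[OF that(1) k] by (intro robust_cost_nonneg dist_to_nonneg) auto
  then show ?thesis using X \<epsilon> by (auto simp: coreset_def algebra_simps)
qed

text \<open>The lower bound on \<open>K\<close> is assumed only for \<open>K < n\<close>, since the
  computation of \<open>K\<close> may have stopped early. A central point, which exists as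
  \<open>ds\<close> is nonempty, forces \<open>K < n\<close>.\<close>

lemma coreset_peeled:
  fixes xs :: "'a list"
  assumes xs: "distinct xs" "length xs = n" "set xs \<subseteq> M" and cs: "set cs \<subseteq> M"
    and desc: "descending n \<pi> f"
    and near: "\<And>j. j < n \<Longrightarrow> nearest d cs (xs ! j) (\<nu> j) (f j) (length cs)"
    and k: "1 \<le> k" and m: "1 \<le> m" and \<epsilon>: "0 < \<epsilon>" "\<epsilon> < 1" and \<alpha>: "1 \<le> \<alpha>" and \<gamma>: "1 \<le> \<gamma>"
    and apx: "approx_solution M d \<alpha> \<beta> \<gamma> k z m (set cs) (unweighted (set xs))"
    and K: "K < real n \<Longrightarrow> \<gamma> * real m + 4 ^ z * \<alpha> * real m / (\<epsilon> / 3) \<le> K"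
    and fs: "fs = picked (Not \<circ> central K \<nu> \<pi> n) \<pi> xs n" and ds: "ds = picked (central K \<nu> \<pi> n) \<pi> xs n"
    and ne: "ds \<noteq> []" and W: "coreset M d (\<epsilon> / 3) k z 0 W (unweighted (set ds))"
  shows "coreset M d \<epsilon> k z m (wunion (set fs) W) (unweighted (set xs))"
proof -
  have \<pi>: "bij_betw \<pi> {..<n} {..<n}" using desc by (simp add: descending_def)
  note p = picked_facts[OF xs(1,2) \<pi>]
  have un: "set fs \<union> set ds = set xs" and disj: "set fs \<inter> set ds = {}"
    unfolding fs ds by (rule p)+
  have dsD: "\<exists>t. x = xs ! \<pi> t \<and> t < n \<and> central K \<nu> \<pi> n t" if "x \<in> set ds" for x
    using that unfolding ds p(1) by auto
  from ne obtain t0 where t0: "t0 < n" "central K \<nu> \<pi> n t0" using dsD[of "hd ds"] by auto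
  have "csize \<nu> n c \<le> n" for c
    unfolding csize_def by (rule order_trans[OF card_mono[of "{..<n}"]]) auto
  then have "real (csize \<nu> n c - r) \<le> real n" for c r
    by (simp add: diff_le_self order_trans[of _ "csize \<nu> n c"])
  then have "K < real n" using t0(2) unfolding central_def by (meson less_le_trans)
  from K[OF this] have K': "\<gamma> * real m + 4 ^ z * \<alpha> * real m / (\<epsilon> / 3) \<le> K" .
  have "0 \<le> 4 ^ z * \<alpha> * real m / (\<epsilon> / 3)" using \<alpha> \<epsilon> by simp
  moreover have "real m \<le> \<gamma> * real m" using \<gamma> m by simp
  ultimately have mK: "real m \<le> K" using K' by linarith
  have "card (set fs) = card {t. t < n \<and> \<not> central K \<nu> \<pi> n t}"
    unfolding fs distinct_card[OF p(2)] p(3) by simp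
  \<comment> \<open>One central point makes at least \<open>K\<close> points peeled, and
    \<open>m \<le> K\<close>; so every \<open>h \<le> m\<close> fits into \<open>fs\<close>.\<close>
  then have "m \<le> card (set fs)" using card_not_central_ge[OF t0(2,1)] mK by simp
  moreover have "real m * dist_to d x C ^ z \<le> (\<epsilon> / 3) * robust_cost d z h (unweighted (set xs)) C"
    if x: "x \<in> set ds" and C: "C \<in> center_sets M k" and h: "0 \<le> h" "h \<le> real m" for x C h
  proof -
    from dsD[OF x] obtain t where t: "x = xs ! \<pi> t" "t < n" "central K \<nu> \<pi> n t" by blast
    let ?c = "cs ! \<nu> (\<pi> t)"
    obtain A B where AB: "A \<subseteq> set xs" "K \<le> real (card A)" "\<forall>y\<in>A. d x ?c \<le> dist_to d y (set cs)"
      "B \<subseteq> set xs" "K \<le> real (card B)" "\<forall>y\<in>B. d y ?c \<le> d x ?c"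
      using central_witnesses[OF xs(1,2) desc near t(2,3)] unfolding t(1) by blast
    have "\<pi> t < n" using \<pi> t(2) by (auto simp: bij_betw_def)
    then have "?c \<in> M" using near cs by (auto simp: nearest_def)
    moreover have "x \<in> set xs" using x un by auto
    ultimately show ?thesis
      using AB xs \<epsilon> by (intro dense_point_negligible[where A = A and B = B and c = ?c,
          OF _ _ m k apx \<alpha> \<gamma> _ K' _ _ _ _ _ _ _ _ C h]) auto
  qed
  ultimately have "coreset M d \<epsilon> k z m (wunion (set fs) W) (unweighted (set fs \<union> set ds))"
    using k m \<epsilon> W disj un by (intro coreset_wunion) auto
  then show ?thesis by (simp add: un)
qed

lemma robust_prog:
  fixes xs cs :: "'a list" and a \<beta> \<gamma> \<epsilon> :: real and k z m g b L :: nat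
  assumes xs: "distinct xs" "set xs \<subseteq> M" "1 \<le> length xs" "length xs \<le> 2 ^ L"
    and k: "1 \<le> k" and m: "1 \<le> m" and \<epsilon>: "0 < \<epsilon>" "\<epsilon> < 1" and a: "0 \<le> a" and \<gamma>: "1 \<le> \<gamma>"
    and apx: "approx_solution M d (2 powr (a * real z)) \<beta> \<gamma> k z m (set cs) (unweighted (set xs))"
    and g: "\<gamma> + 3 \<le> real g" and b: "4 * 2 powr a \<le> real b"
    and sub: "\<And>ds. distinct ds \<Longrightarrow> set ds \<subseteq> set xs \<Longrightarrow> ds \<noteq> [] \<Longrightarrow>
      \<exists>t r W. sub (\<epsilon> / 3) k z ds t r \<and> returns r W \<and>
        coreset M d (\<epsilon> / 3) k z 0 W (unweighted (set ds)) \<and> real (card (fst W)) \<le> B \<and> real t \<le> T"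
    and BT: "0 \<le> B" "0 \<le> T"
  defines "n \<equiv> length xs"
  shows "\<exists>t q r S.
    exec d sub (robust_prog g b) (initial_state [length xs, k, z, m, length cs] [\<epsilon>] [xs, cs]) t q r \<and>
    returns r S \<and> coreset M d \<epsilon> k z m S (unweighted (set xs)) \<and> q \<le> 1 \<and>
    real t \<le> real (1000 * (n * (L + 1 + length cs)) + 200 * n) + T \<and>
    real (card (fst S)) \<le> real (length cs) * (3 * (real g * real m / \<epsilon> * real b ^ z)) + B"
proof -
  let ?s = "initial_state [n, k, z, m, length cs] [\<epsilon>] [xs, cs]"
  let ?c1 = "Cond (NLess (NConst 0) (nvar 10))
    (Invoke (RDiv (rvar 0) (ROfNat (NConst 3))) (NGet 0 (NConst 1)) (NGet 0 (NConst 2)) 3 (nvar 10) 0)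
    (NAsg 0 (NConst 0) (NConst 0))"
  define \<alpha> where "\<alpha> = 2 powr (a * real z)"
  have \<alpha>: "1 \<le> \<alpha>" using a by (simp add: \<alpha>_def ge_one_powr_ge_zero)
  have "1 \<le> (2::real) powr a" using a by (simp add: ge_one_powr_ge_zero)
  then have b2: "4 \<le> real b" using b by linarith
  have cs: "set cs \<subseteq> M" "1 \<le> length cs" using apx by (auto simp: approx_solution_def Suc_le_eq)
  define K0 where "K0 = real g * real m / \<epsilon>"
  have K0: "1 \<le> K0"
  proof -
    have "1 * 1 \<le> real g * real m" using g \<gamma> m by (intro mult_mono) auto
    then show ?thesis using \<epsilon> by (simp add: K0_def)
  qed
  have "2 \<le> b" using b2 by simp
  obtain t1 s1 \<nu> f \<pi> K i where
    e1: "exec d sub (prep_prog g b) ?s t1 0 s1" and t1: "t1 \<le> 1000 * (n * (L + 1 + length cs))"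
    and near': "\<forall>j<n. nearest d cs (xs ! j) (\<nu> j) (f j) (length cs)"
    and desc: "descending n \<pi> f" and i: "i \<le> z" "K = K0 * real b ^ i" "i = z \<or> real n \<le> K"
    and lists: "let Q = central K \<nu> \<pi> n; fs = picked (Not \<circ> Q) \<pi> xs n; ds = picked Q \<pi> xs n in
         holds_points s1 2 fs \<and> nmem s1 9 0 = length fs \<and>
         holds_points s1 3 ds \<and> nmem s1 10 0 = length ds"
    and s1: "nmem s1 0 = nmem ?s 0" "rmem s1 0 = rmem ?s 0"
    using prep_prog[where d = d and k = k and z = z and sub = sub, OF xs(3,4) cs(2) K0_def K0 \<open>2 \<le> b\<close> nonneg, unfolded wp_def, folded n_def]
    apply (elim exE conjE)
    apply (rule that)
    apply assumption+
    done
  have near: "nearest d cs (xs ! j) (\<nu> j) (f j) (length cs)" if "j < n" for j using near' that by blast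
  define fs where "fs = picked (Not \<circ> central K \<nu> \<pi> n) \<pi> xs n"
  define ds where "ds = picked (central K \<nu> \<pi> n) \<pi> xs n"
  have h: "holds_points s1 2 fs" "nmem s1 9 0 = length fs" "holds_points s1 3 ds" "nmem s1 10 0 = length ds"
    using lists by (simp_all add: Let_def fs_def ds_def)
  have \<pi>: "bij_betw \<pi> {..<n} {..<n}" using desc by (simp add: descending_def)
  have len_xs: "length xs = n" by (simp add: n_def)
  note p = picked_facts[OF xs(1) len_xs \<pi>]
  have fd: "distinct fs" "distinct ds" "set fs \<union> set ds = set xs" "set fs \<inter> set ds = {}"
    unfolding fs_def ds_def by (rule p)+
  have ln: "length fs \<le> n" "length ds \<le> n"
  proof -
    have "length fs = card (set fs)" "length ds = card (set ds)" "n = card (set xs)"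
      using fd xs by (simp_all add: distinct_card n_def)
    then show "length fs \<le> n" "length ds \<le> n" using fd(3) by (auto intro!: card_mono)
  qed
  have bz: "1 \<le> real b ^ j" for j using b2 by (simp add: one_le_power)
  have K1: "1 \<le> K" using mult_mono[OF K0 bz[of i]] K0 by (simp add: i(2))
  have KK: "K \<le> K0 * real b ^ z"
    unfolding i(2) using K0 b2 i(1) by (intro mult_left_mono power_increasing) auto
  have lf: "real (length fs) \<le> real (length cs) * (3 * (real g * real m / \<epsilon> * real b ^ z))"
  proof -
    have "real (length fs) \<le> real (length cs) * (3 * K)"
      using card_not_central[OF \<pi> _ K1, of \<nu> "length cs"] near
      by (simp add: fs_def p(3) nearest_def)
    also have "\<dots> \<le> real (length cs) * (3 * (K0 * real b ^ z))"
      using KK by (intro mult_left_mono) auto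
    finally show ?thesis by (simp add: K0_def)
  qed
  \<comment> \<open>Both factors are powers with exponent \<open>z\<close>; their bases multiply to
    \<open>4 * 2 powr a\<close>, which \<open>b\<close> was chosen to dominate.\<close>
  have \<alpha>b: "4 ^ z * \<alpha> \<le> real b ^ z"
  proof -
    have "4 ^ z * \<alpha> = (4 * 2 powr a) ^ z"
      by (simp add: \<alpha>_def power_mult_distrib powr_power mult.commute)
    also have "\<dots> \<le> real b ^ z" using b by (intro power_mono) auto
    finally show ?thesis .
  qed
  \<comment> \<open>\<open>K < n\<close> excludes an early stop, so the full power
    \<open>b ^ z\<close> was reached. Enlarging \<open>\<gamma> * m\<close> by the factor
    \<open>b ^ z / \<epsilon> \<ge> 1\<close> gives the summands a common factor; the
    \<open>3\<close> in \<open>g\<close> comes from \<open>\<epsilon> / 3\<close>.\<close>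
  have K: "\<gamma> * real m + 4 ^ z * \<alpha> * real m / (\<epsilon> / 3) \<le> K" if "K < real n"
  proof -
    have eq: "(\<gamma> + 3) * (real m * (real b ^ z / \<epsilon>)) =
        \<gamma> * real m * (real b ^ z / \<epsilon>) + 3 * real m * (real b ^ z / \<epsilon>)"
      by (simp only: distrib_right mult.assoc)
    have "\<gamma> * real m \<le> \<gamma> * real m * (real b ^ z / \<epsilon>)"
    proof -
      have "\<epsilon> \<le> real b ^ z" using bz[of z] \<epsilon> by linarith
      then have "1 \<le> real b ^ z / \<epsilon>" using \<epsilon> by simp
      then show ?thesis using mult_left_mono[of 1 "real b ^ z / \<epsilon>" "\<gamma> * real m"] \<gamma> by simp
    qed
    moreover have "4 ^ z * \<alpha> * real m / (\<epsilon> / 3) \<le> 3 * real m * (real b ^ z / \<epsilon>)"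
    proof -
      have "4 ^ z * \<alpha> * real m / (\<epsilon> / 3) = (3 * real m / \<epsilon>) * (4 ^ z * \<alpha>)" by simp
      also have "\<dots> \<le> (3 * real m / \<epsilon>) * real b ^ z" using \<alpha>b \<epsilon> by (intro mult_left_mono) auto
      finally show ?thesis by simp
    qed
    ultimately have "\<gamma> * real m + 4 ^ z * \<alpha> * real m / (\<epsilon> / 3) \<le> (\<gamma> + 3) * (real m * (real b ^ z / \<epsilon>))"
      unfolding eq by linarith
    also have "\<dots> \<le> real g * (real m * (real b ^ z / \<epsilon>))"
      using g \<epsilon> by (intro mult_right_mono) auto
    also have "\<dots> = K" using i that by (simp add: K0_def)
    finally show ?thesis .
  qed
  \<comment> \<open>The branches of the conditional are unified by taking \<open>W\<close> empty if
    there is no central point. The summand \<open>2 * n\<close> pays for passing the points and the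
    result.\<close>
  obtain t2 q s2 W where e2: "exec d sub ?c1 s1 t2 q s2" and q: "q \<le> 1" and W: "returns s2 W"
    and t2: "real t2 \<le> real (100 + 2 * n) + T" and cW: "real (card (fst W)) \<le> B"
    and sW: "fst W \<subseteq> set ds" and fr: "nmem s2 9 = nmem s1 9" "pmem s2 2 = pmem s1 2"
    and core: "coreset M d \<epsilon> k z m (wunion (set fs) W) (unweighted (set xs))"
  proof (cases "ds = []")
    case True
    then have "\<not> bval s1 (NLess (NConst 0) (nvar 10))" by (simp add: h)
    note ex = exec.CondFalse[OF this exec.NAsg[of d sub 0 "NConst 0" "NConst 0"]]
    have ret: "returns (nput 0 (nval s1 (NConst 0)) (nval s1 (NConst 0)) s1) (unweighted {})"
      by (simp add: returns_def put_defs holds_points_def)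
    have core: "coreset M d \<epsilon> k z m (wunion (set fs) (unweighted {})) (unweighted (set xs))"
      using coreset_refl[of "set xs" k \<epsilon> z m] k \<epsilon> fd(3) True by (simp add: wunion_unweighted)
    show ?thesis
      by (rule that[OF ex _ ret _ _ _ _ _ core]) (use BT in \<open>auto simp: put_defs\<close>)
  next
    case False
    from sub[OF fd(2) _ False] fd(3) obtain t r W where
      r: "sub (\<epsilon> / 3) k z ds t r" "returns r W" "coreset M d (\<epsilon> / 3) k z 0 W (unweighted (set ds))"
        "real (card (fst W)) \<le> B" "real t \<le> T"
      by blast
    have sW: "fst W \<subseteq> set ds" using r(3) by (auto simp: coreset_def)
    \<comment> \<open>A coreset consists of points of its dataset, so reading it back takes at most
      \<open>length ds\<close> steps.\<close>
    have "nmem r 0 0 = card (fst W)" using r(2) by (metis distinct_card returns_def)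
    also have "\<dots> \<le> length ds" using card_mono[OF _ sW] card_length[of ds] by simp
    finally have nr: "nmem r 0 0 \<le> n" using ln by simp
    have arg: "nval s1 (NGet 0 (NConst 1)) = k" "nval s1 (NGet 0 (NConst 2)) = z"
      "rval s1 (RDiv (rvar 0) (ROfNat (NConst 3))) = \<epsilon> / 3"
      by (simp_all add: s1 initial_state_def)
    have len: "length ds = nval s1 (nvar 10)" by (simp add: h)
    have b10: "bval s1 (NLess (NConst 0) (nvar 10))" using False by (simp add: h)
    note ex = exec.CondTrue[OF b10 exec.Invoke[where d = d and sub = sub and s = s1 and xs = ds and a = 3
        and e = "RDiv (rvar 0) (ROfNat (NConst 3))" and k = "NGet 0 (NConst 1)" and z = "NGet 0 (NConst 2)"
        and n = "nvar 10" and b = 0, OF len h(3) r(1)[folded arg]]]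
    show ?thesis
      by (rule that[OF ex _ returns_store_result[OF r(2)] _ r(4) sW])
        (use ln nr r(5) coreset_peeled[OF xs(1) len_xs xs(2) cs(1) desc near k m \<epsilon> \<alpha> \<gamma>
            apx[folded \<alpha>_def] K fs_def ds_def False r(3)]
          in \<open>auto simp: store_result_def\<close>)
  qed
  have "wp d sub append_prog (\<lambda>t s'. t \<le> 60 * length fs + 20 \<and> returns s' (wunion (set fs) W)) s2"
    by (rule append_prog[OF _ _ W fd(1)]) (use h fr sW fd(4) in \<open>auto simp: holds_points_def\<close>)
  then obtain t3 s3 where e3: "exec d sub append_prog s2 t3 0 s3" and t3: "t3 \<le> 60 * length fs + 20"
    and S: "returns s3 (wunion (set fs) W)"
    by (auto simp: wp_def)
  have "exec d sub (robust_prog g b) ?s (t1 + (t2 + t3)) (0 + (q + 0)) s3"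
    unfolding robust_prog_def by (rule exec.Seq[OF e1 exec.Seq[OF e2 e3]])
  moreover have "real (t1 + (t2 + t3)) \<le> real (1000 * (n * (L + 1 + length cs)) + 200 * n) + T"
  proof -
    have "t1 + t3 + 100 + 2 * n \<le> 1000 * (n * (L + 1 + length cs)) + 200 * n"
      using t1 t3 ln(1) xs(3) n_def by linarith
    then have "real (t1 + t3 + 100 + 2 * n) \<le> real (1000 * (n * (L + 1 + length cs)) + 200 * n)"
      by (simp only: of_nat_le_iff)
    then show ?thesis using t2 by simp
  qed
  moreover have "real (card (fst (wunion (set fs) W))) \<le>
      real (length cs) * (3 * (real g * real m / \<epsilon> * real b ^ z)) + B"
  proof -
    have "card (fst (wunion (set fs) W)) \<le> length fs + card (fst W)"
      using card_Un_le[of "set fs" "fst W"] card_length[of fs] by simp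
    then have "real (card (fst (wunion (set fs) W))) \<le> real (length fs) + real (card (fst W))"
      by linarith
    then show ?thesis using lf cW by linarith
  qed
  ultimately show ?thesis using S core q unfolding n_def[symmetric] add_0_right add_0_left by blast
qed

end

lemma power_le_powr_log:
  assumes b: "1 \<le> b" and z: "1 \<le> z"
  shows "b ^ z \<le> b * 2 powr (log 2 b * (real z * log 2 (real z)))"
\<comment> \<open>For \<open>z = 1\<close> the exponent \<open>z log z\<close> vanishes, hence the
  extra factor \<open>b\<close>; from \<open>z = 2\<close> on the logarithm is at least
  \<open>1\<close>.\<close>
proof (cases "z = 1")
  case False
  have lb: "0 \<le> log 2 b" using b by simp
  have "1 \<le> log 2 (real z)" using z False by (simp add: le_log_iff)
  then have "real z * 1 \<le> real z * log 2 (real z)" by (intro mult_left_mono) auto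
  then have "log 2 b * real z \<le> log 2 b * (real z * log 2 (real z))" using lb by (intro mult_left_mono) auto
  then have "2 powr (log 2 b * real z) \<le> 2 powr (log 2 b * (real z * log 2 (real z)))" by simp
  moreover have "2 powr (log 2 b * real z) = b ^ z"
    using b by (simp add: powr_powr[symmetric] powr_realpow)
  ultimately have "b ^ z \<le> 1 * 2 powr (log 2 b * (real z * log 2 (real z)))" by simp
  also have "\<dots> \<le> b * 2 powr (log 2 b * (real z * log 2 (real z)))" using b by (intro mult_right_mono) auto
  finally show ?thesis .
qed (use b in simp)

text \<open>The factor \<open>2\<close> bounds \<open>1 / ln 2\<close>, and the \<open>1\<close>
  pays for rounding up.\<close>

lemma ex_power2_ge:
  assumes "1 \<le> (n::nat)"
  shows "\<exists>L. n \<le> 2 ^ L \<and> real L \<le> 2 * ln (real n) + 1"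
proof (intro exI conjI)
  define L where "L = nat \<lceil>log 2 (real n)\<rceil>"
  have l0: "0 \<le> log 2 (real n)" using assms by simp
  then have L: "log 2 (real n) \<le> real L" "real L \<le> log 2 (real n) + 1" by (simp_all add: L_def)
  have "real n = 2 powr log 2 (real n)" using assms by simp
  also have "\<dots> \<le> 2 powr real L" using L by simp
  also have "\<dots> = real (2 ^ L)" by (simp add: powr_realpow)
  finally show "n \<le> 2 ^ L" by (simp only: of_nat_le_iff)
  have "log 2 (real n) \<le> 2 * ln (real n)"
  proof -
    have "ln (real n) * 1 \<le> ln (real n) * (2 * ln 2)"
      using assms ln2_ge_two_thirds by (intro mult_left_mono) auto
    then show ?thesis by (simp add: log_def divide_le_eq mult_ac)
  qed
  then show "real L \<le> 2 * ln (real n) + 1" using L by linarith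
qed

text \<open>Every term is compared with \<open>k * w\<close>, where \<open>w\<close> is the
  logarithmic factor: \<open>L + 1\<close> needs it twice, which gives \<open>2000\<close>, and the
  remaining \<open>200\<close> needs it once.\<close>

lemma run_time_bound:
  assumes n: "1 \<le> n" and k: "1 \<le> k" and L: "real L \<le> 2 * ln (real n) + 1" and l: "real l \<le> \<beta> * real k"
    and \<beta>: "1 \<le> \<beta>"
  shows "real (1000 * (n * (L + 1 + l)) + 200 * n)
    \<le> (2200 + 1000 * \<beta>) * (real n * real k) * (1 + ln (real n * real k)) ^ 1"
proof -
  define w where "w = 1 + ln (real n * real k)"
  have lk: "0 \<le> ln (real k)" and ln: "0 \<le> ln (real n)" using n k by auto
  have w: "w = 1 + ln (real n) + ln (real k)" using n k by (simp add: w_def ln_mult)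
  have kw: "w \<le> real k * w" "real k \<le> real k * w" "0 \<le> real k * w"
    using k lk ln w mult_right_mono[of 1 "real k" w] mult_left_mono[of 1 w "real k"] by auto
  have "real L + 1 \<le> 2 * (real k * w)" using L kw w lk ln by linarith
  moreover have "real l \<le> \<beta> * (real k * w)"
    using l \<beta> kw mult_left_mono[of "real k" "real k * w" \<beta>] by linarith
  moreover have "1 \<le> real k * w" using kw k by linarith
  ultimately have "1000 * (real L + 1 + real l) + 200 \<le> (2200 + 1000 * \<beta>) * (real k * w)"
    by (simp add: algebra_simps)
  then have "real n * (1000 * (real L + 1 + real l) + 200) \<le> real n * ((2200 + 1000 * \<beta>) * (real k * w))"
    by (intro mult_left_mono) auto
  then show ?thesis by (simp add: w_def algebra_simps)
qed

text \<open>The subroutine receives a subset of the dataset, of unknown size; monotonicity of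
  \<open>N\<close> and \<open>T\<close> in the number of points turns its bounds into bounds for
  \<open>n\<close>. The inverse precision passed on is \<open>3 / \<epsilon>\<close>, which exceeds
  \<open>1\<close>.\<close>

theorem theorem3p1:
  fixes a \<beta> \<gamma> :: real
  assumes "0 \<le> a" and "1 \<le> \<beta>" and "1 \<le> \<gamma>"
  shows "\<exists>(c_inv :: nat) (c_time :: real) (p :: nat) (c_eps_T :: real) (c_exp :: real)
           (c_size :: real) (c_eps_N :: real).
    0 < c_time \<and> 0 < c_eps_T \<and> 0 < c_exp \<and> 0 < c_size \<and> 0 < c_eps_N \<and>
    (\<forall>(V :: 'v set) d A (N :: nat \<Rightarrow> nat \<Rightarrow> real \<Rightarrow> real) (T :: nat \<Rightarrow> nat \<Rightarrow> real \<Rightarrow> real).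
      Metric_space V d \<and>
      vanilla_coreset_algorithm V d A N T \<and>
      (\<forall>k\<ge>1. \<forall>e>1. mono_on {1..} (\<lambda>n. N n k e)) \<and>
      (\<forall>k\<ge>1. \<forall>e>1. mono_on {1..} (\<lambda>n. T n k e)) \<longrightarrow>
      (\<exists>P. \<forall>\<epsilon> k z m n xs cs.
        0 < \<epsilon> \<and> \<epsilon> < 1 \<and> 1 \<le> k \<and> 1 \<le> z \<and> 1 \<le> m \<and> 1 \<le> n \<and>
        length xs = n \<and> distinct xs \<and> set xs \<subseteq> V \<and> distinct cs \<and>
        approx_solution V d (2 powr (a * real z)) \<beta> \<gamma> k z m (set cs) (unweighted (set xs)) \<longrightarrow>
        (\<exists>t q r S.
          robust_run d A P \<epsilon> k z m xs cs t q r \<and> returns r S \<and>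
          coreset V d \<epsilon> k z m S (unweighted (set xs)) \<and>
          q \<le> c_inv \<and>
          real t \<le> c_time * (real n * real k) * (1 + ln (real n * real k)) ^ p
                     + T n k (c_eps_T * (1 / \<epsilon>)) \<and>
          real (card (fst S)) \<le> 2 powr (c_exp * (real z * log 2 (real z)))
                                   * (c_size * (real k * real m * (1 / \<epsilon>)))
                                 + N n k (c_eps_N * (1 / \<epsilon>)))))"
proof -
  \<comment> \<open>The machine has only natural constants in its programs, so both parameters are
    rounded up: \<open>b\<close> is to dominate the exponentials \<open>4 ^ z\<close> and
    \<open>2 powr (a * z)\<close>, and \<open>g\<close> the two summands of
    \<open>K\<close>.\<close>
  define b where "b = nat \<lceil>4 * 2 powr a\<rceil>"
  define g where "g = nat \<lceil>\<gamma> + 3\<rceil>"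
  have b: "4 * 2 powr a \<le> real b" unfolding b_def by (rule real_nat_ceiling_ge)
  have g: "\<gamma> + 3 \<le> real g" unfolding g_def by (rule real_nat_ceiling_ge)
  have "1 \<le> (2::real) powr a" using assms(1) by (simp add: ge_one_powr_ge_zero)
  then have b4: "4 \<le> real b" using b by linarith
  show ?thesis
  proof (rule exI[of _ 1], rule exI[of _ "2200 + 1000 * \<beta>"], rule exI[of _ 1], rule exI[of _ 3],
      rule exI[of _ "log 2 (real b)"], rule exI[of _ "3 * \<beta> * real g * real b"], rule exI[of _ 3],
      intro conjI; (intro allI impI, rule exI[of _ "robust_prog g b"], intro allI impI)?)
    show "0 < 2200 + 1000 * \<beta>" using assms by simp
    show "0 < log 2 (real b)" using b4 by simp
    show "0 < 3 * \<beta> * real g * real b" using assms g b4 by (auto intro!: mult_pos_pos)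
    fix V :: "'v set" and d A and N T :: "nat \<Rightarrow> nat \<Rightarrow> real \<Rightarrow> real"
      and \<epsilon> :: real and k z m n :: nat and xs cs :: "'v list"
    assume "Metric_space V d \<and> vanilla_coreset_algorithm V d A N T \<and>
      (\<forall>k\<ge>1. \<forall>e>1. mono_on {1..} (\<lambda>n. N n k e)) \<and> (\<forall>k\<ge>1. \<forall>e>1. mono_on {1..} (\<lambda>n. T n k e))"
    then have "Metric_space V d" and alg: "vanilla_coreset_algorithm V d A N T"
      and mono: "\<And>k e. 1 \<le> k \<Longrightarrow> 1 < e \<Longrightarrow> mono_on {1..} (\<lambda>n. N n k e)"
        "\<And>k e. 1 \<le> k \<Longrightarrow> 1 < e \<Longrightarrow> mono_on {1..} (\<lambda>n. T n k e)"
      by auto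
    interpret Metric_space V d by fact
    assume "0 < \<epsilon> \<and> \<epsilon> < 1 \<and> 1 \<le> k \<and> 1 \<le> z \<and> 1 \<le> m \<and> 1 \<le> n \<and>
        length xs = n \<and> distinct xs \<and> set xs \<subseteq> V \<and> distinct cs \<and>
        approx_solution V d (2 powr (a * real z)) \<beta> \<gamma> k z m (set cs) (unweighted (set xs))"
    then have \<epsilon>: "0 < \<epsilon>" "\<epsilon> < 1" and k: "1 \<le> k" and z: "1 \<le> z" and m: "1 \<le> m" and n: "1 \<le> n"
      and xs: "length xs = n" "distinct xs" "set xs \<subseteq> V" and cs: "distinct cs"
      and apx: "approx_solution V d (2 powr (a * real z)) \<beta> \<gamma> k z m (set cs) (unweighted (set xs))"
      by auto
    have e3: "1 < 3 * (1 / \<epsilon>)" "1 / (\<epsilon> / 3) = 3 * (1 / \<epsilon>)" using \<epsilon> by (auto simp: field_simps)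
    have sub: "\<exists>t r W. vanilla_run d A (\<epsilon> / 3) k z ds t r \<and> returns r W \<and>
        coreset V d (\<epsilon> / 3) k z 0 W (unweighted (set ds)) \<and>
        real (card (fst W)) \<le> N n k (3 * (1 / \<epsilon>)) \<and> real t \<le> T n k (3 * (1 / \<epsilon>))"
      if ds: "distinct ds" "set ds \<subseteq> set xs" "ds \<noteq> []" for ds
    proof -
      have l: "1 \<le> length ds" using ds(3) by (simp add: Suc_le_eq)
      have "length ds = card (set ds)" using ds by (simp add: distinct_card)
      also have "\<dots> \<le> n" using card_mono[OF _ ds(2)] xs by (simp add: distinct_card)
      finally have ln: "length ds \<le> n" .
      have "N (length ds) k (3 * (1 / \<epsilon>)) \<le> N n k (3 * (1 / \<epsilon>))"
        "T (length ds) k (3 * (1 / \<epsilon>)) \<le> T n k (3 * (1 / \<epsilon>))"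
        using mono_onD[OF mono(1)[OF k e3(1)]] mono_onD[OF mono(2)[OF k e3(1)]] l ln n by auto
      moreover have "set ds \<subseteq> V" "0 < \<epsilon> / 3" "\<epsilon> / 3 < 1" using ds xs \<epsilon> by auto
      then have "\<exists>t r W. vanilla_run d A (\<epsilon> / 3) k z ds t r \<and> returns r W \<and>
          coreset V d (\<epsilon> / 3) k z 0 W (unweighted (set ds)) \<and>
          real (card (fst W)) \<le> N (length ds) k (1 / (\<epsilon> / 3)) \<and>
          real t \<le> T (length ds) k (1 / (\<epsilon> / 3))"
        using alg ds(1) k z l unfolding vanilla_coreset_algorithm_def by blast
      ultimately show ?thesis unfolding e3(2) by (meson order_trans)
    qed
    obtain L where L: "n \<le> 2 ^ L" "real L \<le> 2 * ln (real n) + 1" using ex_power2_ge[OF n] by blast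
    have len: "1 \<le> length xs" "length xs \<le> 2 ^ L" using n L(1) xs(1) by simp_all
    have "xs \<noteq> []" using n xs by auto
    \<comment> \<open>Nonnegativity of the bounds is needed when the subroutine is not invoked. It
      follows from the behaviour on the whole dataset, as \<open>N\<close> and \<open>T\<close>
      bound a cardinality and a time.\<close>
    from sub[OF xs(2) order_refl this]
    have NT: "0 \<le> N n k (3 * (1 / \<epsilon>))" "0 \<le> T n k (3 * (1 / \<epsilon>))"
      by (meson of_nat_0_le_iff order_trans)+
    have lcs: "real (length cs) \<le> \<beta> * real k"
      using apx cs by (simp add: approx_solution_def distinct_card)
    obtain t q r S where run: "exec d (vanilla_run d A) (robust_prog g b)
          (initial_state [length xs, k, z, m, length cs] [\<epsilon>] [xs, cs]) t q r"
      and S: "returns r S" "coreset V d \<epsilon> k z m S (unweighted (set xs))" "q \<le> 1"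
      and t: "real t \<le> real (1000 * (n * (L + 1 + length cs)) + 200 * n) + T n k (3 * (1 / \<epsilon>))"
      and size: "real (card (fst S)) \<le>
        real (length cs) * (3 * (real g * real m / \<epsilon> * real b ^ z)) + N n k (3 * (1 / \<epsilon>))"
      using robust_prog[where sub = "vanilla_run d A" and B = "N n k (3 * (1 / \<epsilon>))"
          and T = "T n k (3 * (1 / \<epsilon>))", OF xs(2,3) len k m \<epsilon> assms(1,3) apx g b sub NT]
      unfolding xs(1) by blast
    have "real (length cs) * (3 * (real g * real m / \<epsilon> * real b ^ z)) \<le>
        (\<beta> * real k) * (3 * (real g * real m / \<epsilon> *
          (real b * 2 powr (log 2 (real b) * (real z * log 2 (real z))))))"
      using lcs z b4 assms \<epsilon> by (intro mult_mono mult_left_mono power_le_powr_log) auto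
    also have "\<dots> = 2 powr (log 2 (real b) * (real z * log 2 (real z))) *
        (3 * \<beta> * real g * real b * (real k * real m * (1 / \<epsilon>)))"
      by (simp add: mult_ac)
    finally have size': "real (card (fst S)) \<le> 2 powr (log 2 (real b) * (real z * log 2 (real z))) *
        (3 * \<beta> * real g * real b * (real k * real m * (1 / \<epsilon>))) + N n k (3 * (1 / \<epsilon>))"
      using size by linarith
    show "\<exists>t q r S. robust_run d A (robust_prog g b) \<epsilon> k z m xs cs t q r \<and> returns r S \<and>
          coreset V d \<epsilon> k z m S (unweighted (set xs)) \<and> q \<le> 1 \<and>
          real t \<le> (2200 + 1000 * \<beta>) * (real n * real k) * (1 + ln (real n * real k)) ^ 1
                     + T n k (3 * (1 / \<epsilon>)) \<and>
          real (card (fst S)) \<le> 2 powr (log 2 (real b) * (real z * log 2 (real z)))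
                                   * (3 * \<beta> * real g * real b * (real k * real m * (1 / \<epsilon>)))
                                 + N n k (3 * (1 / \<epsilon>))"
      using run S t size' run_time_bound[OF n k L(2) lcs assms(2)] unfolding robust_run_def
      by (intro exI[of _ t] exI[of _ q] exI[of _ r] exI[of _ S]) auto
  qed simp_all
qed

end
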